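(* There exist Scott-continuous maps $\pi_k : N(k) \to E(k)$, one for each $k \in \mathbb{N}$, such that each $\pi_k$ is total (i.e. $\pi_k$ maps $\bar N(k)$ into $\bar E(k)$), and (i) $\pi_0 : N(0) \to E(0)$ sends each $n \in \mathbb{N}$ to its representative in $E(0)$; (ii) for each $k \in \mathbb{N}$, each $f \in \bar N(k+1)$ and each $a \in \bar N(k)$ we have $\pi_0(f(a)) = \pi_{k+1}(f)(\pi_k(a))$.
   Context: All domains are bounded-complete $\omega$-algebraic domains with the Scott topology; $D \to D'$ denotes the domain of Scott-continuous maps ordered pointwise. $\mathbb{N} = \{0,1,2,\dots\}$. Let $N(0) = \mathbb{N}_\bot$ (flat domain) and $N(k+1) = N(k) \to N(0)$. Define partial equivalence relations: $n \approx^N_0 m$ iff $n = m \in \mathbb{N}$; for $f,g \in N(k+1)$, $f \approx^N_{k+1} g$ iff for all $a,b \in N(k)$ with $a \approx^N_k b$ we have $f(a) \approx^N_0 g(b)$. Let $\bar N(k) = \{x \in N(k) : x \approx^N_k x\}$. Let $E(0)$ be the ideal completion of the poset consisting of $\mathbb{R}$ and all closed rational intervals $[p,q]$ ($p \le q$ rationals), ordered by reverse inclusion; $E(k+1) = E(k) \to E(0)$. For ideals $\alpha,\beta \in E(0)$, $\alpha \approx^E_0 \beta$ iff $\bigcap \alpha = \bigcap \beta = \{x\}$ for some real $x$; $\approx^E_{k+1}$ is defined from $\approx^E_k$ exactly as $\approx^N_{k+1}$ from $\approx^N_k$, and $\bar E(k) = \{x \in E(k) : x \approx^E_k x\}$.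 The representative of $n \in \mathbb{N}$ in $E(0)$ is the ideal $\{\mathbb{R}\} \cup \{[p,q] : p \le n \le q\}$. *)

theory Defs
  imports Complex_Main "HOL-Library.FuncSet" "HOL-Library.Countable_Set"
begin

section \<open>Domains\<close>

text \<open>A poset is given by its (reflexive) order relation \<open>r\<close>; its carrier is \<open>Field r\<close>.\<close>

definition is_lub :: "'a rel \<Rightarrow> 'a set \<Rightarrow> 'a \<Rightarrow> bool" where
  "is_lub r A x \<longleftrightarrow> x \<in> Field r \<and> (\<forall>a\<in>A. (a, x) \<in> r) \<and>
     (\<forall>y\<in>Field r. (\<forall>a\<in>A. (a, y) \<in> r) \<longrightarrow> (x, y) \<in> r)"

definition directed :: "'a rel \<Rightarrow> 'a set \<Rightarrow> bool" where
  "directed r A \<longleftrightarrow> A \<subseteq> Field r \<and> A \<noteq> {} \<and> (\<forall>a\<in>A. \<forall>b\<in>A. \<exists>c\<in>A. (a, c) \<in> r \<and> (b, c) \<in> r)"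

definition compact_elem :: "'a rel \<Rightarrow> 'a \<Rightarrow> bool" where
  "compact_elem r c \<longleftrightarrow> c \<in> Field r \<and>
     (\<forall>A x. directed r A \<longrightarrow> is_lub r A x \<longrightarrow> (c, x) \<in> r \<longrightarrow> (\<exists>a\<in>A. (c, a) \<in> r))"

text \<open>Bounded-complete \<open>\<omega>\<close>-algebraic domains.\<close>

definition scott_domain :: "'a rel \<Rightarrow> bool" where
  "scott_domain r \<longleftrightarrow> Partial_order r \<and> Field r \<noteq> {} \<and>
     (\<forall>A. directed r A \<longrightarrow> (\<exists>x. is_lub r A x)) \<and>
     (\<forall>A \<subseteq> Field r. (\<exists>y\<in>Field r. \<forall>a\<in>A. (a, y) \<in> r) \<longrightarrow> (\<exists>x. is_lub r A x)) \<and>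
     (\<forall>x\<in>Field r. directed r {c. compact_elem r c \<and> (c, x) \<in> r} \<and>
                   is_lub r {c. compact_elem r c \<and> (c, x) \<in> r} x) \<and>
     countable {c. compact_elem r c}"

definition scott_cont :: "'a rel \<Rightarrow> 'b rel \<Rightarrow> ('a \<Rightarrow> 'b) \<Rightarrow> bool" where
  "scott_cont D D' f \<longleftrightarrow> f \<in> Field D \<rightarrow> Field D' \<and>
     (\<forall>x y. (x, y) \<in> D \<longrightarrow> (f x, f y) \<in> D') \<and>
     (\<forall>A x. directed D A \<longrightarrow> is_lub D A x \<longrightarrow> is_lub D' (f ` A) (f x))"

definition scott_open :: "'a rel \<Rightarrow> 'a set \<Rightarrow> bool" where
  "scott_open D U \<longleftrightarrow> U \<subseteq> Field D \<and> (\<forall>x y. x \<in> U \<longrightarrow> (x, y) \<in> D \<longrightarrow> y \<in> U) \<and>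
     (\<forall>A x. directed D A \<longrightarrow> is_lub D A x \<longrightarrow> x \<in> U \<longrightarrow> A \<inter> U \<noteq> {})"

definition is_ideal :: "'a rel \<Rightarrow> 'a set \<Rightarrow> bool" where
  "is_ideal r I \<longleftrightarrow> directed r I \<and> (\<forall>a b. b \<in> I \<longrightarrow> (a, b) \<in> r \<longrightarrow> a \<in> I)"

definition ideal_completion :: "'a rel \<Rightarrow> 'a set rel" where
  "ideal_completion r = {(I, J). is_ideal r I \<and> is_ideal r J \<and> I \<subseteq> J}"

section \<open>Function spaces\<close>

definition cont_maps :: "'a rel \<Rightarrow> 'b rel \<Rightarrow> ('a \<Rightarrow> 'b) set" where
  "cont_maps D D' = {f \<in> extensional (Field D). scott_cont D D' f}"

definition cont_order :: "'a rel \<Rightarrow> 'b rel \<Rightarrow> ('a \<Rightarrow> 'b) rel" where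
  "cont_order D D' = {(f, g). f \<in> cont_maps D D' \<and> g \<in> cont_maps D D' \<and>
                              (\<forall>x\<in>Field D. (f x, g x) \<in> D')}"

text \<open>
  All levels of a type hierarchy over a base domain have to live in one HOL type. Elements of the
  base domain are \<open>Base x\<close>; a Scott-continuous map is an element \<open>Code c\<close>, where \<open>c\<close> is its image
  under a fixed injection of the set of Scott-continuous maps into \<open>nat set\<close>. Such an injection
  exists for all bounded-complete \<open>\<omega>\<close>-algebraic domains, and these are closed under the function
  space; see \<open>inj_on_encode\<close>, \<open>scott_domain_fun_dom\<close> and, for the two hierarchies,
  \<open>N_function_space\<close> and \<open>E_function_space\<close> below.
\<close>

datatype 'b elt = Base 'b | Code "nat set"

definition encode :: "'b elt rel \<Rightarrow> 'b elt rel \<Rightarrow> ('b elt \<Rightarrow> 'b elt) \<Rightarrow> 'b elt" where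
  "encode D D' = Code \<circ> (SOME c. inj_on c (cont_maps D D'))"

definition fun_dom :: "'b elt rel \<Rightarrow> 'b elt rel \<Rightarrow> 'b elt rel" where
  "fun_dom D D' = map_prod (encode D D') (encode D D') ` cont_order D D'"

definition app :: "'b elt rel \<Rightarrow> 'b elt rel \<Rightarrow> 'b elt \<Rightarrow> 'b elt \<Rightarrow> 'b elt" where
  "app D D' u = inv_into (cont_maps D D') (encode D D') u"

primrec hier :: "'b elt rel \<Rightarrow> nat \<Rightarrow> 'b elt rel" where
  "hier D 0 = D"
| "hier D (Suc k) = fun_dom (hier D k) D"

primrec hier_per :: "'b elt rel \<Rightarrow> ('b elt \<Rightarrow> 'b elt \<Rightarrow> bool) \<Rightarrow> nat \<Rightarrow> 'b elt \<Rightarrow> 'b elt \<Rightarrow> bool" where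
  "hier_per D R 0 = R"
| "hier_per D R (Suc k) = (\<lambda>f g.
     f \<in> Field (hier D (Suc k)) \<and> g \<in> Field (hier D (Suc k)) \<and>
     (\<forall>a\<in>Field (hier D k). \<forall>b\<in>Field (hier D k). hier_per D R k a b \<longrightarrow>
        R (app (hier D k) D f a) (app (hier D k) D g b)))"

section \<open>The hierarchies \<open>N\<close> and \<open>E\<close>\<close>

definition flat_nat :: "nat option rel" where
  "flat_nat = {(x, y). x = None \<or> x = y}"

definition N :: "nat \<Rightarrow> nat option elt rel" where
  "N = hier (map_prod Base Base ` flat_nat)"

definition N_app :: "nat \<Rightarrow> nat option elt \<Rightarrow> nat option elt \<Rightarrow> nat option elt" where
  "N_app k = app (N k) (N 0)"

definition N_per :: "nat \<Rightarrow> nat option elt \<Rightarrow> nat option elt \<Rightarrow> bool" where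
  "N_per = hier_per (N 0) (\<lambda>x y. \<exists>n. x = Base (Some n) \<and> y = Base (Some n))"

definition N_tot :: "nat \<Rightarrow> nat option elt set" where
  "N_tot k = {x \<in> Field (N k). N_per k x x}"

definition intervals :: "real set set" where
  "intervals = insert UNIV {{real_of_rat p..real_of_rat q} | p q. p \<le> q}"

definition interval_order :: "real set rel" where
  "interval_order = {(I, J). I \<in> intervals \<and> J \<in> intervals \<and> J \<subseteq> I}"

definition E :: "nat \<Rightarrow> real set set elt rel" where
  "E = hier (map_prod Base Base ` ideal_completion interval_order)"

definition E_app :: "nat \<Rightarrow> real set set elt \<Rightarrow> real set set elt \<Rightarrow> real set set elt" where
  "E_app k = app (E k) (E 0)"

definition E_per :: "nat \<Rightarrow> real set set elt \<Rightarrow> real set set elt \<Rightarrow> bool" where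
  "E_per = hier_per (E 0)
     (\<lambda>u v. u \<in> Field (E 0) \<and> v \<in> Field (E 0) \<and>
            (\<exists>\<alpha> \<beta> x. u = Base \<alpha> \<and> v = Base \<beta> \<and> \<Inter>\<alpha> = {x} \<and> \<Inter>\<beta> = {x}))"

definition E_tot :: "nat \<Rightarrow> real set set elt set" where
  "E_tot k = {x \<in> Field (E k). E_per k x x}"

definition nat_rep :: "nat \<Rightarrow> real set set" where
  "nat_rep n = insert UNIV
     {{real_of_rat p..real_of_rat q} | p q. p \<le> of_nat n \<and> of_nat n \<le> q}"

section \<open>Adequacy of the encoding\<close>

lemma lub_unique: "Partial_order r \<Longrightarrow> is_lub r A x \<Longrightarrow> is_lub r A y \<Longrightarrow> x = y"
  unfolding is_lub_def order_on_defs antisym_def by blast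

lemma po_refl: "Partial_order r \<Longrightarrow> x \<in> Field r \<Longrightarrow> (x, x) \<in> r"
  unfolding order_on_defs refl_on_def by blast

lemma po_trans: "Partial_order r \<Longrightarrow> (x, y) \<in> r \<Longrightarrow> (y, z) \<in> r \<Longrightarrow> (x, z) \<in> r"
  unfolding order_on_defs trans_def by blast

lemma po_antisym: "Partial_order r \<Longrightarrow> (x, y) \<in> r \<Longrightarrow> (y, x) \<in> r \<Longrightarrow> x = y"
  unfolding order_on_defs antisym_def by blast

lemma lub_ub: "is_lub r A x \<Longrightarrow> a \<in> A \<Longrightarrow> (a, x) \<in> r"
  unfolding is_lub_def by blast

lemma lub_least: "is_lub r A x \<Longrightarrow> y \<in> Field r \<Longrightarrow> (\<And>a. a \<in> A \<Longrightarrow> (a, y) \<in> r) \<Longrightarrow> (x, y) \<in> r"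
  unfolding is_lub_def by blast

lemma lub_field: "is_lub r A x \<Longrightarrow> x \<in> Field r"
  unfolding is_lub_def by blast

lemma is_lubI: "x \<in> Field r \<Longrightarrow> (\<And>a. a \<in> A \<Longrightarrow> (a, x) \<in> r) \<Longrightarrow>
    (\<And>y. y \<in> Field r \<Longrightarrow> (\<And>a. a \<in> A \<Longrightarrow> (a, y) \<in> r) \<Longrightarrow> (x, y) \<in> r) \<Longrightarrow> is_lub r A x"
  unfolding is_lub_def by blast

lemma FieldI12: "(x, y) \<in> r \<Longrightarrow> x \<in> Field r" "(x, y) \<in> r \<Longrightarrow> y \<in> Field r"
  by (auto intro: FieldI1 FieldI2)

lemma directed_finite_ub:
  assumes po: "Partial_order r" and d: "directed r A" and fin: "finite T"
    and T: "\<And>t. t \<in> T \<Longrightarrow> \<exists>a\<in>A. (t, a) \<in> r"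
  shows "\<exists>a\<in>A. \<forall>t\<in>T. (t, a) \<in> r"
  using fin T
proof (induction T rule: finite_induct)
  case empty
  then show ?case using d unfolding directed_def by blast
next
  case (insert t T)
  then obtain a where a: "a \<in> A" "\<forall>t\<in>T. (t, a) \<in> r" by blast
  obtain b where b: "b \<in> A" "(t, b) \<in> r" using insert.prems by blast
  obtain c where "c \<in> A" "(a, c) \<in> r" "(b, c) \<in> r"
    using d a(1) b(1) unfolding directed_def by blast
  then show ?case using a b po_trans[OF po] by blast
qed

lemma compact_finite_lub:
  assumes po: "Partial_order r" and fin: "finite T"
    and T: "\<And>t. t \<in> T \<Longrightarrow> compact_elem r t" and l: "is_lub r T x"
  shows "compact_elem r x"
  unfolding compact_elem_def
proof (intro conjI allI impI)
  show "x \<in> Field r" using l by (rule lub_field)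
  fix A y assume A: "directed r A" "is_lub r A y" "(x, y) \<in> r"
  have "\<exists>a\<in>A. (t, a) \<in> r" if "t \<in> T" for t
    using T[OF that] A po_trans[OF po lub_ub[OF l that]] unfolding compact_elem_def by blast
  then obtain a where "a \<in> A" "\<forall>t\<in>T. (t, a) \<in> r"
    using directed_finite_ub[OF po A(1) fin] by blast
  then show "\<exists>a\<in>A. (x, a) \<in> r"
    using lub_least[OF l] A(1) unfolding directed_def by blast
qed

lemma scott_domainI:
  assumes po: "Partial_order r" and ne: "Field r \<noteq> {}"
    and dl: "\<And>A. directed r A \<Longrightarrow> \<exists>x. is_lub r A x"
    and bl: "\<And>A y. A \<subseteq> Field r \<Longrightarrow> y \<in> Field r \<Longrightarrow> (\<And>a. a \<in> A \<Longrightarrow> (a, y) \<in> r) \<Longrightarrow> \<exists>x. is_lub r A x"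
    and cS: "countable S" and S: "\<And>s. s \<in> S \<Longrightarrow> compact_elem r s"
    and Sl: "\<And>x. x \<in> Field r \<Longrightarrow> is_lub r {s \<in> S. (s, x) \<in> r} x"
  shows "scott_domain r"
proof -
  have Sf: "S \<subseteq> Field r" using S unfolding compact_elem_def by blast
  have K: "directed r {c. compact_elem r c \<and> (c, x) \<in> r} \<and>
           is_lub r {c. compact_elem r c \<and> (c, x) \<in> r} x" if x: "x \<in> Field r" for x
  proof
    let ?K = "{c. compact_elem r c \<and> (c, x) \<in> r}"
    have fin: "\<exists>c\<in>?K. \<forall>t\<in>T. (t, c) \<in> r" if T: "finite T" "T \<subseteq> ?K" for T
    proof -
      have "T \<subseteq> Field r" using T unfolding compact_elem_def by blast
      then obtain c where c: "is_lub r T c" using bl[of T x] x T by blast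
      have "compact_elem r c" by (rule compact_finite_lub[OF po T(1) _ c]) (use T in blast)
      moreover have "(c, x) \<in> r" using lub_least[OF c x] T by blast
      ultimately show ?thesis using lub_ub[OF c] by blast
    qed
    show "directed r ?K"
      unfolding directed_def
    proof (intro conjI ballI)
      show "?K \<subseteq> Field r" unfolding compact_elem_def by blast
      show "?K \<noteq> {}" using fin[of "{}"] by blast
      fix a b assume "a \<in> ?K" "b \<in> ?K"
      then show "\<exists>c\<in>?K. (a, c) \<in> r \<and> (b, c) \<in> r" using fin[of "{a, b}"] by auto
    qed
    show "is_lub r ?K x"
      using Sl[OF x] S x by (intro is_lubI) (auto elim: lub_least)
  qed
  have "{c. compact_elem r c} \<subseteq> (\<lambda>T. SOME x. is_lub r T x) ` {T. finite T \<and> T \<subseteq> S}"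
  proof
    fix c assume "c \<in> {c. compact_elem r c}"
    then have c: "compact_elem r c" and cf: "c \<in> Field r" unfolding compact_elem_def by auto
    let ?S = "{s \<in> S. (s, c) \<in> r}"
    define A where "A = {x. \<exists>T. finite T \<and> T \<subseteq> ?S \<and> is_lub r T x}"
    have ex: "\<exists>x. is_lub r T x" if "T \<subseteq> ?S" for T
      using bl[of T c] that cf Sf by blast
    have le: "(x, c) \<in> r" if "x \<in> A" for x
      using that cf unfolding A_def by (blast intro: lub_least)
    have "directed r A"
      unfolding directed_def
    proof (intro conjI ballI)
      show "A \<subseteq> Field r" unfolding A_def is_lub_def by blast
      show "A \<noteq> {}" using ex[of "{}"] unfolding A_def by blast
      fix a b assume "a \<in> A" "b \<in> A"
      then obtain T U where T: "finite T" "T \<subseteq> ?S" "is_lub r T a"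
        and U: "finite U" "U \<subseteq> ?S" "is_lub r U b" unfolding A_def by blast
      obtain d where d: "is_lub r (T \<union> U) d" using ex[of "T \<union> U"] T U by blast
      have "d \<in> A" using d T U unfolding A_def by blast
      moreover have "(a, d) \<in> r" "(b, d) \<in> r"
        using lub_least[OF T(3) lub_field[OF d]] lub_least[OF U(3) lub_field[OF d]]
          lub_ub[OF d] by blast+
      ultimately show "\<exists>c\<in>A. (a, c) \<in> r \<and> (b, c) \<in> r" by blast
    qed
    moreover have "is_lub r A c"
    proof (rule is_lubI[OF cf le])
      fix y assume y: "y \<in> Field r" "\<And>a. a \<in> A \<Longrightarrow> (a, y) \<in> r"
      show "(c, y) \<in> r"
      proof (rule lub_least[OF Sl[OF cf] y(1)])
        fix s assume s: "s \<in> ?S"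
        then have sf: "s \<in> Field r" using Sf by blast
        have "is_lub r {s} s" using po_refl[OF po sf] sf by (intro is_lubI) auto
        then have "s \<in> A" unfolding A_def using s by (intro CollectI exI[of _ "{s}"]) auto
        then show "(s, y) \<in> r" by (rule y(2))
      qed
    qed
    ultimately obtain x where x: "x \<in> A" "(c, x) \<in> r"
      using c po_refl[OF po cf] unfolding compact_elem_def by blast
    then have "x = c" using le po_antisym[OF po] by blast
    then obtain T where T: "finite T" "T \<subseteq> ?S" "is_lub r T c" using x unfolding A_def by blast
    then have "(SOME x. is_lub r T x) = c"
      using lub_unique[OF po] by (blast intro: some_equality)
    then show "c \<in> (\<lambda>T. SOME x. is_lub r T x) ` {T. finite T \<and> T \<subseteq> S}" using T by blast
  qed
  moreover have "countable {T. finite T \<and> T \<subseteq> S}"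
    by (rule countable_Collect_finite_subset[OF cS])
  ultimately have "countable {c. compact_elem r c}"
    by (rule countable_subset[OF _ countable_image])
  then show ?thesis
    unfolding scott_domain_def using po ne dl bl K by blast
qed

lemma
  assumes "scott_domain r"
  shows sd_po: "Partial_order r" and sd_ne: "Field r \<noteq> {}"
    and sd_dl: "directed r A \<Longrightarrow> \<exists>x. is_lub r A x"
    and sd_bl: "A \<subseteq> Field r \<Longrightarrow> y \<in> Field r \<Longrightarrow> (\<And>a. a \<in> A \<Longrightarrow> (a, y) \<in> r) \<Longrightarrow> \<exists>x. is_lub r A x"
    and sd_dir: "x \<in> Field r \<Longrightarrow> directed r {c. compact_elem r c \<and> (c, x) \<in> r}"
    and sd_lub: "x \<in> Field r \<Longrightarrow> is_lub r {c. compact_elem r c \<and> (c, x) \<in> r} x"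
    and sd_count: "countable {c. compact_elem r c}"
  using assms unfolding scott_domain_def by blast+

text \<open>Scott continuity is continuity for the Scott topologies.\<close>

lemma scott_cont_iff_open:
  assumes D: "Partial_order D" and D': "Partial_order D'" and f: "f \<in> Field D \<rightarrow> Field D'"
  shows "scott_cont D D' f \<longleftrightarrow> (\<forall>U. scott_open D' U \<longrightarrow> scott_open D {x \<in> Field D. f x \<in> U})"
proof
  assume c: "scott_cont D D' f"
  have m: "\<And>x y. (x, y) \<in> D \<Longrightarrow> (f x, f y) \<in> D'" using c unfolding scott_cont_def by blast
  show "\<forall>U. scott_open D' U \<longrightarrow> scott_open D {x \<in> Field D. f x \<in> U}"
  proof (intro allI impI)
    fix U assume U: "scott_open D' U"
    show "scott_open D {x \<in> Field D. f x \<in> U}"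
      unfolding scott_open_def
    proof (intro conjI allI impI)
      show "{x \<in> Field D. f x \<in> U} \<subseteq> Field D" by blast
    next
      fix x y assume "x \<in> {x \<in> Field D. f x \<in> U}" "(x, y) \<in> D"
      then show "y \<in> {x \<in> Field D. f x \<in> U}"
        using m U FieldI12(2) unfolding scott_open_def by fast
    next
      fix A x assume A: "directed D A" "is_lub D A x" "x \<in> {x \<in> Field D. f x \<in> U}"
      have "directed D' (f ` A)"
        using A(1) f m unfolding directed_def by (auto simp: Pi_iff subset_iff) blast
      moreover have "is_lub D' (f ` A) (f x)" using c A unfolding scott_cont_def by blast
      ultimately have "f ` A \<inter> U \<noteq> {}" using U A(3) unfolding scott_open_def by blast
      then show "A \<inter> {x \<in> Field D. f x \<in> U} \<noteq> {}" using A(1) unfolding directed_def by blast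
    qed
  qed
next
  assume o: "\<forall>U. scott_open D' U \<longrightarrow> scott_open D {x \<in> Field D. f x \<in> U}"
  have op: "scott_open D' {z \<in> Field D'. (z, y) \<notin> D'}" if "y \<in> Field D'" for y
    unfolding scott_open_def
  proof (intro conjI allI impI)
    fix x z assume "x \<in> {z \<in> Field D'. (z, y) \<notin> D'}" "(x, z) \<in> D'"
    then show "z \<in> {z \<in> Field D'. (z, y) \<notin> D'}"
      using po_trans[OF D'] FieldI12(2) by fast
  next
    fix A x assume "directed D' A" "is_lub D' A x" "x \<in> {z \<in> Field D'. (z, y) \<notin> D'}"
    then show "A \<inter> {z \<in> Field D'. (z, y) \<notin> D'} \<noteq> {}"
      using lub_least[of D' A x y] that unfolding directed_def by blast
  qed blast
  have m: "(f x, f y) \<in> D'" if xy: "(x, y) \<in> D" for x y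
  proof (rule ccontr)
    assume n: "(f x, f y) \<notin> D'"
    have F: "x \<in> Field D" "y \<in> Field D" using xy FieldI12 by fast+
    then have "f x \<in> Field D'" "f y \<in> Field D'" using f by auto
    have "scott_open D {x \<in> Field D. f x \<in> {z \<in> Field D'. (z, f y) \<notin> D'}}"
      using o op[OF \<open>f y \<in> Field D'\<close>] by blast
    moreover have "x \<in> {x \<in> Field D. f x \<in> {z \<in> Field D'. (z, f y) \<notin> D'}}"
      using n F \<open>f x \<in> Field D'\<close> by blast
    ultimately have "(f y, f y) \<notin> D'" using xy unfolding scott_open_def by blast
    then show False using po_refl[OF D'] \<open>f y \<in> Field D'\<close> by blast
  qed
  have "is_lub D' (f ` A) (f x)" if A: "directed D A" "is_lub D A x" for A x
  proof (rule is_lubI)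
    have x: "x \<in> Field D" using A(2) by (rule lub_field)
    show fx: "f x \<in> Field D'" using x f by blast
    show "(a, f x) \<in> D'" if "a \<in> f ` A" for a using that m lub_ub[OF A(2)] by blast
    fix y assume y: "y \<in> Field D'" "\<And>a. a \<in> f ` A \<Longrightarrow> (a, y) \<in> D'"
    show "(f x, y) \<in> D'"
    proof (rule ccontr)
      assume "(f x, y) \<notin> D'"
      then have "x \<in> {x \<in> Field D. f x \<in> {z \<in> Field D'. (z, y) \<notin> D'}}" using x fx by blast
      moreover have "scott_open D {x \<in> Field D. f x \<in> {z \<in> Field D'. (z, y) \<notin> D'}}"
        using o op[OF y(1)] by blast
      ultimately have "A \<inter> {x \<in> Field D. f x \<in> {z \<in> Field D'. (z, y) \<notin> D'}} \<noteq> {}"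
        using A unfolding scott_open_def by blast
      then show False using y(2) by blast
    qed
  qed
  then show "scott_cont D D' f" unfolding scott_cont_def using f m by blast
qed

lemma cont_mapsD:
  assumes "f \<in> cont_maps D D'"
  shows "x \<in> Field D \<Longrightarrow> f x \<in> Field D'" "(x, y) \<in> D \<Longrightarrow> (f x, f y) \<in> D'"
    "directed D A \<Longrightarrow> is_lub D A x \<Longrightarrow> is_lub D' (f ` A) (f x)" "f \<in> extensional (Field D)"
  using assms unfolding cont_maps_def scott_cont_def by blast+

lemma Field_cont_order: "Partial_order D' \<Longrightarrow> Field (cont_order D D') = cont_maps D D'"
proof
  assume po: "Partial_order D'"
  show "Field (cont_order D D') \<subseteq> cont_maps D D'" by (auto simp: Field_def cont_order_def)
  have "(f, f) \<in> cont_order D D'" if "f \<in> cont_maps D D'" for f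
    using that po_refl[OF po] cont_mapsD(1)[OF that] unfolding cont_order_def by blast
  then show "cont_maps D D' \<subseteq> Field (cont_order D D')" by (blast intro: FieldI1)
qed

lemma po_cont_order:
  assumes "Partial_order D'" shows "Partial_order (cont_order D D')"
  unfolding order_on_defs
proof (intro conjI)
  show "cont_order D D' \<subseteq> Field (cont_order D D') \<times> Field (cont_order D D')"
    by (auto simp: Field_def)
  show "refl_on (Field (cont_order D D')) (cont_order D D')"
    unfolding refl_on_def Field_cont_order[OF assms]
  proof
    fix f assume f: "f \<in> cont_maps D D'"
    show "(f, f) \<in> cont_order D D'"
      using f po_refl[OF assms cont_mapsD(1)[OF f]] unfolding cont_order_def by blast
  qed
  show "trans (cont_order D D')"
    unfolding trans_def cont_order_def using po_trans[OF assms] by blast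
  show "antisym (cont_order D D')"
  proof (rule antisymI)
    fix f g assume "(f, g) \<in> cont_order D D'" "(g, f) \<in> cont_order D D'"
    then have "f \<in> extensional (Field D)" "g \<in> extensional (Field D)"
      "\<And>x. x \<in> Field D \<Longrightarrow> f x = g x"
      unfolding cont_order_def using po_antisym[OF assms] by (auto dest: cont_mapsD(4))
    then show "f = g" by (rule extensionalityI)
  qed
qed

lemma cont_order_lub:
  assumes po: "Partial_order D'" and F: "F \<subseteq> cont_maps D D'"
    and l: "\<And>x. x \<in> Field D \<Longrightarrow> \<exists>z. is_lub D' ((\<lambda>f. f x) ` F) z"
  shows "\<exists>s. is_lub (cont_order D D') F s"
    and "is_lub (cont_order D D') F g \<Longrightarrow> x \<in> Field D \<Longrightarrow> is_lub D' ((\<lambda>f. f x) ` F) (g x)"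
proof -
  define s where "s = restrict (\<lambda>x. SOME z. is_lub D' ((\<lambda>f. f x) ` F) z) (Field D)"
  have s: "is_lub D' ((\<lambda>f. f x) ` F) (s x)" if "x \<in> Field D" for x
    unfolding s_def using that someI_ex[OF l[OF that]] by simp
  have sf: "s x \<in> Field D'" if "x \<in> Field D" for x using s[OF that] by (rule lub_field)
  have ub: "(f x, s x) \<in> D'" if "f \<in> F" "x \<in> Field D" for f x
    using s that lub_ub by fast
  have le: "(s x, y) \<in> D'" if "x \<in> Field D" "y \<in> Field D'" "\<And>f. f \<in> F \<Longrightarrow> (f x, y) \<in> D'" for x y
    using lub_least[OF s[OF that(1)] that(2)] that(3) by blast
  have m: "(s x, s y) \<in> D'" if "(x, y) \<in> D" for x y
  proof -
    have xy: "x \<in> Field D" "y \<in> Field D" using that by (auto intro: FieldI12)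
    show ?thesis
    proof (rule le[OF xy(1) sf[OF xy(2)]])
      fix f assume f: "f \<in> F"
      then have "f \<in> cont_maps D D'" using F by blast
      then have "(f x, f y) \<in> D'" using that by (rule cont_mapsD(2))
      then show "(f x, s y) \<in> D'" using ub[OF f xy(2)] po_trans[OF po] by blast
    qed
  qed
  have "is_lub D' (s ` A) (s x)" if A: "directed D A" "is_lub D A x" for A x
  proof (rule is_lubI)
    have x: "x \<in> Field D" using A(2) by (rule lub_field)
    show "s x \<in> Field D'" using x by (rule sf)
    show "(a, s x) \<in> D'" if "a \<in> s ` A" for a using that m lub_ub[OF A(2)] by blast
    fix y assume y: "y \<in> Field D'" "\<And>a. a \<in> s ` A \<Longrightarrow> (a, y) \<in> D'"
    show "(s x, y) \<in> D'"
    proof (rule le[OF x y(1)])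
      fix f assume f: "f \<in> F"
      then have "f \<in> cont_maps D D'" using F by blast
      then have "is_lub D' (f ` A) (f x)" using A by (rule cont_mapsD(3))
      then show "(f x, y) \<in> D'"
      proof (rule lub_least[OF _ y(1)])
        fix b assume "b \<in> f ` A"
        then obtain a where a: "a \<in> A" "b = f a" by blast
        then have "a \<in> Field D" using A(1) unfolding directed_def by blast
        then show "(b, y) \<in> D'" using a ub[OF f] y(2) po_trans[OF po] by blast
      qed
    qed
  qed
  then have sc: "s \<in> cont_maps D D'"
    unfolding cont_maps_def scott_cont_def using m sf by (auto simp: s_def)
  have sl: "is_lub (cont_order D D') F s"
  proof (rule is_lubI)
    show "s \<in> Field (cont_order D D')" using sc Field_cont_order[OF po] by blast
    show "(f, s) \<in> cont_order D D'" if "f \<in> F" for f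
      using that F sc ub unfolding cont_order_def by blast
    fix g assume g: "g \<in> Field (cont_order D D')" "\<And>f. f \<in> F \<Longrightarrow> (f, g) \<in> cont_order D D'"
    then have "g \<in> cont_maps D D'" using Field_cont_order[OF po] by blast
    moreover have "(s x, g x) \<in> D'" if "x \<in> Field D" for x
      using g(2) that
      by (intro le[OF that cont_mapsD(1)[OF calculation that]]) (auto simp: cont_order_def)
    ultimately show "(s, g) \<in> cont_order D D'"
      using sc unfolding cont_order_def by blast
  qed
  then show "\<exists>s. is_lub (cont_order D D') F s" by blast
  show "is_lub D' ((\<lambda>f. f x) ` F) (g x)" if "is_lub (cont_order D D') F g" "x \<in> Field D"
    using lub_unique[OF po_cont_order[OF po] that(1) sl] s[OF that(2)] by simp
qed

lemma cont_order_directed: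
  assumes po: "Partial_order D'" and d: "directed (cont_order D D') F" and x: "x \<in> Field D"
  shows "directed D' ((\<lambda>f. f x) ` F)"
proof -
  have F: "F \<subseteq> cont_maps D D'" using d Field_cont_order[OF po] unfolding directed_def by blast
  have *: "\<exists>h\<in>F. (f x, h x) \<in> D' \<and> (g x, h x) \<in> D'" if "f \<in> F" "g \<in> F" for f g
    using d that x unfolding directed_def cont_order_def by blast
  show ?thesis
    using d F * cont_mapsD(1)[OF _ x, of _ D'] unfolding directed_def by blast
qed

lemma scott_domain_cont_order:
  fixes D :: "'a rel" and D' :: "'b rel"
  assumes D: "scott_domain D" and D': "scott_domain D'"
  shows "scott_domain (cont_order D D')"
proof -
  note po = sd_po[OF D] and po' = sd_po[OF D']
  note fc = Field_cont_order[OF po', of D]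
  obtain y0 where y0: "y0 \<in> Field D'" using sd_ne[OF D'] by blast
  obtain bot where bot: "is_lub D' {} bot" using sd_bl[OF D' _ y0, of "{}"] by blast
  have botf: "bot \<in> Field D'" using bot by (rule lub_field)
  have bot_le: "(bot, y) \<in> D'" if "y \<in> Field D'" for y using lub_least[OF bot that] by blast
  define st where "st a b = restrict (\<lambda>x. if (a, x) \<in> D then b else bot) (Field D)" for a b
  have st_c: "st a b \<in> cont_maps D D'" if a: "compact_elem D a" and b: "b \<in> Field D'" for a b
  proof -
    have sf: "st a b x \<in> Field D'" if "x \<in> Field D" for x
      using that b botf unfolding st_def by auto
    have m: "(st a b x, st a b y) \<in> D'" if "(x, y) \<in> D" for x y
    proof -
      have "x \<in> Field D" "y \<in> Field D" using that by (auto intro: FieldI12)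
      then show ?thesis
        using that bot_le b botf po_refl[OF po' b] po_trans[OF po _ that] unfolding st_def by auto
    qed
    have "is_lub D' (st a b ` A) (st a b x)" if A: "directed D A" "is_lub D A x" for A x
    proof (rule is_lubI)
      have x: "x \<in> Field D" using A(2) by (rule lub_field)
      show "st a b x \<in> Field D'" using x by (rule sf)
      show "(z, st a b x) \<in> D'" if "z \<in> st a b ` A" for z using that m lub_ub[OF A(2)] by blast
      fix y assume y: "y \<in> Field D'" "\<And>z. z \<in> st a b ` A \<Longrightarrow> (z, y) \<in> D'"
      show "(st a b x, y) \<in> D'"
      proof (cases "(a, x) \<in> D")
        case True
        then obtain z where z: "z \<in> A" "(a, z) \<in> D" using a A unfolding compact_elem_def by blast
        then have "st a b z = st a b x" using True x FieldI12(2)[OF z(2)] unfolding st_def by simp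
        then show ?thesis using y(2) z(1) by force
      next
        case False
        then show ?thesis using x bot_le[OF y(1)] unfolding st_def by simp
      qed
    qed
    then show ?thesis
      unfolding cont_maps_def scott_cont_def using m sf by (auto simp: st_def)
  qed
  have st_le: "(st a b, f) \<in> cont_order D D' \<longleftrightarrow> (b, f a) \<in> D'"
    if a: "compact_elem D a" and b: "b \<in> Field D'" and f: "f \<in> cont_maps D D'" for a b f
  proof
    have af: "a \<in> Field D" using a unfolding compact_elem_def by blast
    show "(b, f a) \<in> D'" if "(st a b, f) \<in> cont_order D D'"
    proof -
      have "(st a b a, f a) \<in> D'" using that af unfolding cont_order_def by blast
      then show ?thesis using af po_refl[OF po af] unfolding st_def by simp
    qed
    assume le: "(b, f a) \<in> D'"
    have "(st a b x, f x) \<in> D'" if x: "x \<in> Field D" for x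
      using x le bot_le[OF cont_mapsD(1)[OF f x]] po_trans[OF po' le cont_mapsD(2)[OF f]]
      unfolding st_def by auto
    then show "(st a b, f) \<in> cont_order D D'"
      using st_c[OF a b] f unfolding cont_order_def by blast
  qed
  define S where "S = (\<lambda>(a, b). st a b) ` ({a. compact_elem D a} \<times> {b. compact_elem D' b})"
  have dl: "\<exists>z. is_lub D' ((\<lambda>f. f x) ` F) z" if "directed (cont_order D D') F" "x \<in> Field D" for F x
    using sd_dl[OF D' cont_order_directed[OF po' that]] .
  have dF: "F \<subseteq> cont_maps D D'" if "directed (cont_order D D') F" for F
    using that fc unfolding directed_def by blast
  show ?thesis
  proof (rule scott_domainI[of _ S])
    show "Partial_order (cont_order D D')" by (rule po_cont_order[OF po'])
    have "restrict (\<lambda>x. bot) (Field D) \<in> cont_maps D D'"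
    proof -
      obtain x where "x \<in> Field D" using sd_ne[OF D] by blast
      then have "{c. compact_elem D c \<and> (c, x) \<in> D} \<noteq> {}"
        using sd_dir[OF D] unfolding directed_def by blast
      then obtain a where "compact_elem D a" by blast
      then show ?thesis using st_c[of a bot] botf unfolding st_def by simp
    qed
    then show "Field (cont_order D D') \<noteq> {}" using fc by blast
    show "\<exists>s. is_lub (cont_order D D') F s" if "directed (cont_order D D') F" for F
      by (rule cont_order_lub(1)[OF po' dF[OF that] dl[OF that]])
    show "\<exists>s. is_lub (cont_order D D') F s"
      if F: "F \<subseteq> Field (cont_order D D')" and g: "g \<in> Field (cont_order D D')"
        and le: "\<And>f. f \<in> F \<Longrightarrow> (f, g) \<in> cont_order D D'" for F g
    proof (rule cont_order_lub(1)[OF po'])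
      show Fc: "F \<subseteq> cont_maps D D'" using F fc by blast
      fix x assume x: "x \<in> Field D"
      show "\<exists>z. is_lub D' ((\<lambda>f. f x) ` F) z"
      proof (rule sd_bl[OF D', of _ "g x"])
        show "(\<lambda>f. f x) ` F \<subseteq> Field D'" using Fc x by (blast dest: cont_mapsD(1))
        show "g x \<in> Field D'" using g fc x by (blast dest: cont_mapsD(1))
        show "(a, g x) \<in> D'" if "a \<in> (\<lambda>f. f x) ` F" for a
          using that le x unfolding cont_order_def by blast
      qed
    qed
    show "countable S" unfolding S_def using sd_count[OF D] sd_count[OF D'] by auto
    show "compact_elem (cont_order D D') s" if sS: "s \<in> S" for s
    proof -
      obtain a b where ab: "compact_elem D a" "compact_elem D' b" and s: "s = st a b"
        using sS unfolding S_def by auto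
      have af: "a \<in> Field D" and bf: "b \<in> Field D'" using ab unfolding compact_elem_def by auto
      show ?thesis
        unfolding compact_elem_def s
      proof (intro conjI allI impI)
        show "st a b \<in> Field (cont_order D D')" using fc st_c[OF ab(1) bf] by blast
        fix F g assume F: "directed (cont_order D D') F" "is_lub (cont_order D D') F g"
          "(st a b, g) \<in> cont_order D D'"
        have "is_lub D' ((\<lambda>f. f a) ` F) (g a)"
          by (rule cont_order_lub(2)[OF po' dF[OF F(1)] dl[OF F(1)] F(2) af])
        moreover have "(b, g a) \<in> D'"
          using F(3) st_le[OF ab(1) bf] unfolding cont_order_def by blast
        ultimately obtain f where "f \<in> F" "(b, f a) \<in> D'"
          using ab(2) cont_order_directed[OF po' F(1) af] unfolding compact_elem_def by blast
        then show "\<exists>f\<in>F. (st a b, f) \<in> cont_order D D'"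
          using st_le[OF ab(1) bf] dF[OF F(1)] by blast
      qed
    qed
    show "is_lub (cont_order D D') {s \<in> S. (s, f) \<in> cont_order D D'} f"
      if "f \<in> Field (cont_order D D')" for f
    proof (rule is_lubI[OF that])
      fix g assume "g \<in> Field (cont_order D D')"
        and ub: "\<And>s. s \<in> {s \<in> S. (s, f) \<in> cont_order D D'} \<Longrightarrow> (s, g) \<in> cont_order D D'"
      then have g: "g \<in> cont_maps D D'" using fc by blast
      have f: "f \<in> cont_maps D D'" using that fc by blast
      have *: "(f a, g a) \<in> D'" if a: "compact_elem D a" for a
      proof -
        have af: "a \<in> Field D" using a unfolding compact_elem_def by blast
        note ff = cont_mapsD(1)[OF f af]
        show ?thesis
        proof (rule lub_least[OF sd_lub[OF D' ff] cont_mapsD(1)[OF g af]])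
          fix b assume "b \<in> {c. compact_elem D' c \<and> (c, f a) \<in> D'}"
          then have b: "compact_elem D' b" "(b, f a) \<in> D'" and bf: "b \<in> Field D'"
            unfolding compact_elem_def by auto
          have "st a b \<in> S" using a b unfolding S_def by blast
          then have "(st a b, g) \<in> cont_order D D'" using ub st_le[OF a bf f] b(2) by blast
          then show "(b, g a) \<in> D'" using st_le[OF a bf g] by blast
        qed
      qed
      have "(f x, g x) \<in> D'" if x: "x \<in> Field D" for x
      proof (rule lub_least[OF cont_mapsD(3)[OF f sd_dir[OF D x] sd_lub[OF D x]] cont_mapsD(1)[OF g x]])
        fix z assume "z \<in> f ` {c. compact_elem D c \<and> (c, x) \<in> D}"
        then show "(z, g x) \<in> D'" using * cont_mapsD(2)[OF g] po_trans[OF po'] by blast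
      qed
      then show "(f, g) \<in> cont_order D D'" using f g unfolding cont_order_def by blast
    qed blast
  qed
qed

lemma ex_inj_cont_maps:
  assumes D: "scott_domain D" and D': "scott_domain D'"
  shows "\<exists>c :: _ \<Rightarrow> nat set. inj_on c (cont_maps D D')"
proof -
  let ?K = "{a. compact_elem D a} \<times> {b. compact_elem D' b}"
  obtain i :: "_ \<Rightarrow> nat" where i: "inj_on i ?K"
    using countable_SIGMA[OF sd_count[OF D] sd_count[OF D']] unfolding countable_def by blast
  define t where "t f = {(a, b) \<in> ?K. (b, f a) \<in> D'}" for f
  have "inj_on t (cont_maps D D')"
  proof (rule inj_onI)
    fix f g assume f: "f \<in> cont_maps D D'" and g: "g \<in> cont_maps D D'" and eq: "t f = t g"
    have K: "f a = g a" if a: "compact_elem D a" for a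
    proof -
      have af: "a \<in> Field D" using a unfolding compact_elem_def by blast
      have "{c. compact_elem D' c \<and> (c, f a) \<in> D'} = {c. compact_elem D' c \<and> (c, g a) \<in> D'}"
        using eq a unfolding t_def by blast
      then show ?thesis
        using sd_lub[OF D' cont_mapsD(1)[OF f af]] sd_lub[OF D' cont_mapsD(1)[OF g af]]
          lub_unique[OF sd_po[OF D']] by auto
    qed
    show "f = g"
    proof (rule extensionalityI[OF cont_mapsD(4)[OF f] cont_mapsD(4)[OF g]])
      fix x assume x: "x \<in> Field D"
      let ?A = "{c. compact_elem D c \<and> (c, x) \<in> D}"
      have "f ` ?A = g ` ?A" using K by (intro image_cong) auto
      then show "f x = g x"
        using cont_mapsD(3)[OF f sd_dir[OF D x] sd_lub[OF D x]]
          cont_mapsD(3)[OF g sd_dir[OF D x] sd_lub[OF D x]] lub_unique[OF sd_po[OF D']] by simp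
    qed
  qed
  moreover have "inj_on (\<lambda>X. i ` X) (t ` cont_maps D D')"
  proof (rule inj_on_subset[OF inj_on_image_Pow[OF i]])
    show "t ` cont_maps D D' \<subseteq> Pow ?K" unfolding t_def by blast
  qed
  ultimately have "inj_on ((\<lambda>X. i ` X) \<circ> t) (cont_maps D D')" by (rule comp_inj_on)
  then show ?thesis by blast
qed

theorem inj_on_encode:
  assumes "scott_domain D" and "scott_domain D'"
  shows "inj_on (encode D D') (cont_maps D D')"
proof -
  have "inj_on (SOME c :: _ \<Rightarrow> nat set. inj_on c (cont_maps D D')) (cont_maps D D')"
    using ex_inj_cont_maps[OF assms] by (rule someI_ex)
  then show ?thesis unfolding encode_def by (rule comp_inj_on) (simp add: inj_on_def)
qed

lemma scott_domain_image:
  fixes h :: "'a \<Rightarrow> 'b"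
  assumes r: "scott_domain r" and h: "inj_on h (Field r)"
  shows "scott_domain (map_prod h h ` r)"
proof -
  define q where "q = map_prod h h ` r"
  note po = sd_po[OF r]
  have F: "Field q = h ` Field r" by (force simp: Field_def q_def)
  have le: "(h x, h y) \<in> q \<longleftrightarrow> (x, y) \<in> r" if "x \<in> Field r" "y \<in> Field r" for x y
  proof
    assume "(h x, h y) \<in> q"
    then obtain x' y' where "(x', y') \<in> r" "h x = h x'" "h y = h y'" unfolding q_def by auto
    then show "(x, y) \<in> r" using that inj_onD[OF h] FieldI12[of x' y' r] by metis
  qed (force simp: q_def)
  have dir: "directed q (h ` A) \<longleftrightarrow> directed r A" if "A \<subseteq> Field r" for A
  proof -
    have "h ` A \<subseteq> Field q" using that F by blast
    then show ?thesis
      using that le unfolding directed_def by (simp add: subset_iff)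
  qed
  have lub: "is_lub q (h ` A) (h x) \<longleftrightarrow> is_lub r A x" if A: "A \<subseteq> Field r" and x: "x \<in> Field r" for A x
    unfolding is_lub_def F using A x le by (simp add: subset_iff)
  have sub: "\<exists>A'. A' \<subseteq> Field r \<and> A = h ` A'" if "A \<subseteq> Field q" for A
    using that F by (simp add: subset_image_iff)
  have comp: "compact_elem q (h c)" if c: "compact_elem r c" for c
    unfolding compact_elem_def
  proof (intro conjI allI impI)
    have cf: "c \<in> Field r" using c unfolding compact_elem_def by blast
    then show "h c \<in> Field q" using F by blast
    fix A x assume A: "directed q A" "is_lub q A x" "(h c, x) \<in> q"
    have "A \<subseteq> Field q" using A(1) by (simp add: directed_def)
    then obtain A' where A': "A' \<subseteq> Field r" "A = h ` A'" using sub[of A] by metis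
    obtain x' where x': "x' \<in> Field r" "x = h x'" using lub_field[OF A(2)] F by blast
    have "directed r A'" using A(1) dir[OF A'(1)] A'(2) by simp
    moreover have "is_lub r A' x'" using A(2) lub[OF A'(1) x'(1)] A'(2) x'(2) by simp
    moreover have "(c, x') \<in> r" using A(3) le[OF cf x'(1)] x'(2) by simp
    ultimately obtain a where a: "a \<in> A'" "(c, a) \<in> r" using c unfolding compact_elem_def by blast
    then have "(h c, h a) \<in> q" using le[OF cf] A'(1) by blast
    then show "\<exists>a\<in>A. (h c, a) \<in> q" using A'(2) a(1) by blast
  qed
  have "scott_domain q"
  proof (rule scott_domainI[of _ "h ` {c. compact_elem r c}"])
    show "Partial_order q"
      unfolding order_on_defs
    proof (intro conjI)
      show "q \<subseteq> Field q \<times> Field q" by (auto simp: Field_def)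
      show "refl_on (Field q) q"
        unfolding refl_on_def F using le po_refl[OF po] by blast
      show "trans q"
      proof (rule transI)
        fix x y z assume a: "(x, y) \<in> q" "(y, z) \<in> q"
        obtain x' y' z' where h: "x = h x'" "y = h y'" "z = h z'"
          and f: "x' \<in> Field r" "y' \<in> Field r" "z' \<in> Field r"
          using FieldI12[OF a(1)] FieldI12[OF a(2)] F by blast
        show "(x, z) \<in> q" using a po_trans[OF po] by (simp add: h le[OF f(1,2)] le[OF f(2,3)] le[OF f(1,3)])
      qed
      show "antisym q"
      proof (rule antisymI)
        fix x y assume a: "(x, y) \<in> q" "(y, x) \<in> q"
        obtain x' y' where h: "x = h x'" "y = h y'" and f: "x' \<in> Field r" "y' \<in> Field r"
          using FieldI12[OF a(1)] F by blast
        show "x = y" using a po_antisym[OF po, of x' y'] by (simp add: h le[OF f(1,2)] le[OF f(2,1)])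
      qed
    qed
    show "Field q \<noteq> {}" using sd_ne[OF r] F by blast
    show "\<exists>x. is_lub q A x" if d: "directed q A" for A
    proof -
      have "A \<subseteq> Field q" using d by (simp add: directed_def)
      then obtain A' where A': "A' \<subseteq> Field r" "A = h ` A'" using sub[of A] by metis
      then have "directed r A'" using d dir by simp
      then obtain x where x: "is_lub r A' x" using sd_dl[OF r] by metis
      then show ?thesis using lub[OF A'(1) lub_field[OF x]] A'(2) by blast
    qed
    show "\<exists>x. is_lub q A x" if A: "A \<subseteq> Field q" and y: "y \<in> Field q"
      and ub: "\<And>a. a \<in> A \<Longrightarrow> (a, y) \<in> q" for A y
    proof -
      obtain A' where A': "A' \<subseteq> Field r" "A = h ` A'" using sub[OF A] by metis
      obtain y' where y': "y' \<in> Field r" "y = h y'" using y F by blast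
      have "(a, y') \<in> r" if "a \<in> A'" for a
        using that ub[of "h a"] A' y' le[of a y'] by blast
      then obtain x where x: "is_lub r A' x" using sd_bl[OF r A'(1) y'(1)] by metis
      then show ?thesis using lub[OF A'(1) lub_field[OF x]] A'(2) by blast
    qed
    show "countable (h ` {c. compact_elem r c})" using sd_count[OF r] by blast
    show "compact_elem q s" if "s \<in> h ` {c. compact_elem r c}" for s using that comp by blast
    show "is_lub q {s \<in> h ` {c. compact_elem r c}. (s, x) \<in> q} x" if x: "x \<in> Field q" for x
    proof -
      obtain x' where x': "x' \<in> Field r" "x = h x'" using x F by blast
      have Kf: "{c. compact_elem r c} \<subseteq> Field r" unfolding compact_elem_def by blast
      have "{s \<in> h ` {c. compact_elem r c}. (s, x) \<in> q} = h ` {c. compact_elem r c \<and> (c, x') \<in> r}"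
        using x' le Kf by blast
      then show ?thesis using lub[of "{c. compact_elem r c \<and> (c, x') \<in> r}" x'] sd_lub[OF r x'(1)] x' Kf
        by (auto simp: subset_iff)
    qed
  qed
  then show ?thesis unfolding q_def .
qed

theorem scott_domain_fun_dom:
  assumes "scott_domain D" and "scott_domain D'"
  shows "scott_domain (fun_dom D D')"
  unfolding fun_dom_def
  using scott_domain_image[OF scott_domain_cont_order[OF assms]] inj_on_encode[OF assms]
    Field_cont_order[OF sd_po[OF assms(2)]] by metis

theorem scott_domain_hier: "scott_domain D \<Longrightarrow> scott_domain (hier D k)"
  by (induction k) (auto intro: scott_domain_fun_dom)

text \<open>\<open>app\<close> is an order isomorphism from \<open>fun_dom D D'\<close> onto the Scott-continuous maps.\<close>

theorem fun_dom_iso: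
  assumes D: "scott_domain D" and D': "scott_domain D'"
  shows "bij_betw (app D D') (Field (fun_dom D D')) (cont_maps D D')"
    and "f \<in> Field (fun_dom D D') \<Longrightarrow> g \<in> Field (fun_dom D D') \<Longrightarrow>
         (f, g) \<in> fun_dom D D' \<longleftrightarrow> (\<forall>x\<in>Field D. (app D D' f x, app D D' g x) \<in> D')"
proof -
  note inj = inj_on_encode[OF D D'] and fc = Field_cont_order[OF sd_po[OF D'], of D]
  have F: "Field (fun_dom D D') = encode D D' ` cont_maps D D'"
    unfolding fc[symmetric] fun_dom_def by (force simp: Field_def)
  show "bij_betw (app D D') (Field (fun_dom D D')) (cont_maps D D')"
    unfolding F app_def[abs_def]
    using bij_betw_inv_into[OF inj_on_imp_bij_betw[OF inj]] by (simp add: eta_contract_eq)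
  assume "f \<in> Field (fun_dom D D')" "g \<in> Field (fun_dom D D')"
  then obtain f' g' where f: "f' \<in> cont_maps D D'" "f = encode D D' f'"
    and g: "g' \<in> cont_maps D D'" "g = encode D D' g'" unfolding F by blast
  have app: "app D D' f = f'" "app D D' g = g'"
    using f g inv_into_f_f[OF inj] by (simp_all add: app_def)
  have "(f, g) \<in> fun_dom D D' \<longleftrightarrow> (f', g') \<in> cont_order D D'"
  proof
    assume "(f, g) \<in> fun_dom D D'"
    then obtain a b where "(a, b) \<in> cont_order D D'" "encode D D' a = f" "encode D D' b = g"
      unfolding fun_dom_def by auto
    moreover from this have "a = f'" "b = g'"
      using f g inj_onD[OF inj] unfolding cont_order_def by auto
    ultimately show "(f', g') \<in> cont_order D D'" by simp
  next
    assume "(f', g') \<in> cont_order D D'"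
    then show "(f, g) \<in> fun_dom D D'" unfolding fun_dom_def using f g by force
  qed
  then show "(f, g) \<in> fun_dom D D' \<longleftrightarrow> (\<forall>x\<in>Field D. (app D D' f x, app D D' g x) \<in> D')"
    using f g app unfolding cont_order_def by simp
qed

lemma Field_flat_nat: "Field flat_nat = UNIV"
  by (auto simp: flat_nat_def Field_def)

lemma scott_domain_flat_nat: "scott_domain flat_nat"
proof (rule scott_domainI[of _ UNIV])
  show po: "Partial_order flat_nat"
    by (auto simp: flat_nat_def Field_def order_on_defs refl_on_def trans_def antisym_def)
  have top: "is_lub flat_nat A x" if "x \<in> A" "\<And>a. a \<in> A \<Longrightarrow> (a, x) \<in> flat_nat" for A x
    using that by (intro is_lubI) (auto simp: Field_flat_nat)
  have dir: "\<exists>x\<in>A. \<forall>a\<in>A. (a, x) \<in> flat_nat" if "directed flat_nat A" for A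
  proof (cases "A \<subseteq> {None}")
    case True
    then show ?thesis using that unfolding directed_def flat_nat_def by blast
  next
    case False
    then obtain n where "Some n \<in> A" by (metis not_None_eq singleton_iff subsetI)
    then have "\<forall>a\<in>A. (a, Some n) \<in> flat_nat"
      using that unfolding directed_def flat_nat_def by fastforce
    then show ?thesis using \<open>Some n \<in> A\<close> by blast
  qed
  show "\<exists>x. is_lub flat_nat A x" if "directed flat_nat A" for A
    using dir[OF that] top by blast
  show "\<exists>x. is_lub flat_nat A x" if "\<And>a. a \<in> A \<Longrightarrow> (a, y) \<in> flat_nat" for A y
  proof (cases "A \<subseteq> {None}")
    case True
    then have "is_lub flat_nat A None" by (auto simp: is_lub_def Field_def flat_nat_def)
    then show ?thesis by blast
  next
    case False
    then obtain n where "Some n \<in> A" by (metis not_None_eq singleton_iff subsetI)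
    moreover from this have "y = Some n" using that[of "Some n"] by (simp add: flat_nat_def)
    ultimately show ?thesis using top[of y A] that by blast
  qed
  show "compact_elem flat_nat c" for c
    unfolding compact_elem_def
  proof (intro conjI allI impI)
    fix A x assume A: "directed flat_nat A" "is_lub flat_nat A x" "(c, x) \<in> flat_nat"
    obtain a where a: "a \<in> A" "\<forall>b\<in>A. (b, a) \<in> flat_nat" using dir[OF A(1)] by blast
    then have "a = x" using top[of a A] lub_unique[OF po _ A(2)] by blast
    then show "\<exists>a\<in>A. (c, a) \<in> flat_nat" using a A(3) by blast
  qed (simp add: Field_flat_nat)
  show "is_lub flat_nat {s \<in> UNIV. (s, x) \<in> flat_nat} x" for x
    by (rule top) (auto simp: flat_nat_def)
qed (auto simp: Field_flat_nat)

lemma Field_interval_order: "Field interval_order = intervals"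
  by (auto simp: interval_order_def Field_def)

lemma intervals_Int:
  assumes "I \<in> intervals" "J \<in> intervals" "I \<inter> J \<noteq> {}"
  shows "I \<inter> J \<in> intervals"
proof (cases "I = UNIV \<or> J = UNIV")
  case True
  then show ?thesis using assms by auto
next
  case False
  then obtain p q p' q' where I: "I = {real_of_rat p..real_of_rat q}"
    and J: "J = {real_of_rat p'..real_of_rat q'}"
    using assms unfolding intervals_def by blast
  have eq: "I \<inter> J = {real_of_rat (max p p')..real_of_rat (min q q')}"
    unfolding I J by (auto simp: max_def min_def of_rat_less_eq)
  then have "max p p' \<le> min q q'" using assms(3) by (metis atLeastatMost_empty_iff of_rat_less_eq)
  then show ?thesis unfolding eq intervals_def by blast
qed

lemma ideal_interval_iff:
  "is_ideal interval_order X \<longleftrightarrow> X \<subseteq> intervals \<and> UNIV \<in> X \<and>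
     (\<forall>I\<in>X. \<forall>J\<in>X. I \<inter> J \<in> X) \<and> (\<forall>I\<in>intervals. \<forall>J\<in>X. J \<subseteq> I \<longrightarrow> I \<in> X)" (is "_ \<longleftrightarrow> ?R")
proof
  assume i: "is_ideal interval_order X"
  then have X: "X \<subseteq> intervals" "X \<noteq> {}" unfolding is_ideal_def directed_def Field_interval_order by auto
  have dn: "\<forall>I\<in>intervals. \<forall>J\<in>X. J \<subseteq> I \<longrightarrow> I \<in> X"
    using i X unfolding is_ideal_def interval_order_def by blast
  have "I \<inter> J \<in> X" if IJ: "I \<in> X" "J \<in> X" for I J
  proof -
    obtain L where L: "L \<in> X" "L \<subseteq> I" "L \<subseteq> J"
    proof -
      from i IJ obtain L where "L \<in> X" "(I, L) \<in> interval_order" "(J, L) \<in> interval_order"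
        unfolding is_ideal_def directed_def by meson
      then show thesis by (intro that) (auto simp: interval_order_def)
    qed
    have "L \<in> intervals" using L X by blast
    then have "L \<noteq> {}" by (auto simp: intervals_def of_rat_less_eq)
    then have "I \<inter> J \<in> intervals" using intervals_Int[of I J] IJ X L by blast
    then show ?thesis using dn L by blast
  qed
  moreover have "UNIV \<in> X" using dn X unfolding intervals_def by blast
  ultimately show ?R using X dn by blast
next
  assume R: ?R
  have "\<exists>L\<in>X. (I, L) \<in> interval_order \<and> (J, L) \<in> interval_order" if "I \<in> X" "J \<in> X" for I J
    using R that by (intro bexI[of _ "I \<inter> J"]) (auto simp: interval_order_def)
  moreover have "I \<in> X" if "J \<in> X" "(I, J) \<in> interval_order" for I J
    using R that by (auto simp: interval_order_def)
  ultimately show "is_ideal interval_order X"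
    using R unfolding is_ideal_def directed_def Field_interval_order by auto
qed

lemma ideal_intervalD:
  assumes "is_ideal interval_order X"
  shows "I \<in> X \<Longrightarrow> I \<in> intervals" "UNIV \<in> X" "I \<in> X \<Longrightarrow> J \<in> X \<Longrightarrow> I \<inter> J \<in> X"
    "J \<in> X \<Longrightarrow> I \<in> intervals \<Longrightarrow> J \<subseteq> I \<Longrightarrow> I \<in> X"
  using assms unfolding ideal_interval_iff by auto

lemma ideal_intervalI:
  assumes "\<And>I. I \<in> X \<Longrightarrow> I \<in> intervals" "UNIV \<in> X" "\<And>I J. I \<in> X \<Longrightarrow> J \<in> X \<Longrightarrow> I \<inter> J \<in> X"
    "\<And>I J. J \<in> X \<Longrightarrow> I \<in> intervals \<Longrightarrow> J \<subseteq> I \<Longrightarrow> I \<in> X"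
  shows "is_ideal interval_order X"
  unfolding ideal_interval_iff
  by (intro conjI ballI impI subsetI; (rule assms(1) assms(2) assms(3) | rule assms(4)); assumption)

lemma scott_domain_ideals: "scott_domain (ideal_completion interval_order)"
proof -
  let ?r = "ideal_completion interval_order"
  define pr where "pr I = {J \<in> intervals. I \<subseteq> J}" for I
  have F: "Field ?r = {X. is_ideal interval_order X}"
    by (auto simp: ideal_completion_def Field_def)
  have le: "(X, Y) \<in> ?r \<longleftrightarrow> is_ideal interval_order X \<and> is_ideal interval_order Y \<and> X \<subseteq> Y" for X Y
    by (simp add: ideal_completion_def)
  have ne: "I \<noteq> {}" if "I \<in> intervals" for I using that by (auto simp: intervals_def of_rat_less_eq)
  have univ: "UNIV \<in> intervals" by (simp add: intervals_def)
  have pr: "is_ideal interval_order (pr I)" if I: "I \<in> intervals" for I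
    unfolding ideal_interval_iff
  proof (intro conjI ballI impI)
    fix J L assume JL: "J \<in> pr I" "L \<in> pr I"
    then have "I \<subseteq> J \<inter> L" by (simp add: pr_def)
    moreover from this have "J \<inter> L \<in> intervals"
      using JL ne[OF I] by (intro intervals_Int) (auto simp: pr_def)
    ultimately show "J \<inter> L \<in> pr I" by (simp add: pr_def)
  qed (use univ in \<open>auto simp: pr_def\<close>)
  have dl: "is_lub ?r A (\<Union>A)" if d: "directed ?r A" for A
  proof -
    have A: "\<And>X. X \<in> A \<Longrightarrow> is_ideal interval_order X" "A \<noteq> {}"
      using d F unfolding directed_def by blast+
    have int: "I \<inter> J \<in> \<Union>A" if IJ: "I \<in> \<Union>A" "J \<in> \<Union>A" for I J
    proof -
      obtain X Y where "X \<in> A" "Y \<in> A" "I \<in> X" "J \<in> Y" using IJ by blast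
      moreover then obtain Z where "Z \<in> A" "X \<subseteq> Z" "Y \<subseteq> Z"
        using d unfolding directed_def le by blast
      ultimately have "I \<inter> J \<in> Z" using ideal_intervalD(3)[OF A(1)[of Z], of I J] by blast
      then show ?thesis using \<open>Z \<in> A\<close> by blast
    qed
    have "is_ideal interval_order (\<Union>A)"
    proof (rule ideal_intervalI)
      show "I \<in> intervals" if "I \<in> \<Union>A" for I
        using that by (elim UnionE) (rule ideal_intervalD(1)[OF A(1)])
      obtain X where "X \<in> A" using A(2) by blast
      then show "UNIV \<in> \<Union>A" using ideal_intervalD(2)[OF A(1)] by (intro UnionI)
      show "I \<inter> J \<in> \<Union>A" if "I \<in> \<Union>A" "J \<in> \<Union>A" for I J using that by (rule int)
      show "I \<in> \<Union>A" if J: "J \<in> \<Union>A" and I: "I \<in> intervals" "J \<subseteq> I" for I J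
      proof -
        obtain X where X: "X \<in> A" "J \<in> X" using J by (elim UnionE)
        show ?thesis by (rule UnionI[OF X(1) ideal_intervalD(4)[OF A(1)[OF X(1)] X(2) I]])
      qed
    qed
    then show ?thesis using A(1) by (intro is_lubI) (auto simp: F le)
  qed
  show ?thesis
  proof (rule scott_domainI[of _ "pr ` intervals"])
    show po: "Partial_order ?r"
      unfolding order_on_defs F refl_on_def trans_def antisym_def le by (auto simp: ideal_completion_def)
    show "Field ?r \<noteq> {}" using pr[OF univ] F by blast
    show "\<exists>x. is_lub ?r A x" if "directed ?r A" for A using dl[OF that] by blast
    show "\<exists>x. is_lub ?r A x" if A: "A \<subseteq> Field ?r" and Y: "Y \<in> Field ?r"
      and ub: "\<And>a. a \<in> A \<Longrightarrow> (a, Y) \<in> ?r" for A Y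
    proof -
      let ?U = "{J. is_ideal interval_order J \<and> (\<forall>X\<in>A. X \<subseteq> J)}"
      have YU: "Y \<in> ?U" using Y ub F le by blast
      have U: "is_ideal interval_order Z" if "Z \<in> ?U" for Z using that by simp
      have i: "is_ideal interval_order (\<Inter>?U)"
      proof (rule ideal_intervalI)
        show "I \<in> intervals" if "I \<in> \<Inter>?U" for I
          by (rule ideal_intervalD(1)[OF U[OF YU] InterD[OF that YU]])
        show "UNIV \<in> \<Inter>?U" by (rule InterI) (rule ideal_intervalD(2)[OF U])
        show "I \<inter> J \<in> \<Inter>?U" if "I \<in> \<Inter>?U" "J \<in> \<Inter>?U" for I J
          by (rule InterI) (rule ideal_intervalD(3)[OF U InterD[OF that(1)] InterD[OF that(2)]])
        show "I \<in> \<Inter>?U" if "J \<in> \<Inter>?U" "I \<in> intervals" "J \<subseteq> I" for I J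
          by (rule InterI) (rule ideal_intervalD(4)[OF U InterD[OF that(1)] that(2,3)])
      qed
      have "is_lub ?r A (\<Inter>?U)"
        using A i by (intro is_lubI) (auto simp: F le)
      then show ?thesis by blast
    qed
    have "intervals \<subseteq> insert UNIV ((\<lambda>(p, q). {real_of_rat p..real_of_rat q}) ` UNIV)"
      unfolding intervals_def by auto
    then have "countable intervals" by (rule countable_subset) auto
    then show "countable (pr ` intervals)" by blast
    show "compact_elem ?r s" if sI: "s \<in> pr ` intervals" for s
      unfolding compact_elem_def
    proof (intro conjI allI impI)
      obtain I where I: "I \<in> intervals" "s = pr I" using sI by blast
      show "s \<in> Field ?r" using I pr F by blast
      fix A X assume A: "directed ?r A" "is_lub ?r A X" "(s, X) \<in> ?r"
      have "X = \<Union>A" using lub_unique[OF po A(2) dl[OF A(1)]] .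
      moreover have "I \<in> s" using I unfolding pr_def by blast
      ultimately obtain Z where Z: "Z \<in> A" "I \<in> Z" using A(3) le by blast
      then have "is_ideal interval_order Z" using A(1) F unfolding directed_def by blast
      then have "(s, Z) \<in> ?r" using Z I pr ideal_intervalD(4) unfolding le by (auto simp: pr_def)
      then show "\<exists>a\<in>A. (s, a) \<in> ?r" using Z by blast
    qed
    show "is_lub ?r {s \<in> pr ` intervals. (s, X) \<in> ?r} X" if X: "X \<in> Field ?r" for X
    proof (rule is_lubI[OF X])
      fix Y assume Y: "Y \<in> Field ?r" "\<And>s. s \<in> {s \<in> pr ` intervals. (s, X) \<in> ?r} \<Longrightarrow> (s, Y) \<in> ?r"
      have i: "is_ideal interval_order X" "is_ideal interval_order Y" using X Y(1) F by auto
      have "I \<in> Y" if "I \<in> X" for I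
      proof -
        have I: "I \<in> intervals" using ideal_intervalD(1)[OF i(1) that] .
        have "pr I \<subseteq> X" using ideal_intervalD(4)[OF i(1) that] unfolding pr_def by blast
        then have "(pr I, Y) \<in> ?r" using Y(2)[of "pr I"] I pr[OF I] i(1) by (simp add: le)
        moreover have "I \<in> pr I" using I unfolding pr_def by blast
        ultimately show ?thesis unfolding le by blast
      qed
      then show "(X, Y) \<in> ?r" using i le by blast
    qed blast
  qed
qed

theorem scott_domain_N: "scott_domain (N k)"
  unfolding N_def by (intro scott_domain_hier scott_domain_image scott_domain_flat_nat) (simp add: inj_on_def)

theorem scott_domain_E: "scott_domain (E k)"
  unfolding E_def by (intro scott_domain_hier scott_domain_image scott_domain_ideals) (simp add: inj_on_def)

lemma N_Suc: "N (Suc k) = fun_dom (N k) (N 0)" and E_Suc: "E (Suc k) = fun_dom (E k) (E 0)"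
  by (simp_all add: N_def E_def)

theorem N_function_space:
  "bij_betw (N_app k) (Field (N (Suc k))) (cont_maps (N k) (N 0))"
  "f \<in> Field (N (Suc k)) \<Longrightarrow> g \<in> Field (N (Suc k)) \<Longrightarrow>
     (f, g) \<in> N (Suc k) \<longleftrightarrow> (\<forall>x\<in>Field (N k). (N_app k f x, N_app k g x) \<in> N 0)"
  unfolding N_Suc N_app_def by (rule fun_dom_iso[OF scott_domain_N scott_domain_N]; assumption)+

theorem E_function_space:
  "bij_betw (E_app k) (Field (E (Suc k))) (cont_maps (E k) (E 0))"
  "f \<in> Field (E (Suc k)) \<Longrightarrow> g \<in> Field (E (Suc k)) \<Longrightarrow>
     (f, g) \<in> E (Suc k) \<longleftrightarrow> (\<forall>x\<in>Field (E k). (E_app k f x, E_app k g x) \<in> E 0)"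
  unfolding E_Suc E_app_def by (rule fun_dom_iso[OF scott_domain_E scott_domain_E]; assumption)+

end

theory Submission
  imports Defs "HOL-Analysis.Analysis"
begin

text \<open>
  The map \<open>\<pi>\<^sub>k\<^sub>+\<^sub>1\<close> has to extend a functional \<open>\<Phi>\<close> on \<open>N(k)\<close> to the arguments \<open>x \<in> E(k)\<close>; let
  \<open>g = x \<circ> \<pi>\<^sub>k\<^sub>-\<^sub>1\<close>, a real-valued functional on \<open>N(k-1)\<close>. The total elements of \<open>N(k-1)\<close> have truncations
  \<open>t\<^sub>i a\<close> converging to \<open>a\<close>, where each \<open>t\<^sub>i\<close> has a finite range. If \<open>g\<close> is close to natural numbers on
  the range of \<open>t\<^sub>i\<close>, then rounding \<open>g (t\<^sub>i a)\<close> gives a total \<open>\<rho>\<^sub>i x \<in> N(k)\<close>, so \<open>\<Phi> (\<rho>\<^sub>i x)\<close> is a number.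
  Let \<open>Q\<^sub>i \<in> [0,1]\<close> be continuous in \<open>x\<close>, decreasing in \<open>i\<close>, equal to \<open>1\<close> if \<open>g\<close> is very close to natural
  numbers on the ranges of \<open>t\<^sub>0, \<dots>, t\<^sub>i\<close>, and \<open>0\<close> if it is not close to them. Then
  \<open>\<pi>\<^sub>k\<^sub>+\<^sub>1 \<Phi> x = (\<Sum>i. (Q\<^sub>i - Q\<^sub>i\<^sub>+\<^sub>1) \<cdot> \<Phi> (\<rho>\<^sub>i x)) + (lim Q\<^sub>i) \<cdot> (lim \<Phi> (\<rho>\<^sub>i x))\<close>
  works: either some \<open>Q\<^sub>i\<close> vanishes and the sum is finite, or \<open>\<rho>\<^sub>i x\<close> converges to a total element and
  \<open>\<Phi> (\<rho>\<^sub>i x)\<close> is eventually constant. The latter can be recognised from finite information because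
  the \<open>t\<^sub>i\<close> with \<open>i \<ge> m\<close> have a common lower bound \<open>p\<^sub>m\<close> with \<open>p\<^sub>m a\<close> increasing to \<open>a\<close>.
\<close>

section \<open>Scott-continuous maps and increasing chains\<close>

lemma scott_contD:
  assumes "scott_cont D D' f"
  shows "x \<in> Field D \<Longrightarrow> f x \<in> Field D'" "(x, y) \<in> D \<Longrightarrow> (f x, f y) \<in> D'"
    "directed D A \<Longrightarrow> is_lub D A x \<Longrightarrow> is_lub D' (f ` A) (f x)"
  using assms unfolding scott_cont_def by blast+

lemma directed_image:
  assumes f: "scott_cont D D' f" and A: "directed D A"
  shows "directed D' (f ` A)"
  unfolding directed_def
proof (intro conjI ballI)
  show "f ` A \<subseteq> Field D'" "f ` A \<noteq> {}"
    using A scott_contD(1)[OF f] unfolding directed_def by blast+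
  fix a b assume "a \<in> f ` A" "b \<in> f ` A"
  then obtain a' b' where ab: "a' \<in> A" "b' \<in> A" "a = f a'" "b = f b'" by blast
  obtain c where "c \<in> A" "(a', c) \<in> D" "(b', c) \<in> D"
    using A ab(1,2) unfolding directed_def by blast
  then show "\<exists>c\<in>f ` A. (a, c) \<in> D' \<and> (b, c) \<in> D'"
    using ab scott_contD(2)[OF f] by blast
qed

lemma scott_cont_compose:
  assumes f: "scott_cont D D' f" and g: "scott_cont D' D'' g"
  shows "scott_cont D D'' (\<lambda>x. g (f x))"
  unfolding scott_cont_def
proof (intro conjI allI impI)
  show "(\<lambda>x. g (f x)) \<in> Field D \<rightarrow> Field D''"
    using scott_contD(1)[OF f] scott_contD(1)[OF g] by blast
  show "(g (f x), g (f y)) \<in> D''" if "(x, y) \<in> D" for x y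
    by (rule scott_contD(2)[OF g scott_contD(2)[OF f that]])
  show "is_lub D'' ((\<lambda>x. g (f x)) ` A) (g (f x))" if "directed D A" "is_lub D A x" for A x
    using scott_contD(3)[OF g directed_image[OF f that(1)] scott_contD(3)[OF f that]]
    by (simp add: image_image)
qed

lemma chain_directed:
  assumes po: "Partial_order r" and s: "\<And>m. (s m, s (Suc m)) \<in> r"
  shows "m \<le> n \<Longrightarrow> (s m, s n) \<in> r" "directed r (range s)"
proof -
  show le: "(s m, s n) \<in> r" if "m \<le> n" for m n
    using that
  proof (induction n rule: dec_induct)
    case base
    show ?case using po_refl[OF po FieldI12(1)[OF s]] .
  next
    case (step n)
    then show ?case using po_trans[OF po _ s] by blast
  qed
  show "directed r (range s)"
    unfolding directed_def
  proof (intro conjI ballI)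
    show "range s \<subseteq> Field r" using FieldI12(1)[OF s] by blast
    fix a b assume "a \<in> range s" "b \<in> range s"
    then obtain m n where "a = s m" "b = s n" by blast
    then show "\<exists>c\<in>range s. (a, c) \<in> r \<and> (b, c) \<in> r"
      using le[of m "max m n"] le[of n "max m n"] by auto
  qed simp
qed

section \<open>Function spaces\<close>

context
  fixes D D' :: "'b elt rel"
  assumes D: "scott_domain D" and D': "scott_domain D'"
begin

lemma app_cont_maps: "u \<in> Field (fun_dom D D') \<Longrightarrow> app D D' u \<in> cont_maps D D'"
  using fun_dom_iso(1)[OF D D'] by (rule bij_betwE[THEN bspec])

lemma scott_cont_app: "u \<in> Field (fun_dom D D') \<Longrightarrow> scott_cont D D' (app D D' u)"
  using app_cont_maps unfolding cont_maps_def by blast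

lemma app_le:
  "(u, v) \<in> fun_dom D D' \<Longrightarrow> (x, y) \<in> D \<Longrightarrow> (app D D' u x, app D D' v y) \<in> D'"
proof -
  assume uv: "(u, v) \<in> fun_dom D D'" and xy: "(x, y) \<in> D"
  have F: "u \<in> Field (fun_dom D D')" "v \<in> Field (fun_dom D D')" "x \<in> Field D"
    using uv xy by (auto intro: FieldI12)
  have "(app D D' u x, app D D' v x) \<in> D'" using fun_dom_iso(2)[OF D D' F(1,2)] uv F(3) by blast
  then show ?thesis
    using po_trans[OF sd_po[OF D']] scott_contD(2)[OF scott_cont_app[OF F(2)] xy] by blast
qed

text \<open>Turns any Scott-continuous function into an element of the function space. The
  restriction picks the extensional representative that \<open>cont_maps\<close> demands.\<close>

lemma
  assumes f: "scott_cont D D' f"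
  shows encode_Field: "encode D D' (restrict f (Field D)) \<in> Field (fun_dom D D')"
    and app_encode: "x \<in> Field D \<Longrightarrow> app D D' (encode D D' (restrict f (Field D))) x = f x"
proof -
  let ?g = "restrict f (Field D)"
  have "scott_cont D D' ?g"
    unfolding scott_cont_def
  proof (intro conjI allI impI)
    show "?g \<in> Field D \<rightarrow> Field D'" using scott_contD(1)[OF f] by auto
    show "(?g x, ?g y) \<in> D'" if "(x, y) \<in> D" for x y
      using scott_contD(2)[OF f that] FieldI12[OF that] by simp
    show "is_lub D' (?g ` A) (?g x)" if A: "directed D A" "is_lub D A x" for A x
    proof -
      have "?g ` A = f ` A" using A(1) by (intro image_cong) (auto simp: directed_def)
      then show ?thesis using scott_contD(3)[OF f A] lub_field[OF A(2)] by simp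
    qed
  qed
  then have g: "?g \<in> cont_maps D D'" by (simp add: cont_maps_def)
  have "(?g, ?g) \<in> cont_order D D'"
    unfolding cont_order_def using g po_refl[OF sd_po[OF D'] cont_mapsD(1)[OF g]] by blast
  then have "(encode D D' ?g, encode D D' ?g) \<in> fun_dom D D'" unfolding fun_dom_def by force
  then show "encode D D' ?g \<in> Field (fun_dom D D')" by (rule FieldI12)
  show "app D D' (encode D D' ?g) x = f x" if "x \<in> Field D"
    using that inv_into_f_f[OF inj_on_encode[OF D D'] g] by (simp add: app_def)
qed

lemma fun_dom_lubI:
  assumes A: "A \<subseteq> Field (fun_dom D D')" and u: "u \<in> Field (fun_dom D D')"
    and l: "\<And>x. x \<in> Field D \<Longrightarrow> is_lub D' ((\<lambda>f. app D D' f x) ` A) (app D D' u x)"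
  shows "is_lub (fun_dom D D') A u"
proof (rule is_lubI[OF u])
  note iso = fun_dom_iso(2)[OF D D']
  show "(a, u) \<in> fun_dom D D'" if "a \<in> A" for a
    using iso[of a u] that A u lub_ub[OF l] by blast
  fix v assume v: "v \<in> Field (fun_dom D D')" "\<And>a. a \<in> A \<Longrightarrow> (a, v) \<in> fun_dom D D'"
  have "(app D D' u x, app D D' v x) \<in> D'" if x: "x \<in> Field D" for x
  proof (rule lub_least[OF l[OF x]])
    show "app D D' v x \<in> Field D'" by (rule scott_contD(1)[OF scott_cont_app[OF v(1)] x])
    show "(a, app D D' v x) \<in> D'" if "a \<in> (\<lambda>f. app D D' f x) ` A" for a
      using that v(2) app_le po_refl[OF sd_po[OF D] x] by blast
  qed
  then show "(u, v) \<in> fun_dom D D'" using iso[OF u v(1)] by blast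
qed

text \<open>Directed suprema of functionals are pointwise: the pointwise supremum is again
  continuous, hence has a code \<open>v\<close>, and \<open>v\<close> must be the given lub because
  lubs are unique.\<close>

lemma scott_cont_app_left:
  assumes x: "x \<in> Field D"
  shows "scott_cont (fun_dom D D') D' (\<lambda>u. app D D' u x)"
proof -
  have eq: "is_lub D' ((\<lambda>f. app D D' f x) ` A) (app D D' u x)"
    if A: "directed (fun_dom D D') A" and u: "is_lub (fun_dom D D') A u" for A u
  proof -
    have AF: "A \<subseteq> Field (fun_dom D D')" using A unfolding directed_def by blast
    have d: "directed D' ((\<lambda>f. app D D' f z) ` A)" if z: "z \<in> Field D" for z
      unfolding directed_def
    proof (intro conjI ballI)
      show "(\<lambda>f. app D D' f z) ` A \<subseteq> Field D'"
        using AF scott_contD(1)[OF scott_cont_app _] z by blast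
      show "(\<lambda>f. app D D' f z) ` A \<noteq> {}" using A unfolding directed_def by blast
      fix a b assume "a \<in> (\<lambda>f. app D D' f z) ` A" "b \<in> (\<lambda>f. app D D' f z) ` A"
      then obtain f g where fg: "f \<in> A" "g \<in> A" "a = app D D' f z" "b = app D D' g z" by blast
      obtain h where "h \<in> A" "(f, h) \<in> fun_dom D D'" "(g, h) \<in> fun_dom D D'"
        using A fg(1,2) unfolding directed_def by blast
      then show "\<exists>c\<in>(\<lambda>f. app D D' f z) ` A. (a, c) \<in> D' \<and> (b, c) \<in> D'"
        using fg app_le po_refl[OF sd_po[OF D] z] by blast
    qed
    have l: "\<exists>w. is_lub D' ((\<lambda>f. f z) ` app D D' ` A) w" if "z \<in> Field D" for z
      using sd_dl[OF D' d[OF that]] by (simp add: image_image)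
    have AC: "app D D' ` A \<subseteq> cont_maps D D'" using AF app_cont_maps by blast
    obtain s where s: "is_lub (cont_order D D') (app D D' ` A) s"
      using cont_order_lub(1)[OF sd_po[OF D'] AC l] by blast
    then have "s \<in> cont_maps D D'"
      using lub_field[OF s] Field_cont_order[OF sd_po[OF D']] by blast
    then obtain v where v: "v \<in> Field (fun_dom D D')" "s = app D D' v"
      using fun_dom_iso(1)[OF D D'] unfolding bij_betw_def by blast
    have p: "is_lub D' ((\<lambda>f. app D D' f z) ` A) (app D D' v z)" if "z \<in> Field D" for z
      using cont_order_lub(2)[OF sd_po[OF D'] AC l s that] v(2) by (simp add: image_image)
    have "is_lub (fun_dom D D') A v" by (rule fun_dom_lubI[OF AF v(1) p])
    then have "u = v" using lub_unique[OF sd_po[OF scott_domain_fun_dom[OF D D']] u] by blast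
    then show ?thesis using p[OF x] by blast
  qed
  show ?thesis
    unfolding scott_cont_def
    using eq scott_contD(1)[OF scott_cont_app _] app_le[OF _ po_refl[OF sd_po[OF D] x]] x by blast
qed

end

text \<open>The action of the function space on arrows: precompose with \<open>j\<close>,
  postcompose with \<open>h\<close>, encode again. It yields both the truncations
  \<open>trunc\<close> and the roundings \<open>lift\<close>.\<close>

definition dmap ::
  "'b elt rel \<Rightarrow> 'a elt rel \<Rightarrow> 'a elt rel \<Rightarrow> 'b elt rel \<Rightarrow> ('b elt \<Rightarrow> 'a elt) \<Rightarrow> ('a elt \<Rightarrow> 'b elt) \<Rightarrow>
   'a elt \<Rightarrow> 'b elt" where
  "dmap D\<^sub>0 D\<^sub>1 D\<^sub>2 D\<^sub>3 j h u = encode D\<^sub>0 D\<^sub>3 (restrict (\<lambda>a. h (app D\<^sub>1 D\<^sub>2 u (j a))) (Field D\<^sub>0))"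

lemma
  assumes D: "scott_domain D\<^sub>0" "scott_domain D\<^sub>1" "scott_domain D\<^sub>2" "scott_domain D\<^sub>3"
    and j: "scott_cont D\<^sub>0 D\<^sub>1 j" and h: "scott_cont D\<^sub>2 D\<^sub>3 h"
  shows app_dmap: "u \<in> Field (fun_dom D\<^sub>1 D\<^sub>2) \<Longrightarrow> a \<in> Field D\<^sub>0 \<Longrightarrow>
      app D\<^sub>0 D\<^sub>3 (dmap D\<^sub>0 D\<^sub>1 D\<^sub>2 D\<^sub>3 j h u) a = h (app D\<^sub>1 D\<^sub>2 u (j a))"
    and scott_cont_dmap: "scott_cont (fun_dom D\<^sub>1 D\<^sub>2) (fun_dom D\<^sub>0 D\<^sub>3) (dmap D\<^sub>0 D\<^sub>1 D\<^sub>2 D\<^sub>3 j h)"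
proof -
  let ?m = "dmap D\<^sub>0 D\<^sub>1 D\<^sub>2 D\<^sub>3 j h"
  have c: "scott_cont D\<^sub>0 D\<^sub>3 (\<lambda>a. h (app D\<^sub>1 D\<^sub>2 u (j a)))" if "u \<in> Field (fun_dom D\<^sub>1 D\<^sub>2)" for u
    by (rule scott_cont_compose[OF scott_cont_compose[OF j scott_cont_app[OF D(2,3) that]] h])
  have F: "?m u \<in> Field (fun_dom D\<^sub>0 D\<^sub>3)" if "u \<in> Field (fun_dom D\<^sub>1 D\<^sub>2)" for u
    unfolding dmap_def by (rule encode_Field[OF D(1,4) c[OF that]])
  show app: "app D\<^sub>0 D\<^sub>3 (?m u) a = h (app D\<^sub>1 D\<^sub>2 u (j a))"
    if "u \<in> Field (fun_dom D\<^sub>1 D\<^sub>2)" "a \<in> Field D\<^sub>0" for u a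
    unfolding dmap_def by (rule app_encode[OF D(1,4) c[OF that(1)] that(2)])
  have e: "scott_cont (fun_dom D\<^sub>1 D\<^sub>2) D\<^sub>3 (\<lambda>u. h (app D\<^sub>1 D\<^sub>2 u (j a)))" if "a \<in> Field D\<^sub>0" for a
    by (rule scott_cont_compose[OF scott_cont_app_left[OF D(2,3) scott_contD(1)[OF j that]] h])
  show "scott_cont (fun_dom D\<^sub>1 D\<^sub>2) (fun_dom D\<^sub>0 D\<^sub>3) ?m"
    unfolding scott_cont_def
  proof (intro conjI allI impI)
    show "?m \<in> Field (fun_dom D\<^sub>1 D\<^sub>2) \<rightarrow> Field (fun_dom D\<^sub>0 D\<^sub>3)" using F by blast
    show "(?m u, ?m v) \<in> fun_dom D\<^sub>0 D\<^sub>3" if uv: "(u, v) \<in> fun_dom D\<^sub>1 D\<^sub>2" for u v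
    proof -
      note uvF = FieldI12[OF uv]
      show ?thesis
        unfolding fun_dom_iso(2)[OF D(1,4) F[OF uvF(1)] F[OF uvF(2)]]
        using app[OF uvF(1)] app[OF uvF(2)] scott_contD(2)[OF e uv] by simp
    qed
    fix A u assume A: "directed (fun_dom D\<^sub>1 D\<^sub>2) A" "is_lub (fun_dom D\<^sub>1 D\<^sub>2) A u"
    have AF: "A \<subseteq> Field (fun_dom D\<^sub>1 D\<^sub>2)" using A(1) unfolding directed_def by blast
    note uF = lub_field[OF A(2)]
    show "is_lub (fun_dom D\<^sub>0 D\<^sub>3) (?m ` A) (?m u)"
    proof (rule fun_dom_lubI[OF D(1,4) _ F[OF uF]])
      show "?m ` A \<subseteq> Field (fun_dom D\<^sub>0 D\<^sub>3)" using F AF by blast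
      fix a assume a: "a \<in> Field D\<^sub>0"
      have "(\<lambda>f. app D\<^sub>0 D\<^sub>3 f a) ` ?m ` A = (\<lambda>u. h (app D\<^sub>1 D\<^sub>2 u (j a))) ` A"
        unfolding image_image using AF app a by (intro image_cong) auto
      then show "is_lub D\<^sub>3 ((\<lambda>f. app D\<^sub>0 D\<^sub>3 f a) ` ?m ` A) (app D\<^sub>0 D\<^sub>3 (?m u) a)"
        using scott_contD(3)[OF e[OF a] A] app[OF uF a] by simp
    qed
  qed
qed

section \<open>The base domains\<close>

lemma Field_N0: "Field (N 0) = range Base"
  by (force simp: N_def Field_def flat_nat_def)

lemma N0_le: "(Base a, Base b) \<in> N 0 \<longleftrightarrow> a = None \<or> a = b"
  by (auto simp: N_def flat_nat_def)

lemma N0_cases: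
  assumes "u \<in> Field (N 0)"
  obtains "u = Base None" | n where "u = Base (Some n)"
  using assms unfolding Field_N0 by (metis imageE option.exhaust)

lemma N0_Some_le: "(Base (Some n), v) \<in> N 0 \<Longrightarrow> v = Base (Some n)"
  by (auto simp: N_def flat_nat_def)

text \<open>If the number were missing from \<open>A\<close>, all members would be bottom, and
  bottom would already be an upper bound.\<close>

lemma N0_lub_mem:
  assumes A: "A \<subseteq> Field (N 0)" and l: "is_lub (N 0) A (Base (Some n))"
  shows "Base (Some n) \<in> A"
proof (rule ccontr)
  assume n: "Base (Some n) \<notin> A"
  have "(a, Base None) \<in> N 0" if a: "a \<in> A" for a
  proof -
    obtain a' where a': "a = Base a'" using A a Field_N0 by auto
    have "(a, Base (Some n)) \<in> N 0" using lub_ub[OF l a] .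
    then show ?thesis using n a unfolding a' N0_le by auto
  qed
  then have "(Base (Some n), Base None) \<in> N 0" by (intro lub_least[OF l]) (auto simp: Field_N0)
  then show False by (simp add: N0_le)
qed

lemma N0_directed_lub_mem:
  assumes A: "directed (N 0) A" and l: "is_lub (N 0) A x"
  shows "x \<in> A"
  using lub_field[OF l]
proof (cases rule: N0_cases)
  case 1
  obtain a where a: "a \<in> A" "a \<in> Field (N 0)" using A unfolding directed_def by blast
  then obtain a' where "a = Base a'" using Field_N0 by auto
  then show ?thesis using lub_ub[OF l a(1)] a(1) 1 by (simp add: N0_le)
next
  case (2 n)
  then show ?thesis using N0_lub_mem l A unfolding directed_def by blast
qed

text \<open>A directed set in a flat domain contains its lub, so continuity reduces to monotonicity,
  and the only strict comparisons are those of bottom with a number.\<close>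

lemma scott_cont_N0I:
  assumes po: "Partial_order D" and F: "\<And>a. f (Base a) \<in> Field D"
    and bot: "\<And>n. (f (Base None), f (Base (Some n))) \<in> D"
  shows "scott_cont (N 0) D f"
proof -
  have m: "(f x, f y) \<in> D" if xy: "(x, y) \<in> N 0" for x y
  proof -
    have "x \<in> range Base" "y \<in> range Base" using FieldI12[OF xy] by (simp_all add: Field_N0)
    then obtain a b where ab: "x = Base a" "y = Base b" by blast
    then show ?thesis using xy bot po_refl[OF po F] by (cases b) (auto simp: N0_le)
  qed
  show ?thesis
    unfolding scott_cont_def
  proof (intro conjI allI impI)
    show "f \<in> Field (N 0) \<rightarrow> Field D" using F by (auto simp: Field_N0)
    show "(f x, f y) \<in> D" if "(x, y) \<in> N 0" for x y using that by (rule m)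
    fix A x assume A: "directed (N 0) A" "is_lub (N 0) A x"
    have x: "x \<in> A" by (rule N0_directed_lub_mem[OF A])
    show "is_lub D (f ` A) (f x)"
    proof (rule is_lubI)
      show "f x \<in> Field D" using lub_field[OF A(2)] F by (auto simp: Field_N0)
      show "(a, f x) \<in> D" if "a \<in> f ` A" for a using that m lub_ub[OF A(2)] by blast
      show "(f x, y) \<in> D" if "\<And>a. a \<in> f ` A \<Longrightarrow> (a, y) \<in> D" for y using that x by blast
    qed
  qed
qed

text \<open>A numerical value is a finite piece of information: the directed set of values at
  compact approximations attains its lub.\<close>

lemma scott_cont_N0_Some:
  assumes D: "scott_domain D" and f: "scott_cont D (N 0) f" and x: "x \<in> Field D"
    and n: "f x = Base (Some n)"
  shows "\<exists>c. compact_elem D c \<and> (c, x) \<in> D \<and> f c = Base (Some n)"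
proof -
  have "is_lub (N 0) (f ` {c. compact_elem D c \<and> (c, x) \<in> D}) (Base (Some n))"
    using scott_contD(3)[OF f sd_dir[OF D x] sd_lub[OF D x]] n by simp
  then show ?thesis
    using N0_directed_lub_mem[OF directed_image[OF f sd_dir[OF D x]]] by force
qed

section \<open>Ideals of rational intervals\<close>

abbreviation ideal :: "real set set \<Rightarrow> bool" where
  "ideal \<equiv> is_ideal interval_order"

lemma Field_E0: "Field (E 0) = Base ` Collect ideal"
  by (force simp: E_def Field_def ideal_completion_def)

lemma E0_le: "(Base \<alpha>, Base \<beta>) \<in> E 0 \<longleftrightarrow> ideal \<alpha> \<and> ideal \<beta> \<and> \<alpha> \<subseteq> \<beta>"
  by (auto simp: E_def ideal_completion_def)

lemma E0_union_lub:
  assumes "\<And>\<alpha>. \<alpha> \<in> A \<Longrightarrow> ideal \<alpha>" and "ideal (\<Union>A)"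
  shows "is_lub (E 0) (Base ` A) (Base (\<Union>A))"
proof (rule is_lubI)
  fix y assume y: "y \<in> Field (E 0)" "\<And>a. a \<in> Base ` A \<Longrightarrow> (a, y) \<in> E 0"
  then obtain \<beta> where \<beta>: "y = Base \<beta>" "ideal \<beta>" by (auto simp: Field_E0)
  have "\<alpha> \<subseteq> \<beta>" if "\<alpha> \<in> A" for \<alpha> using y(2)[of "Base \<alpha>"] that \<beta>(1) by (simp add: E0_le)
  then show "(Base (\<Union>A), y) \<in> E 0" using assms(2) \<beta> by (auto simp: E0_le)
qed (use assms in \<open>auto simp: Field_E0 E0_le\<close>)

text \<open>The lub of a directed set of ideals is their union, directedness being what makes the
  union closed under intersections. Hence each interval of the limit occurs at some member.\<close>

lemma E0_directed_lub:
  assumes A: "directed (E 0) A" and l: "is_lub (E 0) A (Base \<alpha>)" and I: "I \<in> \<alpha>"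
  shows "\<exists>\<beta>. Base \<beta> \<in> A \<and> I \<in> \<beta>"
proof -
  define B where "B = {\<beta>. Base \<beta> \<in> A}"
  have AB: "A = Base ` B" using A unfolding directed_def B_def Field_E0 by blast
  have id: "ideal \<beta>" if "\<beta> \<in> B" for \<beta>
    using that A unfolding directed_def AB Field_E0 by auto
  have "B \<noteq> {}" using A AB unfolding directed_def by blast
  then obtain \<beta>\<^sub>0 where \<beta>\<^sub>0: "\<beta>\<^sub>0 \<in> B" by blast
  have "ideal (\<Union>B)"
  proof (rule ideal_intervalI)
    show "I \<in> intervals" if "I \<in> \<Union>B" for I using that id ideal_intervalD(1) by blast
    show "UNIV \<in> \<Union>B" using \<beta>\<^sub>0 ideal_intervalD(2)[OF id[OF \<beta>\<^sub>0]] by blast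
    show "I \<inter> J \<in> \<Union>B" if IJ: "I \<in> \<Union>B" "J \<in> \<Union>B" for I J
    proof -
      obtain \<beta> \<gamma> where b: "\<beta> \<in> B" "\<gamma> \<in> B" "I \<in> \<beta>" "J \<in> \<gamma>" using IJ by blast
      have "\<exists>c\<in>A. (Base \<beta>, c) \<in> E 0 \<and> (Base \<gamma>, c) \<in> E 0"
        using A b(1,2) AB unfolding directed_def by blast
      then obtain \<delta> where d: "\<delta> \<in> B" "\<beta> \<subseteq> \<delta>" "\<gamma> \<subseteq> \<delta>" unfolding AB by (auto simp: E0_le)
      then have "I \<inter> J \<in> \<delta>" using ideal_intervalD(3)[OF id[OF d(1)]] b by blast
      then show ?thesis using d(1) by blast
    qed
    show "I \<in> \<Union>B" if "J \<in> \<Union>B" "I \<in> intervals" "J \<subseteq> I" for I J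
      using that ideal_intervalD(4)[OF id] by blast
  qed
  then have "is_lub (E 0) A (Base (\<Union>B))" unfolding AB using id by (intro E0_union_lub)
  then have "\<alpha> = \<Union>B" using lub_unique[OF sd_po[OF scott_domain_E] l] by blast
  then show ?thesis using I B_def by blast
qed

lemma scott_cont_E0_mem:
  assumes f: "scott_cont D (E 0) f" and A: "directed D A" "is_lub D A x"
    and x: "f x = Base \<alpha>" "I \<in> \<alpha>"
  shows "\<exists>a\<in>A. \<exists>\<beta>. f a = Base \<beta> \<and> I \<in> \<beta>"
proof -
  have "is_lub (E 0) (f ` A) (Base \<alpha>)" using scott_contD(3)[OF f A] x(1) by simp
  then obtain \<beta> where "Base \<beta> \<in> f ` A" "I \<in> \<beta>"
    using E0_directed_lub[OF directed_image[OF f A(1)]] x(2) by blast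
  then show ?thesis by (metis imageE)
qed

lemma interval_nonempty: "I \<in> intervals \<Longrightarrow> I \<noteq> {}"
  by (auto simp: intervals_def of_rat_less_eq)

lemma interval_closed: "I \<in> intervals \<Longrightarrow> closed I"
  by (auto simp: intervals_def)

lemma interval_rat: "p \<le> q \<Longrightarrow> {real_of_rat p..real_of_rat q} \<in> intervals"
  by (auto simp: intervals_def)

lemma interval_convex: "I \<in> intervals \<Longrightarrow> x \<in> I \<Longrightarrow> y \<in> I \<Longrightarrow> x \<le> z \<Longrightarrow> z \<le> y \<Longrightarrow> z \<in> I"
  by (auto simp: intervals_def)

lemma ideal_finite_Inter: "finite F \<Longrightarrow> ideal \<alpha> \<Longrightarrow> F \<subseteq> \<alpha> \<Longrightarrow> \<Inter>F \<in> \<alpha>"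
  by (induction rule: finite_induct) (auto intro: ideal_intervalD)

text \<open>Apart from the ideal with the single member \<open>UNIV\<close>, an ideal has a compact
  member, and finite intersections of members are members, hence nonempty; compactness does the
  rest.\<close>

lemma ideal_Inter_nonempty:
  assumes i: "ideal \<alpha>"
  shows "\<Inter>\<alpha> \<noteq> {}"
proof (cases "\<alpha> \<subseteq> {UNIV}")
  case True
  then show ?thesis by blast
next
  case False
  then obtain I where I: "I \<in> \<alpha>" "I \<noteq> UNIV" by blast
  then have "compact I" using ideal_intervalD(1)[OF i I(1)] by (auto simp: intervals_def)
  then have "I \<inter> \<Inter>\<alpha> \<noteq> {}"
  proof (rule compact_imp_fip)
    show "closed T" if "T \<in> \<alpha>" for T using interval_closed ideal_intervalD(1)[OF i that] by blast
    fix F assume F: "finite F" "F \<subseteq> \<alpha>"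
    then have "I \<inter> \<Inter>F \<in> \<alpha>" using ideal_intervalD(3)[OF i I(1) ideal_finite_Inter[OF F(1) i F(2)]] by simp
    then show "I \<inter> \<Inter>F \<noteq> {}" using interval_nonempty ideal_intervalD(1)[OF i] by blast
  qed
  then show ?thesis by blast
qed

text \<open>Some member misses \<open>r - e\<close> and some member misses \<open>r + e\<close>;
  both contain \<open>r\<close> and are convex, so their intersection stays strictly between these
  points.\<close>

lemma ideal_point_nbhd:
  assumes i: "ideal \<alpha>" and r: "\<Inter>\<alpha> = {r}" and e: "e > 0"
  shows "\<exists>I\<in>\<alpha>. I \<subseteq> {r - e<..<r + e}"
proof -
  have "r - e \<notin> \<Inter>\<alpha>" "r + e \<notin> \<Inter>\<alpha>" unfolding r using e by auto
  then obtain I J where I: "I \<in> \<alpha>" "r - e \<notin> I" and J: "J \<in> \<alpha>" "r + e \<notin> J" by blast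
  have IJ: "I \<in> intervals" "J \<in> intervals" using I J ideal_intervalD(1)[OF i] by auto
  have rIJ: "r \<in> I" "r \<in> J" using r I J by blast+
  have "I \<inter> J \<subseteq> {r - e<..<r + e}"
  proof
    fix z assume z: "z \<in> I \<inter> J"
    have "\<not> z \<le> r - e" using interval_convex[OF IJ(1) _ rIJ(1), of z "r - e"] z I(2) e by auto
    moreover have "\<not> r + e \<le> z" using interval_convex[OF IJ(2) rIJ(2), of z "r + e"] z J(2) e by auto
    ultimately show "z \<in> {r - e<..<r + e}" by auto
  qed
  then show ?thesis using ideal_intervalD(3)[OF i I(1) J(1)] by blast
qed

text \<open>The ideal generated by a filter base of arbitrary sets of reals. The sets need not be
  intervals, which allows raw sets of candidate values to define an element of
  \<open>E 0\<close>.\<close>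

definition up :: "real set set \<Rightarrow> real set set" where
  "up \<W> = {I \<in> intervals. \<exists>W\<in>\<W>. W \<subseteq> I}"

lemma ideal_up:
  assumes ne: "\<W> \<noteq> {}" "\<And>W. W \<in> \<W> \<Longrightarrow> W \<noteq> {}"
    and d: "\<And>W W'. W \<in> \<W> \<Longrightarrow> W' \<in> \<W> \<Longrightarrow> \<exists>W''\<in>\<W>. W'' \<subseteq> W \<inter> W'"
  shows "ideal (up \<W>)"
proof (rule ideal_intervalI)
  show "UNIV \<in> up \<W>" using ne(1) by (auto simp: up_def intervals_def)
  fix I J assume "I \<in> up \<W>" "J \<in> up \<W>"
  then obtain W W' where W: "W \<in> \<W>" "W' \<in> \<W>" "W \<subseteq> I" "W' \<subseteq> J" "I \<in> intervals" "J \<in> intervals"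
    unfolding up_def by blast
  obtain W'' where W'': "W'' \<in> \<W>" "W'' \<subseteq> W \<inter> W'" using d[OF W(1,2)] by blast
  then have "I \<inter> J \<in> intervals" using intervals_Int[OF W(5,6)] ne(2)[OF W''(1)] W(3,4) by blast
  then show "I \<inter> J \<in> up \<W>" using W W'' unfolding up_def by blast
qed (auto simp: up_def)

lemma rat_interval_between:
  assumes "e > 0"
  shows "\<exists>I\<in>intervals. {r - e..r + e} \<subseteq> I \<and> I \<subseteq> {r - 2 * e<..<r + 2 * e}"
proof -
  obtain p where p: "r - 2 * e < real_of_rat p" "real_of_rat p < r - e"
    using of_rat_dense[of "r - 2 * e" "r - e"] assms by auto
  obtain q where q: "r + e < real_of_rat q" "real_of_rat q < r + 2 * e"
    using of_rat_dense[of "r + e" "r + 2 * e"] assms by auto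
  have "real_of_rat p \<le> real_of_rat q" using p q assms by linarith
  then have "p \<le> q" by (simp add: of_rat_less_eq)
  then show ?thesis using interval_rat[of p q] p q by (intro bexI[of _ "{real_of_rat p..real_of_rat q}"]) auto
qed

lemma Inter_up_point:
  assumes i: "ideal (up \<W>)" and W: "\<And>e. e > 0 \<Longrightarrow> \<exists>W\<in>\<W>. W \<subseteq> {r - e..r + e}"
  shows "\<Inter>(up \<W>) = {r}"
proof -
  have "z = r" if z: "z \<in> \<Inter>(up \<W>)" for z
  proof (rule ccontr)
    assume "z \<noteq> r"
    \<comment> \<open>With half the distance, the open interval of radius \<open>2 * e\<close>
      around \<open>r\<close> just excludes \<open>z\<close>.\<close>
    define e where "e = \<bar>z - r\<bar> / 2"
    have e: "e > 0" using \<open>z \<noteq> r\<close> by (simp add: e_def)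
    obtain I where I: "I \<in> intervals" "{r - e..r + e} \<subseteq> I" "I \<subseteq> {r - 2 * e<..<r + 2 * e}"
      using rat_interval_between[OF e] by blast
    have "I \<in> up \<W>" using W[OF e] I unfolding up_def by blast
    then have "z \<in> {r - 2 * e<..<r + 2 * e}" using z I by blast
    then show False unfolding e_def by (auto simp: abs_if split: if_splits)
  qed
  then show ?thesis using ideal_Inter_nonempty[OF i] by blast
qed

lemma nat_rep_up: "nat_rep n = up {{real n}}"
proof -
  have "real_of_rat p \<le> real n \<longleftrightarrow> p \<le> of_nat n" "real n \<le> real_of_rat p \<longleftrightarrow> of_nat n \<le> p" for p
    by (metis of_rat_less_eq of_rat_of_nat_eq)+
  then show ?thesis unfolding nat_rep_def up_def intervals_def by fastforce
qed

lemma ideal_nat_rep: "ideal (nat_rep n)"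
  unfolding nat_rep_up by (rule ideal_up) auto

lemma Inter_nat_rep: "\<Inter>(nat_rep n) = {real n}"
  using ideal_nat_rep unfolding nat_rep_up by (rule Inter_up_point) auto

text \<open>The reals compatible with an element of \<open>E 0\<close>; totality means that one
  point is left. \<open>Code\<close> does not occur at the base level, so its value is a
  dummy.\<close>

definition pts :: "real set set elt \<Rightarrow> real set" where
  "pts u = (case u of Base \<alpha> \<Rightarrow> \<Inter>\<alpha> | Code _ \<Rightarrow> {})"

lemma pts_Base [simp]: "pts (Base \<alpha>) = \<Inter>\<alpha>"
  by (simp add: pts_def)

lemma pts_nonempty: "u \<in> Field (E 0) \<Longrightarrow> pts u \<noteq> {}"
  using ideal_Inter_nonempty by (auto simp: Field_E0 pts_def)

lemma pts_antimono: "(u, v) \<in> E 0 \<Longrightarrow> pts v \<subseteq> pts u"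
proof -
  assume uv: "(u, v) \<in> E 0"
  then obtain \<alpha> \<beta> where "u = Base \<alpha>" "v = Base \<beta>" using FieldI12[OF uv] by (auto simp: Field_E0)
  then show ?thesis using uv by (auto simp: E0_le)
qed

lemma E_per_0: "E_per 0 u v \<longleftrightarrow> u \<in> Field (E 0) \<and> v \<in> Field (E 0) \<and> (\<exists>r. pts u = {r} \<and> pts v = {r})"
  by (auto simp: E_per_def Field_E0)

text \<open>The epsilon form of continuity: an interval of the limit ideal inside the neighbourhood
  already occurs at some member of \<open>A\<close>.\<close>

lemma pts_nbhd:
  assumes f: "scott_cont D (E 0) f" and A: "directed D A" "is_lub D A x"
    and r: "pts (f x) = {r}" and e: "e > 0"
  shows "\<exists>a\<in>A. pts (f a) \<subseteq> {r - e<..<r + e}"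
proof -
  have "f x \<in> Field (E 0)" using scott_contD(1)[OF f lub_field[OF A(2)]] .
  then obtain \<alpha> where \<alpha>: "f x = Base \<alpha>" "ideal \<alpha>" by (auto simp: Field_E0)
  then obtain I where I: "I \<in> \<alpha>" "I \<subseteq> {r - e<..<r + e}" using ideal_point_nbhd[of \<alpha> r e] r e by auto
  obtain a \<beta> where "a \<in> A" "f a = Base \<beta>" "I \<in> \<beta>" using scott_cont_E0_mem[OF f A \<alpha>(1) I(1)] by blast
  then show ?thesis using I(2) by (intro bexI[of _ a]) auto
qed

section \<open>Rounding\<close>

text \<open>Any radius below \<open>1 / 2\<close> keeps these intervals disjoint for distinct
  numbers; the radius is rational so that they belong to \<open>intervals\<close>.\<close>

definition third :: "nat \<Rightarrow> real set" where
  "third n = {real n - 1 / 3..real n + 1 / 3}"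

text \<open>Partial rounding. Its result is a number only once an interval of the ideal certifies
  it, and bottom otherwise, which makes it continuous; \<open>THE\<close> is justified by
  \<open>third_unique\<close>.\<close>

definition nint :: "real set set elt \<Rightarrow> nat option elt" where
  "nint u = Base (if \<exists>n \<alpha>. u = Base \<alpha> \<and> third n \<in> \<alpha> then Some (THE n. \<exists>\<alpha>. u = Base \<alpha> \<and> third n \<in> \<alpha>) else None)"

lemma third_interval: "third n \<in> intervals"
proof -
  have "third n = {real_of_rat (of_nat n - 1 / 3)..real_of_rat (of_nat n + 1 / 3)}"
    by (simp add: third_def of_rat_diff of_rat_add of_rat_divide)
  then show ?thesis using interval_rat[of "of_nat n - 1 / 3" "of_nat n + 1 / 3"] by simp
qed

lemma third_unique: "ideal \<alpha> \<Longrightarrow> third n \<in> \<alpha> \<Longrightarrow> third m \<in> \<alpha> \<Longrightarrow> n = m"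
proof (rule ccontr)
  assume "ideal \<alpha>" "third n \<in> \<alpha>" "third m \<in> \<alpha>" "n \<noteq> m"
  then have "third n \<inter> third m \<noteq> {}" using ideal_intervalD(1,3) interval_nonempty by meson
  then show False using \<open>n \<noteq> m\<close> by (auto simp: third_def)
qed

lemma nint_Some: "ideal \<alpha> \<Longrightarrow> nint (Base \<alpha>) = Base (Some n) \<longleftrightarrow> third n \<in> \<alpha>"
proof -
  assume i: "ideal \<alpha>"
  have "(THE n. \<exists>\<beta>. Base \<alpha> = Base \<beta> \<and> third n \<in> \<beta>) = n" if "third n \<in> \<alpha>" for n
    using that third_unique[OF i] by (intro the_equality) auto
  then show ?thesis using third_unique[OF i] unfolding nint_def by auto
qed

lemma nint_Field: "nint u \<in> Field (N 0)"
  by (simp add: nint_def Field_N0)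

text \<open>The certificate \<open>third n\<close> is a single interval, so by
  \<open>E0_directed_lub\<close> it is present at some member of the directed set.\<close>

lemma scott_cont_nint: "scott_cont (E 0) (N 0) nint"
proof -
  have m: "(nint x, nint y) \<in> N 0" if xy: "(x, y) \<in> E 0" for x y
  proof -
    obtain \<alpha> \<beta> where ab: "x = Base \<alpha>" "y = Base \<beta>" using FieldI12[OF xy] by (auto simp: Field_E0)
    then have i: "ideal \<alpha>" "ideal \<beta>" "\<alpha> \<subseteq> \<beta>" using xy by (auto simp: E0_le)
    show ?thesis
    proof (cases rule: N0_cases[OF nint_Field[of x]])
      case 1
      then show ?thesis using N0_le unfolding nint_def by auto
    next
      case (2 n)
      then have "nint y = Base (Some n)" using i nint_Some ab by auto
      then show ?thesis using 2 by (simp add: N0_le)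
    qed
  qed
  show ?thesis
    unfolding scott_cont_def
  proof (intro conjI allI impI)
    show "nint \<in> Field (E 0) \<rightarrow> Field (N 0)" using nint_Field by blast
    show "(nint x, nint y) \<in> N 0" if "(x, y) \<in> E 0" for x y using that by (rule m)
    fix A x assume A: "directed (E 0) A" "is_lub (E 0) A x"
    show "is_lub (N 0) (nint ` A) (nint x)"
    proof (rule is_lubI[OF nint_Field])
      show "(a, nint x) \<in> N 0" if "a \<in> nint ` A" for a using that m lub_ub[OF A(2)] by blast
      fix y assume y: "y \<in> Field (N 0)" "\<And>a. a \<in> nint ` A \<Longrightarrow> (a, y) \<in> N 0"
      show "(nint x, y) \<in> N 0"
      proof (cases rule: N0_cases[OF nint_Field[of x]])
        case 1
        then show ?thesis using y(1) N0_le unfolding Field_N0 by auto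
      next
        case (2 n)
        obtain \<alpha> where \<alpha>: "x = Base \<alpha>" "ideal \<alpha>" using lub_field[OF A(2)] by (auto simp: Field_E0)
        then obtain \<beta> where \<beta>: "Base \<beta> \<in> A" "third n \<in> \<beta>"
          using E0_directed_lub[OF A(1), of \<alpha> "third n"] A(2) 2 nint_Some by auto
        then have "ideal \<beta>" using A(1) unfolding directed_def by (auto simp: Field_E0)
        then have "nint (Base \<beta>) = nint x" using \<beta> 2 nint_Some by auto
        then show ?thesis using y(2) \<beta>(1) by force
      qed
    qed
  qed
qed

abbreviation dist_nat :: "real \<Rightarrow> real" where
  "dist_nat r \<equiv> infdist r (range real)"

lemma dist_nat_lipschitz: "\<bar>dist_nat r - dist_nat s\<bar> \<le> \<bar>r - s\<bar>"
  using infdist_triangle_abs[of r "range real" s] by (simp add: dist_real_def)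

text \<open>The strict inequality leaves room for an interval of the ideal around \<open>r\<close>
  inside \<open>third n\<close>. At distance exactly \<open>1 / 3\<close> the ideal need not contain
  \<open>third n\<close>.\<close>

lemma nint_near:
  assumes u: "u \<in> Field (E 0)" and r: "pts u = {r}" and n: "\<bar>r - real n\<bar> < 1 / 3"
  shows "nint u = Base (Some n)"
proof -
  obtain \<alpha> where \<alpha>: "u = Base \<alpha>" "ideal \<alpha>" using u by (auto simp: Field_E0)
  then obtain I where I: "I \<in> \<alpha>" "I \<subseteq> {r - (1 / 3 - \<bar>r - real n\<bar>)<..<r + (1 / 3 - \<bar>r - real n\<bar>)}"
    using ideal_point_nbhd[of \<alpha> r "1 / 3 - \<bar>r - real n\<bar>"] r n by auto
  have "I \<subseteq> third n"
  proof
    fix z assume "z \<in> I"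
    then have "z \<in> {r - (1 / 3 - \<bar>r - real n\<bar>)<..<r + (1 / 3 - \<bar>r - real n\<bar>)}" using I by blast
    then show "z \<in> third n" unfolding third_def by (auto simp: abs_if split: if_splits)
  qed
  then have "third n \<in> \<alpha>" using ideal_intervalD(4)[OF \<alpha>(2) I(1) third_interval] by blast
  then show ?thesis using nint_Some \<alpha> by blast
qed

lemma nint_total:
  assumes uv: "E_per 0 u v" and near: "pts u \<subseteq> {r. dist_nat r \<le> 1 / 4}"
  shows "N_per 0 (nint u) (nint v)"
proof -
  obtain r where r: "u \<in> Field (E 0)" "v \<in> Field (E 0)" "pts u = {r}" "pts v = {r}"
    using uv E_per_0 by auto
  have "dist_nat r < 1 / 3" using near r by auto
  then have "(INF a\<in>range real. dist r a) < 1 / 3" by (simp add: infdist_notempty)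
  then obtain n where "\<bar>r - real n\<bar> < 1 / 3"
    by (subst (asm) cINF_less_iff) (auto simp: dist_real_def intro!: bdd_belowI[of _ 0])
  then have "nint u = Base (Some n)" "nint v = Base (Some n)" using nint_near r by auto
  then show ?thesis by (simp add: N_per_def)
qed

definition rep :: "nat option elt \<Rightarrow> real set set elt" where
  "rep u = (case u of Base (Some n) \<Rightarrow> Base (nat_rep n) | _ \<Rightarrow> Base {UNIV})"

lemma scott_cont_rep: "scott_cont (N 0) (E 0) rep"
proof -
  have "{UNIV} = up {UNIV}" by (auto simp: up_def intervals_def)
  also have "ideal \<dots>" by (rule ideal_up) auto
  finally have "ideal {UNIV}" .
  then show ?thesis
    using ideal_nat_rep ideal_intervalD(2)[OF ideal_nat_rep]
    by (intro scott_cont_N0I[OF sd_po[OF scott_domain_E]])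
      (auto simp: rep_def Field_E0 E0_le split: option.split)
qed

text \<open>Rounding is a left inverse of \<open>rep\<close> on numbers; this is what lets the
  embedding recover the original functional from its image.\<close>

lemma nint_rep: "nint (rep (Base (Some n))) = Base (Some n)"
proof -
  have "third n \<in> nat_rep n" using third_interval by (auto simp: nat_rep_up up_def third_def)
  then show ?thesis using nint_Some[OF ideal_nat_rep] by (simp add: rep_def)
qed

section \<open>Totality\<close>

text \<open>Both properties are proved jointly: transitivity for functionals compares
  \<open>f a\<close> with \<open>g b\<close> and \<open>g b\<close> with \<open>h b\<close>, and
  thus needs that \<open>b\<close> is related to itself, which comes from symmetry and transitivity
  one level down.\<close>

lemma hier_per_sym_trans:
  assumes R: "\<And>x y. R x y \<Longrightarrow> R y x" "\<And>x y z. R x y \<Longrightarrow> R y z \<Longrightarrow> R x z"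
  shows "(\<forall>x y. hier_per D R k x y \<longrightarrow> hier_per D R k y x) \<and>
    (\<forall>x y z. hier_per D R k x y \<longrightarrow> hier_per D R k y z \<longrightarrow> hier_per D R k x z)"
proof (induction k)
  case 0
  show ?case unfolding hier_per.simps by (intro conjI allI impI) (erule R(1), erule (1) R(2))
next
  case (Suc k)
  then have s: "hier_per D R k y x" if "hier_per D R k x y" for x y using that by blast
  have r: "hier_per D R k y y" if "hier_per D R k x y" for x y using that Suc by blast
  show ?case
  proof (intro conjI allI impI)
    fix f g assume fg: "hier_per D R (Suc k) f g"
    show "hier_per D R (Suc k) g f" using fg R(1) s by simp
    fix h assume gh: "hier_per D R (Suc k) g h"
    show "hier_per D R (Suc k) f h"
      unfolding hier_per.simps
    proof (intro conjI ballI impI)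
      show "f \<in> Field (hier D (Suc k))" "h \<in> Field (hier D (Suc k))" using fg gh by simp_all
      fix a b assume ab: "a \<in> Field (hier D k)" "b \<in> Field (hier D k)" "hier_per D R k a b"
      then show "R (app (hier D k) D f a) (app (hier D k) D h b)"
        using R(2) fg gh r[OF ab(3)] unfolding hier_per.simps by blast
    qed
  qed
qed

lemma N_per_sym: "N_per k a b \<Longrightarrow> N_per k b a" and N_per_trans: "N_per k a b \<Longrightarrow> N_per k b c \<Longrightarrow> N_per k a c"
  using hier_per_sym_trans[of "\<lambda>x y. \<exists>n. x = Base (Some n) \<and> y = Base (Some n)" "N 0" k]
  unfolding N_per_def by blast+

lemma N_per_0: "N_per 0 u v \<longleftrightarrow> (\<exists>n. u = Base (Some n) \<and> v = Base (Some n))"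
  by (simp add: N_per_def)

lemma hier_N: "hier (N 0) k = N k" and hier_E: "hier (E 0) k = E k"
  by (simp_all add: N_def E_def)

lemma N_per_Suc: "N_per (Suc k) f g \<longleftrightarrow> f \<in> Field (N (Suc k)) \<and> g \<in> Field (N (Suc k)) \<and>
    (\<forall>a\<in>Field (N k). \<forall>b\<in>Field (N k). N_per k a b \<longrightarrow> N_per 0 (N_app k f a) (N_app k g b))"
  unfolding N_per_def hier_per.simps hier_N N_app_def by (simp add: hier_N[of "Suc k", simplified])

lemma E_per_Suc: "E_per (Suc k) f g \<longleftrightarrow> f \<in> Field (E (Suc k)) \<and> g \<in> Field (E (Suc k)) \<and>
    (\<forall>a\<in>Field (E k). \<forall>b\<in>Field (E k). E_per k a b \<longrightarrow> E_per 0 (E_app k f a) (E_app k g b))"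
  unfolding E_per_def hier_per.simps hier_E E_app_def by (simp add: hier_E[of "Suc k", simplified])

lemma N_per_Field: "N_per k a b \<Longrightarrow> a \<in> Field (N k)" "N_per k a b \<Longrightarrow> b \<in> Field (N k)"
  by (cases k; auto simp: N_per_0 N_per_Suc Field_N0)+

lemma E_per_Field: "E_per k a b \<Longrightarrow> a \<in> Field (E k)" "E_per k a b \<Longrightarrow> b \<in> Field (E k)"
  by (cases k; auto simp: E_per_0 E_per_Suc)+

lemma N_per_app: "N_per (Suc k) f g \<Longrightarrow> N_per k a b \<Longrightarrow> N_per 0 (N_app k f a) (N_app k g b)"
  using N_per_Field unfolding N_per_Suc by blast

lemma E_per_app: "E_per (Suc k) f g \<Longrightarrow> E_per k a b \<Longrightarrow> E_per 0 (E_app k f a) (E_app k g b)"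
  using E_per_Field unfolding E_per_Suc by blast

lemma N_tot_iff: "a \<in> N_tot k \<longleftrightarrow> N_per k a a" and E_tot_iff: "x \<in> E_tot k \<longleftrightarrow> E_per k x x"
  using N_per_Field E_per_Field unfolding N_tot_def E_tot_def by blast+

lemma N_per_tot: "N_per k a b \<Longrightarrow> a \<in> N_tot k"
  using N_per_sym N_per_trans N_tot_iff by blast

section \<open>Truncations of the natural number functionals\<close>

text \<open>A map \<open>z\<close> on the base domain acts at every level by conjugation, cutting
  down the arguments hereditarily as well as the values.\<close>

primrec trunc :: "(nat option elt \<Rightarrow> nat option elt) \<Rightarrow> nat \<Rightarrow> nat option elt \<Rightarrow> nat option elt" where
  "trunc z 0 = z"
| "trunc z (Suc k) = dmap (N k) (N k) (N 0) (N 0) (trunc z k) z"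

lemma scott_cont_trunc: "scott_cont (N 0) (N 0) z \<Longrightarrow> scott_cont (N k) (N k) (trunc z k)"
  by (induction k) (simp_all add: N_Suc scott_cont_dmap[OF scott_domain_N scott_domain_N scott_domain_N scott_domain_N])

lemma N_app_trunc:
  assumes "scott_cont (N 0) (N 0) z" "f \<in> Field (N (Suc k))" "a \<in> Field (N k)"
  shows "N_app k (trunc z (Suc k) f) a = z (N_app k f (trunc z k a))"
  using app_dmap[OF scott_domain_N scott_domain_N scott_domain_N scott_domain_N scott_cont_trunc[OF assms(1)] assms(1)]
    assms(2,3) by (simp add: N_app_def N_Suc)

lemma N_app_Field: "f \<in> Field (N (Suc k)) \<Longrightarrow> a \<in> Field (N k) \<Longrightarrow> N_app k f a \<in> Field (N 0)"
  and scott_cont_N_app: "f \<in> Field (N (Suc k)) \<Longrightarrow> scott_cont (N k) (N 0) (N_app k f)"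
  and scott_cont_N_app_left: "a \<in> Field (N k) \<Longrightarrow> scott_cont (N (Suc k)) (N 0) (\<lambda>f. N_app k f a)"
  unfolding N_Suc N_app_def
  by (rule scott_contD(1)[OF scott_cont_app[OF scott_domain_N scott_domain_N]]
        scott_cont_app[OF scott_domain_N scott_domain_N]
        scott_cont_app_left[OF scott_domain_N scott_domain_N]; assumption)+

lemma N_app_le: "(f, g) \<in> N (Suc k) \<Longrightarrow> (a, b) \<in> N k \<Longrightarrow> (N_app k f a, N_app k g b) \<in> N 0"
  unfolding N_Suc N_app_def by (rule app_le[OF scott_domain_N scott_domain_N])

lemma scott_cont_E_app: "f \<in> Field (E (Suc k)) \<Longrightarrow> scott_cont (E k) (E 0) (E_app k f)"
  and scott_cont_E_app_left: "a \<in> Field (E k) \<Longrightarrow> scott_cont (E (Suc k)) (E 0) (\<lambda>f. E_app k f a)"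
  unfolding E_Suc E_app_def
  by (rule scott_cont_app[OF scott_domain_E scott_domain_E]
        scott_cont_app_left[OF scott_domain_E scott_domain_E]; assumption)+

text \<open>The action is covariant although arguments are truncated too: a larger truncation gives
  \<open>f\<close> a larger argument, and \<open>f\<close> is monotone.\<close>

lemma trunc_mono:
  assumes z: "scott_cont (N 0) (N 0) z" "scott_cont (N 0) (N 0) z'"
    and le: "\<And>u. u \<in> Field (N 0) \<Longrightarrow> (z u, z' u) \<in> N 0"
  shows "a \<in> Field (N k) \<Longrightarrow> (trunc z k a, trunc z' k a) \<in> N k"
proof (induction k arbitrary: a)
  case 0
  then show ?case using le by simp
next
  case (Suc k f)
  have F: "trunc z (Suc k) f \<in> Field (N (Suc k))" "trunc z' (Suc k) f \<in> Field (N (Suc k))"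
    using scott_contD(1)[OF scott_cont_trunc Suc.prems] z by blast+
  have "(N_app k (trunc z (Suc k) f) a, N_app k (trunc z' (Suc k) f) a) \<in> N 0" if a: "a \<in> Field (N k)" for a
  proof -
    have "(z (N_app k f (trunc z k a)), z (N_app k f (trunc z' k a))) \<in> N 0"
      using scott_contD(2)[OF z(1) scott_contD(2)[OF scott_cont_N_app[OF Suc.prems] Suc.IH[OF a]]] .
    moreover have "(z (N_app k f (trunc z' k a)), z' (N_app k f (trunc z' k a))) \<in> N 0"
      using le N_app_Field[OF Suc.prems] scott_contD(1)[OF scott_cont_trunc[OF z(2)] a] by blast
    ultimately show ?thesis
      unfolding N_app_trunc[OF z(1) Suc.prems a] N_app_trunc[OF z(2) Suc.prems a]
      using po_trans[OF sd_po[OF scott_domain_N]] by blast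
  qed
  then show ?case using N_function_space(2)[OF F] by blast
qed

text \<open>A truncated functional is determined by a function from the finitely many truncated
  arguments to the finitely many values of \<open>z\<close>.\<close>

lemma trunc_finite:
  assumes z: "scott_cont (N 0) (N 0) z" and fin: "finite (z ` Field (N 0))"
  shows "finite (trunc z k ` Field (N k))"
proof (induction k)
  case 0
  then show ?case using fin by simp
next
  case (Suc k)
  let ?T = "trunc z k ` Field (N k)"
  let ?e = "\<lambda>\<phi>. encode (N k) (N 0) (restrict (\<lambda>a. \<phi> (trunc z k a)) (Field (N k)))"
  have "trunc z (Suc k) f \<in> ?e ` (?T \<rightarrow>\<^sub>E z ` Field (N 0))" if f: "f \<in> Field (N (Suc k))" for f
  proof (rule image_eqI)
    let ?\<phi> = "restrict (\<lambda>b. z (N_app k f b)) ?T"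
    show "?\<phi> \<in> ?T \<rightarrow>\<^sub>E z ` Field (N 0)"
      using N_app_Field[OF f] scott_contD(1)[OF scott_cont_trunc[OF z]] by auto
    have "restrict (\<lambda>a. z (N_app k f (trunc z k a))) (Field (N k)) = restrict (\<lambda>a. ?\<phi> (trunc z k a)) (Field (N k))"
      by (rule restrict_ext) simp
    then show "trunc z (Suc k) f = ?e ?\<phi>" by (simp add: dmap_def N_app_def)
  qed
  moreover have "finite (?T \<rightarrow>\<^sub>E z ` Field (N 0))" using Suc fin by (intro finite_PiE)
  ultimately show ?case by (meson finite_imageI finite_subset image_subsetI)
qed

lemma trunc_total:
  assumes z: "scott_cont (N 0) (N 0) z" and t: "\<And>u v. N_per 0 u v \<Longrightarrow> N_per 0 (z u) (z v)"
  shows "N_per k a b \<Longrightarrow> N_per k (trunc z k a) (trunc z k b)"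
proof (induction k arbitrary: a b)
  case 0
  then show ?case using t by simp
next
  case (Suc k f g)
  note F = N_per_Field[OF Suc.prems]
  have "N_per 0 (N_app k (trunc z (Suc k) f) a) (N_app k (trunc z (Suc k) g) b)" if ab: "N_per k a b" for a b
    unfolding N_app_trunc[OF z F(1) N_per_Field(1)[OF ab]] N_app_trunc[OF z F(2) N_per_Field(2)[OF ab]]
    using t N_per_app[OF Suc.prems Suc.IH[OF ab]] by blast
  then show ?case using scott_contD(1)[OF scott_cont_trunc[OF z]] F unfolding N_per_Suc by blast
qed

text \<open>
  \<open>trunc (cap i)\<close> is the truncation \<open>t\<^sub>i\<close>, and \<open>trunc (chop m)\<close> is the lower bound \<open>p\<^sub>m\<close>.
\<close>

definition cap :: "nat \<Rightarrow> nat option elt \<Rightarrow> nat option elt" where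
  "cap i u = (case u of Base (Some n) \<Rightarrow> Base (Some (min n i)) | _ \<Rightarrow> Base None)"

definition chop :: "nat \<Rightarrow> nat option elt \<Rightarrow> nat option elt" where
  "chop m u = (case u of Base (Some n) \<Rightarrow> Base (if n \<le> m then Some n else None) | _ \<Rightarrow> Base None)"

lemma scott_cont_cap: "scott_cont (N 0) (N 0) (cap i)" and scott_cont_chop: "scott_cont (N 0) (N 0) (chop m)"
  by (rule scott_cont_N0I[OF sd_po[OF scott_domain_N]];
      auto simp: cap_def chop_def Field_N0 N0_le split: option.split)+

lemma finite_trunc_cap: "finite (trunc (cap i) k ` Field (N k))"
proof (rule trunc_finite[OF scott_cont_cap])
  have "cap i ` Field (N 0) \<subseteq> insert (Base None) ((\<lambda>n. Base (Some n)) ` {..i})"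
  proof
    fix u assume "u \<in> cap i ` Field (N 0)"
    then obtain a where "u = cap i (Base a)" by (auto simp: Field_N0)
    then show "u \<in> insert (Base None) ((\<lambda>n. Base (Some n)) ` {..i})" by (cases a) (auto simp: cap_def)
  qed
  then show "finite (cap i ` Field (N 0))" by (rule finite_subset) simp
qed

lemma trunc_cap_total: "N_per k a b \<Longrightarrow> N_per k (trunc (cap i) k a) (trunc (cap i) k b)"
  by (rule trunc_total[OF scott_cont_cap]) (auto simp: N_per_0 cap_def)

text \<open>\<open>chop m\<close> erases the numbers above \<open>m\<close>, while
  \<open>cap i\<close> fixes the others. Such a lower bound is needed because the caps do not
  increase: \<open>cap i\<close> and \<open>cap (Suc i)\<close> send each number above
  \<open>i\<close> to different numbers.\<close>

lemma trunc_chop_le_cap: "m \<le> i \<Longrightarrow> a \<in> Field (N k) \<Longrightarrow> (trunc (chop m) k a, trunc (cap i) k a) \<in> N k"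
  by (rule trunc_mono[OF scott_cont_chop scott_cont_cap]) (auto simp: Field_N0 N0_le cap_def chop_def split: option.split)

lemma trunc_chop_Suc: "a \<in> Field (N k) \<Longrightarrow> (trunc (chop m) k a, trunc (chop (Suc m)) k a) \<in> N k"
  by (rule trunc_mono[OF scott_cont_chop scott_cont_chop]) (auto simp: Field_N0 N0_le chop_def split: option.split)

text \<open>By induction the truncated arguments converge to \<open>a\<close>; a numerical value of
  \<open>f a\<close> then appears at a finite stage and survives chopping from some stage
  on.\<close>

lemma trunc_chop_lub: "a \<in> Field (N k) \<Longrightarrow> is_lub (N k) (range (\<lambda>m. trunc (chop m) k a)) a"
proof (induction k arbitrary: a)
  case 0
  show ?case
  proof (rule is_lubI[OF 0])
    show "(b, a) \<in> N 0" if "b \<in> range (\<lambda>m. trunc (chop m) 0 a)" for b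
      using that 0 by (auto simp: Field_N0 N0_le chop_def split: option.split)
    fix y assume y: "y \<in> Field (N 0)" "\<And>b. b \<in> range (\<lambda>m. trunc (chop m) 0 a) \<Longrightarrow> (b, y) \<in> N 0"
    show "(a, y) \<in> N 0" using 0
    proof (cases rule: N0_cases)
      case 1
      then show ?thesis using y(1) by (auto simp: Field_N0 N0_le)
    next
      case (2 n)
      then have "a = trunc (chop n) 0 a" by (simp add: chop_def)
      then show ?thesis using y(2) by (metis rangeI)
    qed
  qed
next
  case (Suc k f)
  note po = sd_po[OF scott_domain_N]
  let ?s = "\<lambda>m. trunc (chop m) (Suc k) f"
  show ?case
    unfolding N_Suc
  proof (rule fun_dom_lubI[OF scott_domain_N scott_domain_N])
    show "range ?s \<subseteq> Field (fun_dom (N k) (N 0))" "f \<in> Field (fun_dom (N k) (N 0))"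
      using scott_contD(1)[OF scott_cont_trunc[OF scott_cont_chop] Suc.prems] Suc.prems unfolding N_Suc by blast+
    fix a assume a: "a \<in> Field (N k)"
    have eq: "N_app k (?s m) a = chop m (N_app k f (trunc (chop m) k a))" for m
      using N_app_trunc[OF scott_cont_chop Suc.prems a] .
    have chop_le: "(chop m u, u) \<in> N 0" if "u \<in> Field (N 0)" for m u
      using that by (auto simp: Field_N0 N0_le chop_def split: option.split)
    have dir: "directed (N k) (range (\<lambda>m. trunc (chop m) k a))"
      by (rule chain_directed(2)[where s = "\<lambda>m. trunc (chop m) k a", OF po trunc_chop_Suc[OF a]])
    have l: "is_lub (N 0) (N_app k f ` range (\<lambda>m. trunc (chop m) k a)) (N_app k f a)"
      by (rule scott_contD(3)[OF scott_cont_N_app[OF Suc.prems] dir Suc.IH[OF a]])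
    have F: "N_app k f (trunc (chop m) k a) \<in> Field (N 0)" for m
      by (rule N_app_Field[OF Suc.prems scott_contD(1)[OF scott_cont_trunc[OF scott_cont_chop] a]])
    have "is_lub (N 0) (range (\<lambda>m. N_app k (?s m) a)) (N_app k f a)"
    proof (rule is_lubI[OF N_app_Field[OF Suc.prems a]])
      fix b assume "b \<in> range (\<lambda>m. N_app k (?s m) a)"
      then obtain m where b: "b = chop m (N_app k f (trunc (chop m) k a))" using eq by auto
      show "(b, N_app k f a) \<in> N 0"
        unfolding b using po_trans[OF po chop_le[OF F] lub_ub[OF l]] by blast
    next
      fix y assume y: "y \<in> Field (N 0)" "\<And>b. b \<in> range (\<lambda>m. N_app k (?s m) a) \<Longrightarrow> (b, y) \<in> N 0"
      show "(N_app k f a, y) \<in> N 0"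
        using N_app_Field[OF Suc.prems a]
      proof (cases rule: N0_cases)
        case 1
        then show ?thesis using y(1) by (auto simp: Field_N0 N0_le)
      next
        case (2 n)
        then have "Base (Some n) \<in> N_app k f ` range (\<lambda>m. trunc (chop m) k a)"
          using N0_lub_mem[of "N_app k f ` range (\<lambda>m. trunc (chop m) k a)" n] l F by (simp add: image_subset_iff)
        then obtain m where m: "N_app k f (trunc (chop m) k a) = Base (Some n)" by (elim imageE) simp
        \<comment> \<open>Stage \<open>m\<close> makes the value appear; stage \<open>n\<close>
          ensures that \<open>chop\<close> does not erase it.\<close>
        let ?m = "max m n"
        have "(trunc (chop m) k a, trunc (chop ?m) k a) \<in> N k"
          by (rule chain_directed(1)[where s = "\<lambda>m. trunc (chop m) k a", OF po trunc_chop_Suc[OF a]]) simp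
        then have "N_app k f (trunc (chop ?m) k a) = Base (Some n)"
          using scott_contD(2)[OF scott_cont_N_app[OF Suc.prems]] m N0_Some_le by metis
        then have "N_app k (?s ?m) a = Base (Some n)" unfolding eq by (simp add: chop_def)
        then show ?thesis using y(2) 2 by (metis rangeI)
      qed
    qed
    then show "is_lub (N 0) ((\<lambda>f. app (N k) (N 0) f a) ` range ?s) (app (N k) (N 0) f a)"
      by (simp add: image_image N_app_def)
  qed
qed

section \<open>Extending functionals from integer-valued to real-valued arguments\<close>

text \<open>
  The weight vanishes from distance \<open>1 / 4\<close> on, whereas rounding succeeds up to distance \<open>1 / 3\<close>. Due
  to this gap, a stage at which rounding fails has weight zero on a whole neighbourhood, so the
  undetermined value at that stage cannot contribute.
\<close>

definition weight :: "real \<Rightarrow> real" where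
  "weight r = max 0 (min 1 (2 - 8 * dist_nat r))"

text \<open>Clamping is nonexpansive and so is \<open>dist_nat\<close>; the slope 8 takes the weight
  from 1 at distance \<open>1 / 8\<close> to 0 at distance \<open>1 / 4\<close>.\<close>

lemma weight_lipschitz: "\<bar>weight r - weight s\<bar> \<le> 8 * \<bar>r - s\<bar>"
proof -
  have "\<bar>max 0 (min 1 a) - max 0 (min 1 b)\<bar> \<le> \<bar>a - b\<bar>" for a b :: real
    by (auto simp: max_def min_def)
  then have "\<bar>weight r - weight s\<bar> \<le> \<bar>(2 - 8 * dist_nat r) - (2 - 8 * dist_nat s)\<bar>"
    unfolding weight_def .
  also have "\<dots> = \<bar>8 * (dist_nat s - dist_nat r)\<bar>" by simp
  also have "\<dots> = 8 * \<bar>dist_nat s - dist_nat r\<bar>" by (simp only: abs_mult abs_numeral)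
  also have "\<dots> \<le> 8 * \<bar>r - s\<bar>" using dist_nat_lipschitz[of s r] by (simp add: abs_minus_commute)
  finally show ?thesis .
qed

lemma weight_nonneg: "0 \<le> weight r"
  by (simp add: weight_def)

lemma Min_insert_lipschitz:
  fixes f f' :: "'g \<Rightarrow> real"
  assumes A: "finite A" and e: "0 \<le> e" and le: "\<And>g. g \<in> A \<Longrightarrow> \<bar>f g - f' g\<bar> \<le> e"
  shows "\<bar>Min (insert 1 (f ` A)) - Min (insert 1 (f' ` A))\<bar> \<le> e"
proof -
  have *: "Min (insert 1 (f ` A)) \<le> Min (insert 1 (f' ` A)) + e"
    if le: "\<And>g. g \<in> A \<Longrightarrow> \<bar>f g - f' g\<bar> \<le> e" for f f' :: "'g \<Rightarrow> real"
  proof -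
    have "Min (insert 1 (f' ` A)) \<in> insert 1 (f' ` A)" using A by (intro Min_in) auto
    then consider "Min (insert 1 (f' ` A)) = 1" | g where "g \<in> A" "Min (insert 1 (f' ` A)) = f' g" by blast
    then show ?thesis
    proof cases
      case 1
      have "Min (insert 1 (f ` A)) \<le> 1" using A by (intro Min_le) auto
      then show ?thesis using 1 e by linarith
    next
      case (2 g)
      have "Min (insert 1 (f ` A)) \<le> f g" using A 2 by (intro Min_le) auto
      then show ?thesis using 2 le[OF 2(1)] by linarith
    qed
  qed
  show ?thesis using *[of f f'] *[of f' f] le by (fastforce simp: abs_le_iff abs_minus_commute)
qed

text \<open>The minimum runs over all stages up to \<open>i\<close>, so it decreases in
  \<open>i\<close>; the inserted 1 covers stages without tests. Here \<open>y\<close> assigns to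
  each test its real value.\<close>

definition Q :: "(nat \<Rightarrow> 'g set) \<Rightarrow> ('g \<Rightarrow> real) \<Rightarrow> nat \<Rightarrow> real" where
  "Q G y i = Min (insert 1 ((\<lambda>g. weight (y g)) ` (\<Union>j\<le>i. G j)))"

lemma
  assumes G: "\<And>i. finite (G i)"
  shows Q_nonneg: "0 \<le> Q G y i" and Q_Suc: "Q G y (Suc i) \<le> Q G y i"
    and Q_zero: "g \<in> G j \<Longrightarrow> j \<le> i \<Longrightarrow> 1 / 4 \<le> dist_nat (y g) \<Longrightarrow> Q G y i = 0"
    and Q_one: "(\<And>j g. j \<le> i \<Longrightarrow> g \<in> G j \<Longrightarrow> dist_nat (y g) \<le> 1 / 8) \<Longrightarrow> Q G y i = 1"
    and Q_lipschitz: "0 \<le> e \<Longrightarrow> (\<And>j g. j \<le> i \<Longrightarrow> g \<in> G j \<Longrightarrow> \<bar>y g - y' g\<bar> \<le> e) \<Longrightarrow>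
      \<bar>Q G y i - Q G y' i\<bar> \<le> 8 * e"
proof -
  have fin: "finite (\<Union>j\<le>i. G j)" for i using G by blast
  have weight1: "weight r = 1" if "dist_nat r \<le> 1 / 8" for r using that by (simp add: weight_def)
  show nonneg: "0 \<le> Q G y i" for i
    unfolding Q_def using fin weight_nonneg by (subst Min_ge_iff) auto
  show "Q G y (Suc i) \<le> Q G y i"
    unfolding Q_def using fin by (intro Min_antimono) (auto simp: atMost_Suc)
  show "Q G y i = 0" if g: "g \<in> G j" "j \<le> i" "1 / 4 \<le> dist_nat (y g)"
  proof -
    have "Q G y i \<le> weight (y g)" unfolding Q_def using fin g by (intro Min_le) auto
    moreover have "weight (y g) = 0" using g(3) by (simp add: weight_def)
    ultimately show ?thesis using nonneg[of i] by linarith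
  qed
  show "Q G y i = 1" if near: "\<And>j g. j \<le> i \<Longrightarrow> g \<in> G j \<Longrightarrow> dist_nat (y g) \<le> 1 / 8"
  proof -
    have "insert 1 ((\<lambda>g. weight (y g)) ` (\<Union>j\<le>i. G j)) = {1}"
      using weight1[OF near] by auto
    then show ?thesis unfolding Q_def by (simp only: Min_singleton)
  qed
  show "\<bar>Q G y i - Q G y' i\<bar> \<le> 8 * e"
    if e: "0 \<le> e" and le: "\<And>j g. j \<le> i \<Longrightarrow> g \<in> G j \<Longrightarrow> \<bar>y g - y' g\<bar> \<le> e"
    unfolding Q_def
  proof (rule Min_insert_lipschitz[OF fin])
    fix g assume "g \<in> (\<Union>j\<le>i. G j)"
    then show "\<bar>weight (y g) - weight (y' g)\<bar> \<le> 8 * e"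
      using weight_lipschitz[of "y g" "y' g"] le by fastforce
  qed (use e in simp)
qed

text \<open>Bottom leaves every real possible, not only the natural numbers. \<open>V_Suc\<close>
  relies on this when it merges two stages into a weighted mean.\<close>

definition possible :: "nat option elt \<Rightarrow> real \<Rightarrow> bool" where
  "possible w v \<longleftrightarrow> (\<forall>n. w = Base (Some n) \<longrightarrow> v = real n)"

lemma possible_ex: "\<exists>v. possible w v"
proof (cases "\<exists>n. w = Base (Some n)")
  case True
  then obtain n where "w = Base (Some n)" by blast
  then have "possible w (real n)" by (simp add: possible_def)
  then show ?thesis by blast
next
  case False
  then have "possible w 0" by (simp add: possible_def)
  then show ?thesis by blast
qed

lemma possible_antimono: "(w, w') \<in> N 0 \<Longrightarrow> possible w' v \<Longrightarrow> possible w v"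
  using N0_Some_le unfolding possible_def by blast

section \<open>Compact approximations\<close>

definition below :: "'a rel \<Rightarrow> 'a \<Rightarrow> 'a set" where
  "below D x = {c. compact_elem D c \<and> (c, x) \<in> D}"

lemma below_Field: "c \<in> below D x \<Longrightarrow> c \<in> Field D"
  by (auto simp: below_def intro: FieldI12)

lemma below_lub:
  assumes "Partial_order D" "directed D A" "is_lub D A x"
  shows "below D x = (\<Union>a\<in>A. below D a)"
  using assms lub_ub[OF assms(3)] po_trans[OF assms(1)] unfolding below_def compact_elem_def by blast

text \<open>The data for extending functionals on \<open>N k\<close> to arguments in
  \<open>E k\<close>: tests \<open>G i\<close>, stage roundings \<open>\<rho> i\<close>, and an
  increasing chain \<open>\<sigma>\<close> with \<open>\<sigma> m\<close> below
  \<open>\<rho> m\<close>, hence below all later roundings. A rounding is total as soon as the tests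
  of its own stage are near natural numbers; the limit of \<open>\<sigma>\<close> is total if all
  tests are. Abstracting from the construction lets level 0 and the successor levels share one
  argument.\<close>

locale extension =
  fixes k :: nat
    and G :: "nat \<Rightarrow> (real set set elt \<Rightarrow> real set set elt) set"
    and \<rho> \<sigma> :: "nat \<Rightarrow> real set set elt \<Rightarrow> nat option elt"
  assumes finG: "\<And>i. finite (G i)"
    and G_cont: "\<And>i g. g \<in> G i \<Longrightarrow> scott_cont (E k) (E 0) g"
    and G_total: "\<And>i g x x'. g \<in> G i \<Longrightarrow> E_per k x x' \<Longrightarrow> E_per 0 (g x) (g x')"
    and \<rho>_cont: "\<And>i. scott_cont (E k) (N k) (\<rho> i)"
    and \<sigma>_cont: "\<And>m. scott_cont (E k) (N k) (\<sigma> m)"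
    and \<sigma>_\<rho>: "\<And>m x. x \<in> Field (E k) \<Longrightarrow> (\<sigma> m x, \<rho> m x) \<in> N k"
    and \<sigma>_Suc: "\<And>m x. x \<in> Field (E k) \<Longrightarrow> (\<sigma> m x, \<sigma> (Suc m) x) \<in> N k"
    and \<rho>_total: "\<And>i x x'. E_per k x x' \<Longrightarrow> (\<And>g. g \<in> G i \<Longrightarrow> pts (g x) \<subseteq> {r. dist_nat r \<le> 1 / 4}) \<Longrightarrow>
      N_per k (\<rho> i x) (\<rho> i x')"
    and \<sigma>_total: "\<And>x x'. E_per k x x' \<Longrightarrow> (\<And>i g. g \<in> G i \<Longrightarrow> pts (g x) \<subseteq> {r. dist_nat r \<le> 1 / 4}) \<Longrightarrow>
      \<exists>b b'. is_lub (N k) (range (\<lambda>m. \<sigma> m x)) b \<and> is_lub (N k) (range (\<lambda>m. \<sigma> m x')) b' \<and> N_per k b b'"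
begin

text \<open>
  The values compatible with information \<open>d\<close> on the functional and \<open>c\<close> on its argument. All stages
  from \<open>m\<close> on are merged into one, for which \<open>\<sigma> m\<close> is a common lower bound.
\<close>

definition V :: "nat \<Rightarrow> nat option elt \<Rightarrow> real set set elt \<Rightarrow> real set" where
  "V m d c = {r. \<exists>y v u. (\<forall>i. \<forall>g\<in>G i. y g \<in> pts (g c)) \<and> (\<forall>i<m. possible (N_app k d (\<rho> i c)) (v i)) \<and>
     possible (N_app k d (\<sigma> m c)) u \<and> r = (\<Sum>i<m. (Q G y i - Q G y (Suc i)) * v i) + Q G y m * u}"

lemma V_nonempty:
  assumes c: "c \<in> Field (E k)"
  shows "V m d c \<noteq> {}"
proof -
  have "\<exists>r. r \<in> pts (g c)" if "g \<in> G i" for i g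
    using pts_nonempty[OF scott_contD(1)[OF G_cont[OF that] c]] by blast
  then have "\<forall>g\<in>\<Union>i. G i. \<exists>r. r \<in> pts (g c)" by blast
  then obtain y where "\<forall>g\<in>\<Union>i. G i. y g \<in> pts (g c)" by metis
  then have "\<forall>i. \<forall>g\<in>G i. y g \<in> pts (g c)" by blast
  moreover have "\<forall>i. \<exists>v. possible (N_app k d (\<rho> i c)) v" using possible_ex by blast
  then obtain v where "\<forall>i. possible (N_app k d (\<rho> i c)) (v i)" by metis
  moreover obtain u where "possible (N_app k d (\<sigma> m c)) u" using possible_ex by blast
  ultimately show ?thesis unfolding V_def by blast
qed

lemma V_antimono:
  assumes d: "(d, d') \<in> N (Suc k)" and c: "(c, c') \<in> E k"
  shows "V m d' c' \<subseteq> V m d c"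
proof
  fix r assume "r \<in> V m d' c'"
  then obtain y v u where y: "\<forall>i. \<forall>g\<in>G i. y g \<in> pts (g c')" and v: "\<forall>i<m. possible (N_app k d' (\<rho> i c')) (v i)"
    and u: "possible (N_app k d' (\<sigma> m c')) u"
    and r: "r = (\<Sum>i<m. (Q G y i - Q G y (Suc i)) * v i) + Q G y m * u"
    unfolding V_def by blast
  have "\<forall>i. \<forall>g\<in>G i. y g \<in> pts (g c)" using y pts_antimono scott_contD(2)[OF G_cont c] by blast
  moreover have "\<forall>i<m. possible (N_app k d (\<rho> i c)) (v i)"
    using v possible_antimono N_app_le[OF d scott_contD(2)[OF \<rho>_cont c]] by blast
  moreover have "possible (N_app k d (\<sigma> m c)) u"
    using u possible_antimono N_app_le[OF d scott_contD(2)[OF \<sigma>_cont c]] by blast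
  ultimately show "r \<in> V m d c" unfolding V_def using r by blast
qed

text \<open>Stage \<open>m\<close> is absorbed into the tail, as the weights
  \<open>Q G y m - Q G y (Suc m)\<close> and \<open>Q G y (Suc m)\<close> add up to
  \<open>Q G y m\<close>. If \<open>\<sigma> m\<close> determines a number, both values equal it; if
  not, any real may stand for the tail; if the total weight is 0, both terms vanish.\<close>

lemma V_Suc:
  assumes d: "d \<in> Field (N (Suc k))" and c: "c \<in> Field (E k)"
  shows "V (Suc m) d c \<subseteq> V m d c"
proof
  fix r assume "r \<in> V (Suc m) d c"
  then obtain y v u where y: "\<forall>i. \<forall>g\<in>G i. y g \<in> pts (g c)" and v: "\<forall>i<Suc m. possible (N_app k d (\<rho> i c)) (v i)"
    and u: "possible (N_app k d (\<sigma> (Suc m) c)) u"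
    and r: "r = (\<Sum>i<Suc m. (Q G y i - Q G y (Suc i)) * v i) + Q G y (Suc m) * u"
    unfolding V_def by blast
  have dd: "(d, d) \<in> N (Suc k)" using po_refl[OF sd_po[OF scott_domain_N] d] .
  let ?w = "N_app k d (\<sigma> m c)"
  have "\<exists>u'. possible ?w u' \<and> (Q G y m - Q G y (Suc m)) * v m + Q G y (Suc m) * u = Q G y m * u'"
  proof (cases "Q G y m = 0")
    case True
    then have "Q G y (Suc m) = 0" using Q_nonneg[of G y "Suc m", OF finG] Q_Suc[of G y m, OF finG] by simp
    then show ?thesis using True possible_ex[of ?w] by simp
  next
    case nz: False
    show ?thesis
    proof (cases "\<exists>n. ?w = Base (Some n)")
      case True
      then obtain n where n: "?w = Base (Some n)" by blast
      have "N_app k d (\<rho> m c) = Base (Some n)" "N_app k d (\<sigma> (Suc m) c) = Base (Some n)"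
        using N_app_le[OF dd \<sigma>_\<rho>[OF c]] N_app_le[OF dd \<sigma>_Suc[OF c]] n N0_Some_le by metis+
      then have "v m = real n" "u = real n" using u v by (auto simp: possible_def)
      then show ?thesis using n by (intro exI[of _ "real n"]) (auto simp: possible_def algebra_simps)
    next
      case False
      then show ?thesis
        \<comment> \<open>The tail value is the weighted mean of the two values.\<close>
        using nz by (intro exI[of _ "((Q G y m - Q G y (Suc m)) * v m + Q G y (Suc m) * u) / Q G y m"])
          (auto simp: possible_def)
    qed
  qed
  then obtain u' where u': "possible ?w u'" "(Q G y m - Q G y (Suc m)) * v m + Q G y (Suc m) * u = Q G y m * u'"
    by blast
  then have "r = (\<Sum>i<m. (Q G y i - Q G y (Suc i)) * v i) + Q G y m * u'" using r by simp
  moreover have "\<forall>i<m. possible (N_app k d (\<rho> i c)) (v i)" using v by simp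
  ultimately show "r \<in> V m d c" unfolding V_def using y u'(1) by blast
qed

lemma V_le:
  assumes "d \<in> Field (N (Suc k))" and "c \<in> Field (E k)"
  shows "m \<le> m' \<Longrightarrow> V m' d c \<subseteq> V m d c"
  by (induction m' rule: dec_induct) (use V_Suc[OF assms] in auto)

section \<open>The extension as a generated ideal\<close>

text \<open>Only compact \<open>d\<close> and \<open>c\<close> are used, so the family at a directed
  lub is the union of the families at the members, by \<open>below_lub\<close>. Continuity in both
  variables follows from this.\<close>

definition fam :: "nat option elt \<Rightarrow> real set set elt \<Rightarrow> real set set" where
  "fam \<Phi> x = {V m d c | m d c. d \<in> below (N (Suc k)) \<Phi> \<and> c \<in> below (E k) x}"

definition ext :: "nat option elt \<Rightarrow> real set set elt \<Rightarrow> real set set elt" where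
  "ext \<Phi> x = Base (up (fam \<Phi> x))"

text \<open>Two sets of the family contain a third one: take common compact upper bounds of the
  approximations, and the larger of the two stages.\<close>

lemma ideal_fam:
  assumes \<Phi>: "\<Phi> \<in> Field (N (Suc k))" and x: "x \<in> Field (E k)"
  shows "ideal (up (fam \<Phi> x))"
proof (rule ideal_up)
  have dirN: "directed (N (Suc k)) (below (N (Suc k)) \<Phi>)" and dirE: "directed (E k) (below (E k) x)"
    unfolding below_def by (rule sd_dir[OF scott_domain_N \<Phi>], rule sd_dir[OF scott_domain_E x])
  show "fam \<Phi> x \<noteq> {}" using dirN dirE unfolding fam_def directed_def by blast
  show "W \<noteq> {}" if "W \<in> fam \<Phi> x" for W using that V_nonempty[OF below_Field] unfolding fam_def by (elim CollectE exE conjE) simp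
  fix W W' assume "W \<in> fam \<Phi> x" "W' \<in> fam \<Phi> x"
  then obtain m d c m' d' c' where W: "W = V m d c" "W' = V m' d' c'"
    and dc: "d \<in> below (N (Suc k)) \<Phi>" "d' \<in> below (N (Suc k)) \<Phi>" "c \<in> below (E k) x" "c' \<in> below (E k) x"
    unfolding fam_def by blast
  obtain d'' where d'': "d'' \<in> below (N (Suc k)) \<Phi>" "(d, d'') \<in> N (Suc k)" "(d', d'') \<in> N (Suc k)"
    using dirN dc unfolding directed_def by blast
  obtain c'' where c'': "c'' \<in> below (E k) x" "(c, c'') \<in> E k" "(c', c'') \<in> E k"
    using dirE dc unfolding directed_def by blast
  note le = V_le[OF below_Field[OF d''(1)] below_Field[OF c''(1)]]
  have "V (max m m') d'' c'' \<subseteq> W \<inter> W'"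
    using V_antimono[OF d''(2) c''(2)] V_antimono[OF d''(3) c''(3)] le[of m "max m m'"] le[of m' "max m m'"]
    unfolding W by fastforce
  then show "\<exists>W''\<in>fam \<Phi> x. W'' \<subseteq> W \<inter> W'" using d''(1) c''(1) unfolding fam_def by blast
qed

lemma ext_Field: "\<Phi> \<in> Field (N (Suc k)) \<Longrightarrow> x \<in> Field (E k) \<Longrightarrow> ext \<Phi> x \<in> Field (E 0)"
  using ideal_fam by (simp add: ext_def Field_E0)

lemma ext_mono:
  assumes le: "(\<Phi>, \<Phi>') \<in> N (Suc k)" "(x, x') \<in> E k"
  shows "(ext \<Phi> x, ext \<Phi>' x') \<in> E 0"
proof -
  have "below (N (Suc k)) \<Phi> \<subseteq> below (N (Suc k)) \<Phi>'" "below (E k) x \<subseteq> below (E k) x'"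
    using po_trans[OF sd_po[OF scott_domain_N] _ le(1)] po_trans[OF sd_po[OF scott_domain_E] _ le(2)]
    unfolding below_def by blast+
  then have "up (fam \<Phi> x) \<subseteq> up (fam \<Phi>' x')" unfolding fam_def up_def by blast
  then show ?thesis
    using ideal_fam FieldI12[OF le(1)] FieldI12[OF le(2)] unfolding ext_def E0_le by blast
qed

text \<open>Stated for sets of pairs so that it gives continuity in the argument and in the
  functional alike.\<close>

lemma ext_lub:
  assumes S: "\<And>s. s \<in> S \<Longrightarrow> fst s \<in> Field (N (Suc k)) \<and> snd s \<in> Field (E k)"
    and F: "\<Phi> \<in> Field (N (Suc k))" "x \<in> Field (E k)"
    and un: "fam \<Phi> x = (\<Union>s\<in>S. fam (fst s) (snd s))"
  shows "is_lub (E 0) ((\<lambda>s. ext (fst s) (snd s)) ` S) (ext \<Phi> x)"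
proof -
  have u: "up (fam \<Phi> x) = \<Union>((\<lambda>s. up (fam (fst s) (snd s))) ` S)" unfolding un up_def by blast
  have "is_lub (E 0) (Base ` (\<lambda>s. up (fam (fst s) (snd s))) ` S) (Base (\<Union>((\<lambda>s. up (fam (fst s) (snd s))) ` S)))"
    using S ideal_fam ideal_fam[OF F] u by (intro E0_union_lub) auto
  then show ?thesis unfolding ext_def u by (simp add: image_image)
qed

lemma scott_cont_ext:
  assumes \<Phi>: "\<Phi> \<in> Field (N (Suc k))"
  shows "scott_cont (E k) (E 0) (ext \<Phi>)"
  unfolding scott_cont_def
proof (intro conjI allI impI)
  show "ext \<Phi> \<in> Field (E k) \<rightarrow> Field (E 0)" using ext_Field[OF \<Phi>] by blast
  show "(ext \<Phi> x, ext \<Phi> y) \<in> E 0" if "(x, y) \<in> E k" for x y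
    by (rule ext_mono[OF po_refl[OF sd_po[OF scott_domain_N] \<Phi>] that])
  fix A x assume A: "directed (E k) A" "is_lub (E k) A x"
  have "fam \<Phi> x = (\<Union>s\<in>Pair \<Phi> ` A. fam (fst s) (snd s))"
    unfolding fam_def below_lub[OF sd_po[OF scott_domain_E] A] by auto
  then have "is_lub (E 0) ((\<lambda>s. ext (fst s) (snd s)) ` Pair \<Phi> ` A) (ext \<Phi> x)"
    using \<Phi> A(1) lub_field[OF A(2)] by (intro ext_lub) (auto simp: directed_def)
  then show "is_lub (E 0) (ext \<Phi> ` A) (ext \<Phi> x)" by (simp add: image_image)
qed

definition extend :: "nat option elt \<Rightarrow> real set set elt" where
  "extend \<Phi> = encode (E k) (E 0) (restrict (ext \<Phi>) (Field (E k)))"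

lemma extend_Field: "\<Phi> \<in> Field (N (Suc k)) \<Longrightarrow> extend \<Phi> \<in> Field (E (Suc k))"
  and E_app_extend: "\<Phi> \<in> Field (N (Suc k)) \<Longrightarrow> x \<in> Field (E k) \<Longrightarrow> E_app k (extend \<Phi>) x = ext \<Phi> x"
  unfolding extend_def E_Suc E_app_def
  by (rule encode_Field[OF scott_domain_E scott_domain_E scott_cont_ext]
      app_encode[OF scott_domain_E scott_domain_E scott_cont_ext]; assumption)+

lemma scott_cont_extend: "scott_cont (N (Suc k)) (E (Suc k)) extend"
  unfolding scott_cont_def
proof (intro conjI allI impI)
  show "extend \<in> Field (N (Suc k)) \<rightarrow> Field (E (Suc k))" using extend_Field by blast
  show "(extend \<Phi>, extend \<Phi>') \<in> E (Suc k)" if le: "(\<Phi>, \<Phi>') \<in> N (Suc k)" for \<Phi> \<Phi>'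
  proof -
    note F = FieldI12[OF le]
    have "(ext \<Phi> x, ext \<Phi>' x) \<in> E 0" if "x \<in> Field (E k)" for x
      by (rule ext_mono[OF le po_refl[OF sd_po[OF scott_domain_E] that]])
    then show ?thesis
      unfolding E_function_space(2)[OF extend_Field[OF F(1)] extend_Field[OF F(2)]]
      using E_app_extend[OF F(1)] E_app_extend[OF F(2)] by simp
  qed
  fix A \<Phi> assume A: "directed (N (Suc k)) A" "is_lub (N (Suc k)) A \<Phi>"
  have AF: "A \<subseteq> Field (N (Suc k))" using A(1) unfolding directed_def by blast
  note \<Phi> = lub_field[OF A(2)]
  show "is_lub (E (Suc k)) (extend ` A) (extend \<Phi>)"
    unfolding E_Suc
  proof (rule fun_dom_lubI[OF scott_domain_E scott_domain_E])
    show "extend ` A \<subseteq> Field (fun_dom (E k) (E 0))" "extend \<Phi> \<in> Field (fun_dom (E k) (E 0))"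
      using extend_Field AF \<Phi> unfolding E_Suc by blast+
    fix x assume x: "x \<in> Field (E k)"
    have "fam \<Phi> x = (\<Union>s\<in>(\<lambda>d. (d, x)) ` A. fam (fst s) (snd s))"
      unfolding fam_def below_lub[OF sd_po[OF scott_domain_N] A] by auto
    then have "is_lub (E 0) ((\<lambda>s. ext (fst s) (snd s)) ` (\<lambda>d. (d, x)) ` A) (ext \<Phi> x)"
      using \<Phi> AF x by (intro ext_lub) auto
    moreover have "(\<lambda>f. app (E k) (E 0) f x) ` extend ` A = (\<lambda>d. ext d x) ` A"
      unfolding image_image using E_app_extend[OF _ x] AF by (intro image_cong) (auto simp: E_app_def)
    ultimately show "is_lub (E 0) ((\<lambda>f. app (E k) (E 0) f x) ` extend ` A) (app (E k) (E 0) (extend \<Phi>) x)"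
      using E_app_extend[OF \<Phi> x] by (simp add: image_image E_app_def)
  qed
qed

section \<open>Values of the extension at total arguments\<close>

text \<open>Finitely many numerical values, and the tests up to stage \<open>m\<close> with
  precision \<eta>, are already secured by compact approximations; directedness combines the
  approximations found for each of them.\<close>

lemma finite_information:
  assumes \<Phi>: "\<Phi> \<in> Field (N (Suc k))" and x: "x \<in> Field (E k)"
    and y: "\<forall>g\<in>\<Union>i. G i. pts (g x) = {y g}"
    and H': "finite H" "\<forall>h\<in>H. scott_cont (E k) (N k) h" "\<forall>h\<in>H. \<exists>n. N_app k \<Phi> (h x) = Base (Some n)"
    and \<eta>: "\<eta> > 0"
  shows "\<exists>d c. d \<in> below (N (Suc k)) \<Phi> \<and> c \<in> below (E k) x \<and>
    (\<forall>h\<in>H. N_app k d (h c) = N_app k \<Phi> (h x)) \<and>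
    (\<forall>j\<le>m. \<forall>g\<in>G j. pts (g c) \<subseteq> {y g - \<eta><..<y g + \<eta>})"
proof -
  note poN = sd_po[OF scott_domain_N] and poE = sd_po[OF scott_domain_E]
  have H: "finite H" "\<And>h. h \<in> H \<Longrightarrow> scott_cont (E k) (N k) h"
    "\<And>h. h \<in> H \<Longrightarrow> \<exists>n. N_app k \<Phi> (h x) = Base (Some n)" using H' by blast+
  have dirN: "directed (N (Suc k)) (below (N (Suc k)) \<Phi>)"
    unfolding below_def by (rule sd_dir[OF scott_domain_N \<Phi>])
  have dirE: "directed (E k) (below (E k) x)" and lubE: "is_lub (E k) (below (E k) x) x"
    unfolding below_def by (rule sd_dir[OF scott_domain_E x], rule sd_lub[OF scott_domain_E x])
  have hx: "h x \<in> Field (N k)" if "h \<in> H" for h using scott_contD(1)[OF H(2)[OF that] x] .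
  \<comment> \<open>First the functional is approximated with the arguments \<open>h x\<close> held
    fixed; afterwards \<open>x\<close> is approximated with the resulting \<open>d\<close> held
    fixed.\<close>
  have "\<forall>h\<in>H. \<exists>d. d \<in> below (N (Suc k)) \<Phi> \<and> N_app k d (h x) = N_app k \<Phi> (h x)"
  proof
    fix h assume h: "h \<in> H"
    obtain n where n: "N_app k \<Phi> (h x) = Base (Some n)" using H(3)[OF h] by blast
    show "\<exists>d. d \<in> below (N (Suc k)) \<Phi> \<and> N_app k d (h x) = N_app k \<Phi> (h x)"
      using scott_cont_N0_Some[OF scott_domain_N scott_cont_N_app_left[OF hx[OF h]] \<Phi> n] n
      unfolding below_def by auto
  qed
  then obtain D where D: "\<And>h. h \<in> H \<Longrightarrow> D h \<in> below (N (Suc k)) \<Phi>"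
    "\<And>h. h \<in> H \<Longrightarrow> N_app k (D h) (h x) = N_app k \<Phi> (h x)" by metis
  have "\<exists>d\<in>below (N (Suc k)) \<Phi>. \<forall>t\<in>D ` H. (t, d) \<in> N (Suc k)"
  proof (rule directed_finite_ub[OF poN dirN])
    fix t assume "t \<in> D ` H"
    then have "t \<in> below (N (Suc k)) \<Phi>" using D(1) by blast
    then show "\<exists>a\<in>below (N (Suc k)) \<Phi>. (t, a) \<in> N (Suc k)" using po_refl[OF poN below_Field] by blast
  qed (use H in simp)
  then obtain d where d: "d \<in> below (N (Suc k)) \<Phi>" "\<And>h. h \<in> H \<Longrightarrow> (D h, d) \<in> N (Suc k)" by blast
  have dx: "N_app k d (h x) = N_app k \<Phi> (h x)" if h: "h \<in> H" for h
    using N_app_le[OF d(2)[OF h] po_refl[OF poN hx[OF h]]] D(2)[OF h] H(3)[OF h] N0_Some_le by metis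
  have "\<forall>h\<in>H. \<exists>c. c \<in> below (E k) x \<and> N_app k d (h c) = N_app k \<Phi> (h x)"
  proof
    fix h assume h: "h \<in> H"
    obtain n where n: "N_app k d (h x) = Base (Some n)" using H(3)[OF h] dx[OF h] by auto
    have "scott_cont (E k) (N 0) (\<lambda>c. N_app k d (h c))"
      by (rule scott_cont_compose[OF H(2)[OF h] scott_cont_N_app[OF below_Field[OF d(1)]]])
    from scott_cont_N0_Some[OF scott_domain_E this x n]
    show "\<exists>c. c \<in> below (E k) x \<and> N_app k d (h c) = N_app k \<Phi> (h x)"
      using n dx[OF h] unfolding below_def by auto
  qed
  then obtain C where C: "\<And>h. h \<in> H \<Longrightarrow> C h \<in> below (E k) x"
    "\<And>h. h \<in> H \<Longrightarrow> N_app k d (h (C h)) = N_app k \<Phi> (h x)" by metis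
  have "\<forall>g\<in>\<Union>j\<le>m. G j. \<exists>c\<in>below (E k) x. pts (g c) \<subseteq> {y g - \<eta><..<y g + \<eta>}"
  proof
    fix g assume "g \<in> (\<Union>j\<le>m. G j)"
    then obtain j where g: "g \<in> G j" by blast
    show "\<exists>c\<in>below (E k) x. pts (g c) \<subseteq> {y g - \<eta><..<y g + \<eta>}"
      using pts_nbhd[OF G_cont[OF g] dirE lubE _ \<eta>, of "y g"] y g by blast
  qed
  then obtain C' where C': "\<And>g. g \<in> (\<Union>j\<le>m. G j) \<Longrightarrow> C' g \<in> below (E k) x"
    "\<And>g. g \<in> (\<Union>j\<le>m. G j) \<Longrightarrow> pts (g (C' g)) \<subseteq> {y g - \<eta><..<y g + \<eta>}" by metis
  have "\<exists>c\<in>below (E k) x. \<forall>t\<in>C ` H \<union> C' ` (\<Union>j\<le>m. G j). (t, c) \<in> E k"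
  proof (rule directed_finite_ub[OF poE dirE])
    fix t assume "t \<in> C ` H \<union> C' ` (\<Union>j\<le>m. G j)"
    then have "t \<in> below (E k) x" using C(1) C'(1) by blast
    then show "\<exists>a\<in>below (E k) x. (t, a) \<in> E k" using po_refl[OF poE below_Field] by blast
  qed (use H finG in simp)
  then obtain c where c: "c \<in> below (E k) x"
    and ub: "\<forall>t\<in>C ` H \<union> C' ` (\<Union>j\<le>m. G j). (t, c) \<in> E k" by blast
  have "N_app k d (h c) = N_app k \<Phi> (h x)" if h: "h \<in> H" for h
    using N_app_le[OF po_refl[OF poN below_Field[OF d(1)]] scott_contD(2)[OF H(2)[OF h] ub[rule_format, OF UnI1[OF imageI[OF h]]]]]
      C(2)[OF h] H(3)[OF h] N0_Some_le by metis
  moreover have "pts (g c) \<subseteq> {y g - \<eta><..<y g + \<eta>}" if g: "j \<le> m" "g \<in> G j" for j g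
  proof -
    have g': "g \<in> (\<Union>j\<le>m. G j)" using g by blast
    show ?thesis
      using pts_antimono[OF scott_contD(2)[OF G_cont[OF g(2)] ub[rule_format, OF UnI2[OF imageI[OF g']]]]] C'(2)[OF g'] by blast
  qed
  ultimately show ?thesis using d(1) c by blast
qed

text \<open>The finite form of the defining sum. Either the tail value is settled to be
  \<open>l\<close>, or a test beyond distance \<open>1 / 4\<close> makes the tail weight 0, so that
  the formula does not depend on \<open>l\<close>. The inequality is strict so that the weight stays
  0 under small perturbations of the tests.\<close>

lemma ext_point:
  assumes \<Phi>: "\<Phi> \<in> Field (N (Suc k))" and x: "x \<in> Field (E k)"
    and y: "\<forall>g\<in>\<Union>i. G i. pts (g x) = {y g}"
    and n: "\<And>i. i < m \<Longrightarrow> N_app k \<Phi> (\<rho> i x) = Base (Some (n i))"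
    and l: "N_app k \<Phi> (\<sigma> m x) = Base (Some l) \<or> (\<exists>g\<in>G m. 1 / 4 < dist_nat (y g))"
  shows "pts (ext \<Phi> x) = {(\<Sum>i<m. (Q G y i - Q G y (Suc i)) * real (n i)) + Q G y m * real l}" (is "_ = {?r}")
proof -
  have "\<exists>W\<in>fam \<Phi> x. W \<subseteq> {?r - e..?r + e}" if e: "e > 0" for e
  proof -
    \<comment> \<open>\<open>B\<close> is the Lipschitz constant of the sum in the test values: each
      \<open>Q\<close> moves by at most \<open>8 * \<eta>\<close>, a difference of two by at most
      \<open>16 * \<eta>\<close>.\<close>
    define B where "B = (\<Sum>i<m. 16 * real (n i)) + 8 * real l"
    have B: "0 \<le> B" unfolding B_def by (intro add_nonneg_nonneg sum_nonneg) auto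
    define H where "H = \<rho> ` {..<m} \<union> (if N_app k \<Phi> (\<sigma> m x) = Base (Some l) then {\<sigma> m} else {})"
    \<comment> \<open>\<theta> is the margin by which a far test exceeds \<open>1 / 4\<close>;
      perturbing it by at most \<theta> cannot bring it within \<open>1 / 4\<close>. If the tail is
      settled, any positive value will do.\<close>
    have "\<exists>\<theta>>0. N_app k \<Phi> (\<sigma> m x) = Base (Some l) \<or> (\<exists>g\<in>G m. 1 / 4 + \<theta> \<le> dist_nat (y g))"
    proof (cases "N_app k \<Phi> (\<sigma> m x) = Base (Some l)")
      case True
      then show ?thesis using zero_less_one by blast
    next
      case False
      then obtain g where "g \<in> G m" "1 / 4 < dist_nat (y g)" using l by blast
      then show ?thesis by (intro exI[of _ "dist_nat (y g) - 1 / 4"]) auto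
    qed
    then obtain \<theta> where \<theta>: "\<theta> > 0"
      "N_app k \<Phi> (\<sigma> m x) = Base (Some l) \<or> (\<exists>g\<in>G m. 1 / 4 + \<theta> \<le> dist_nat (y g))" by blast
    define \<eta> where "\<eta> = min \<theta> (e / (B + 1))"
    have \<eta>: "\<eta> > 0" "\<eta> \<le> \<theta>" "B * \<eta> \<le> e"
    proof -
      show "\<eta> > 0" "\<eta> \<le> \<theta>" unfolding \<eta>_def using \<theta>(1) e B by auto
      have "B * \<eta> \<le> B * (e / (B + 1))" unfolding \<eta>_def using B by (intro mult_left_mono) auto
      also have "\<dots> \<le> e" using B e by (simp add: field_simps)
      finally show "B * \<eta> \<le> e" .
    qed
    have Hfin: "finite H" unfolding H_def by auto
    have Hc: "\<forall>h\<in>H. scott_cont (E k) (N k) h"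
      using \<rho>_cont \<sigma>_cont unfolding H_def by (auto split: if_splits)
    have Hn: "\<forall>h\<in>H. \<exists>n. N_app k \<Phi> (h x) = Base (Some n)"
      using n unfolding H_def by (auto split: if_splits)
    obtain d c where d: "d \<in> below (N (Suc k)) \<Phi>" and c: "c \<in> below (E k) x"
      and dc: "\<And>h. h \<in> H \<Longrightarrow> N_app k d (h c) = N_app k \<Phi> (h x)"
      and near: "\<And>j g. j \<le> m \<Longrightarrow> g \<in> G j \<Longrightarrow> pts (g c) \<subseteq> {y g - \<eta><..<y g + \<eta>}"
      using finite_information[OF \<Phi> x y Hfin Hc Hn \<eta>(1), of m] by blast
    have "r \<in> {?r - e..?r + e}" if r: "r \<in> V m d c" for r
    proof -
      obtain y' v u where y': "\<forall>i. \<forall>g\<in>G i. y' g \<in> pts (g c)" and v: "\<forall>i<m. possible (N_app k d (\<rho> i c)) (v i)"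
        and u: "possible (N_app k d (\<sigma> m c)) u"
        and r: "r = (\<Sum>i<m. (Q G y' i - Q G y' (Suc i)) * v i) + Q G y' m * u"
        using r unfolding V_def by blast
      have vn: "v i = real (n i)" if "i < m" for i
        using v dc[of "\<rho> i"] n[OF that] that unfolding H_def possible_def by auto
      have yy: "\<bar>y' g - y g\<bar> \<le> \<eta>" if "j \<le> m" "g \<in> G j" for j g
        using near[OF that] y' that by fastforce
      have Q: "\<bar>Q G y' i - Q G y i\<bar> \<le> 8 * \<eta>" if "i \<le> m" for i
      proof (rule Q_lipschitz[OF finG])
        show "\<bar>y' g - y g\<bar> \<le> \<eta>" if "j \<le> i" "g \<in> G j" for j g
          using yy[OF order_trans[OF that(1) \<open>i \<le> m\<close>] that(2)] .
      qed (use \<eta>(1) in simp)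
      have last: "\<bar>Q G y' m * u - Q G y m * real l\<bar> \<le> 8 * real l * \<eta>"
      proof (cases "N_app k \<Phi> (\<sigma> m x) = Base (Some l)")
        case True
        then have "u = real l" using u dc[of "\<sigma> m"] unfolding H_def possible_def by auto
        then have "\<bar>Q G y' m * u - Q G y m * real l\<bar> = \<bar>Q G y' m - Q G y m\<bar> * real l"
          by (simp add: left_diff_distrib[symmetric] abs_mult)
        also have "\<dots> \<le> 8 * \<eta> * real l" using Q[of m] by (intro mult_right_mono) auto
        finally show ?thesis by (simp add: mult_ac)
      next
        case False
        then obtain g where g: "g \<in> G m" "1 / 4 + \<theta> \<le> dist_nat (y g)" using \<theta>(2) by blast
        have "1 / 4 \<le> dist_nat (y' g)" using dist_nat_lipschitz[of "y' g" "y g"] yy[of m g] g \<eta>(2) by linarith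
        then have "Q G y' m = 0" using Q_zero[where G = G, OF finG g(1)] by blast
        moreover have "Q G y m = 0" using Q_zero[where G = G, OF finG g(1)] g(2) \<theta>(1) by auto
        ultimately show ?thesis using \<eta>(1) by simp
      qed
      have "r - ?r = (\<Sum>i<m. (Q G y' i - Q G y' (Suc i)) * real (n i) - (Q G y i - Q G y (Suc i)) * real (n i))
          + (Q G y' m * u - Q G y m * real l)"
        unfolding r sum_subtractf using vn by simp
      also have "\<bar>\<dots>\<bar> \<le> (\<Sum>i<m. 16 * real (n i) * \<eta>) + 8 * real l * \<eta>"
      proof (rule order_trans[OF abs_triangle_ineq add_mono[OF order_trans[OF sum_abs sum_mono] last]])
        fix i assume "i \<in> {..<m}"
        then have i: "\<bar>(Q G y' i - Q G y i) - (Q G y' (Suc i) - Q G y (Suc i))\<bar> \<le> 16 * \<eta>"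
          using Q[of i] Q[of "Suc i"] by simp
        have "\<bar>(Q G y' i - Q G y' (Suc i)) * real (n i) - (Q G y i - Q G y (Suc i)) * real (n i)\<bar>
            = \<bar>(Q G y' i - Q G y i) - (Q G y' (Suc i) - Q G y (Suc i))\<bar> * real (n i)"
        proof -
          have "(Q G y' i - Q G y' (Suc i)) * real (n i) - (Q G y i - Q G y (Suc i)) * real (n i)
            = ((Q G y' i - Q G y i) - (Q G y' (Suc i) - Q G y (Suc i))) * real (n i)"
            by (simp add: algebra_simps)
          then show ?thesis by (simp only: abs_mult abs_of_nat)
        qed
        also have "\<dots> \<le> 16 * \<eta> * real (n i)" using i by (intro mult_right_mono) auto
        finally show "\<bar>(Q G y' i - Q G y' (Suc i)) * real (n i) - (Q G y i - Q G y (Suc i)) * real (n i)\<bar>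
            \<le> 16 * real (n i) * \<eta>" by (simp add: mult_ac)
      qed
      also have "\<dots> = B * \<eta>" unfolding B_def by (simp add: distrib_right sum_distrib_right)
      also have "\<dots> \<le> e" by (rule \<eta>(3))
      finally show ?thesis by (auto simp: abs_le_iff)
    qed
    then show ?thesis using d c unfolding fam_def by blast
  qed
  then show ?thesis unfolding ext_def pts_Base using Inter_up_point[OF ideal_fam[OF \<Phi> x]] by blast
qed

lemma \<sigma>_le: "x \<in> Field (E k) \<Longrightarrow> m \<le> m' \<Longrightarrow> (\<sigma> m x, \<sigma> m' x) \<in> N k"
  by (rule chain_directed(1)[where s = "\<lambda>m. \<sigma> m x", OF sd_po[OF scott_domain_N] \<sigma>_Suc])

text \<open>A number attained at the limit of the chain is attained at some stage by flatness, and
  persists at all later stages by monotonicity.\<close>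

lemma \<sigma>_lub_stage:
  assumes \<Phi>: "\<Phi> \<in> Field (N (Suc k))" and x: "x \<in> Field (E k)"
    and b: "is_lub (N k) (range (\<lambda>m. \<sigma> m x)) b" "N_app k \<Phi> b = Base (Some n)"
  shows "\<exists>m\<^sub>0. \<forall>m\<ge>m\<^sub>0. N_app k \<Phi> (\<sigma> m x) = Base (Some n)"
proof -
  have dir: "directed (N k) (range (\<lambda>m. \<sigma> m x))"
    by (rule chain_directed(2)[where s = "\<lambda>m. \<sigma> m x", OF sd_po[OF scott_domain_N] \<sigma>_Suc[OF x]])
  note c = scott_cont_N_app[OF \<Phi>]
  have "Base (Some n) \<in> N_app k \<Phi> ` range (\<lambda>m. \<sigma> m x)"
    using N0_directed_lub_mem[OF directed_image[OF c dir] scott_contD(3)[OF c dir b(1)]] b(2) by simp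
  then obtain m\<^sub>0 where m\<^sub>0: "N_app k \<Phi> (\<sigma> m\<^sub>0 x) = Base (Some n)" by (elim imageE) simp
  have "N_app k \<Phi> (\<sigma> m x) = Base (Some n)" if "m\<^sub>0 \<le> m" for m
    using scott_contD(2)[OF c \<sigma>_le[OF x that]] m\<^sub>0 N0_Some_le by metis
  then show ?thesis by blast
qed

text \<open>Related inputs have the same test values and the same numbers at the relevant stages, so
  \<open>ext_point\<close> gives both sides the same real. Its stage \<open>m\<close> is the first
  one with a far test or, if there is none, one at which the tail is settled.\<close>

lemma ext_total:
  assumes \<Phi>: "N_per (Suc k) \<Phi> \<Phi>'" and x: "E_per k x x'"
  shows "E_per 0 (ext \<Phi> x) (ext \<Phi>' x')"
proof -
  note \<Phi>F = N_per_Field[OF \<Phi>] and xF = E_per_Field[OF x]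
  have "\<exists>r. pts (g x) = {r} \<and> pts (g x') = {r}" if "g \<in> G i" for i g
    using G_total[OF that x] unfolding E_per_0 by blast
  then have "\<forall>g\<in>\<Union>i. G i. \<exists>r. pts (g x) = {r} \<and> pts (g x') = {r}" by blast
  then obtain y where "\<forall>g\<in>\<Union>i. G i. pts (g x) = {y g} \<and> pts (g x') = {y g}" by metis
  then have y: "\<forall>g\<in>\<Union>i. G i. pts (g x) = {y g}" "\<forall>g\<in>\<Union>i. G i. pts (g x') = {y g}" by blast+
  have \<rho>: "\<exists>n. N_app k \<Phi> (\<rho> i x) = Base (Some n) \<and> N_app k \<Phi>' (\<rho> i x') = Base (Some n)"
    if "\<And>g. g \<in> G i \<Longrightarrow> dist_nat (y g) \<le> 1 / 4" for i
    using N_per_app[OF \<Phi> \<rho>_total[OF x]] y(1) that unfolding N_per_0 by auto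
  have "\<exists>m l. (\<forall>i<m. \<forall>g\<in>G i. dist_nat (y g) \<le> 1 / 4) \<and>
    (N_app k \<Phi> (\<sigma> m x) = Base (Some l) \<and> N_app k \<Phi>' (\<sigma> m x') = Base (Some l) \<or>
     (\<exists>g\<in>G m. 1 / 4 < dist_nat (y g)))"
  proof (cases "\<exists>m. \<exists>g\<in>G m. 1 / 4 < dist_nat (y g)")
    case True
    \<comment> \<open>At the first far stage all earlier roundings are still total, while the tail
      has weight 0.\<close>
    then have "\<exists>g\<in>G (LEAST m. \<exists>g\<in>G m. 1 / 4 < dist_nat (y g)). 1 / 4 < dist_nat (y g)" by (rule LeastI_ex)
    moreover have "\<forall>i<LEAST m. \<exists>g\<in>G m. 1 / 4 < dist_nat (y g). \<forall>g\<in>G i. dist_nat (y g) \<le> 1 / 4"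
      using not_less_Least linorder_not_le by blast
    ultimately show ?thesis by blast
  next
    case False
    then have near: "dist_nat (y g) \<le> 1 / 4" if "g \<in> G i" for i g using that linorder_not_le by blast
    then obtain b b' where b: "is_lub (N k) (range (\<lambda>m. \<sigma> m x)) b"
      and b': "is_lub (N k) (range (\<lambda>m. \<sigma> m x')) b'" and bb': "N_per k b b'"
      using \<sigma>_total[OF x] y(1) by auto
    obtain l where l: "N_app k \<Phi> b = Base (Some l)" "N_app k \<Phi>' b' = Base (Some l)"
      using N_per_app[OF \<Phi> bb'] unfolding N_per_0 by blast
    obtain m m' where "\<forall>i\<ge>m. N_app k \<Phi> (\<sigma> i x) = Base (Some l)" "\<forall>i\<ge>m'. N_app k \<Phi>' (\<sigma> i x') = Base (Some l)"
      using \<sigma>_lub_stage[OF \<Phi>F(1) xF(1) b l(1)] \<sigma>_lub_stage[OF \<Phi>F(2) xF(2) b' l(2)] by blast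
    \<comment> \<open>One stage has to serve both sides, so that the two sums coincide term by
      term.\<close>
    then show ?thesis using near by (intro exI[of _ "max m m'"] exI[of _ l]) auto
  qed
  then obtain m l where near: "\<And>i g. i < m \<Longrightarrow> g \<in> G i \<Longrightarrow> dist_nat (y g) \<le> 1 / 4"
    and l: "N_app k \<Phi> (\<sigma> m x) = Base (Some l) \<and> N_app k \<Phi>' (\<sigma> m x') = Base (Some l) \<or>
     (\<exists>g\<in>G m. 1 / 4 < dist_nat (y g))" by blast
  have "\<forall>i. \<exists>n. i < m \<longrightarrow> N_app k \<Phi> (\<rho> i x) = Base (Some n) \<and> N_app k \<Phi>' (\<rho> i x') = Base (Some n)"
    using \<rho> near by blast
  then obtain n where n: "\<And>i. i < m \<Longrightarrow> N_app k \<Phi> (\<rho> i x) = Base (Some (n i))"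
    "\<And>i. i < m \<Longrightarrow> N_app k \<Phi>' (\<rho> i x') = Base (Some (n i))" by metis
  let ?r = "(\<Sum>i<m. (Q G y i - Q G y (Suc i)) * real (n i)) + Q G y m * real l"
  have "pts (ext \<Phi> x) = {?r}" by (rule ext_point[OF \<Phi>F(1) xF(1) y(1) n(1)]) (use l in blast)+
  moreover have "pts (ext \<Phi>' x') = {?r}" by (rule ext_point[OF \<Phi>F(2) xF(2) y(2) n(2)]) (use l in blast)+
  ultimately show ?thesis unfolding E_per_0 using ext_Field \<Phi>F xF by auto
qed

lemma extend_total: "N_per (Suc k) \<Phi> \<Phi>' \<Longrightarrow> E_per (Suc k) (extend \<Phi>) (extend \<Phi>')"
  using ext_total N_per_Field[of "Suc k" \<Phi> \<Phi>'] extend_Field E_app_extend unfolding E_per_Suc by simp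

text \<open>If all tests are natural numbers, nearby all weights \<open>Q\<close> equal 1, the
  differences vanish and only the settled tail remains. This gives the ideal
  \<open>nat_rep n\<close> itself and not merely an ideal with the same intersection.\<close>

lemma extend_exact:
  assumes \<Phi>: "\<Phi> \<in> Field (N (Suc k))" and x: "x \<in> Field (E k)"
    and y: "\<And>i g. g \<in> G i \<Longrightarrow> \<exists>j. pts (g x) = {real j}"
    and b: "is_lub (N k) (range (\<lambda>m. \<sigma> m x)) b" "N_app k \<Phi> b = Base (Some n)"
  shows "E_app k (extend \<Phi>) x = Base (nat_rep n)"
proof -
  have "\<forall>g\<in>\<Union>i. G i. \<exists>j. pts (g x) = {real j}" using y by blast
  then obtain j where j: "\<forall>g\<in>\<Union>i. G i. pts (g x) = {real (j g)}" by metis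
  obtain m where m: "N_app k \<Phi> (\<sigma> m x) = Base (Some n)" using \<sigma>_lub_stage[OF \<Phi> x b] by blast
  \<comment> \<open>The precision \<open>1 / 8\<close> keeps all tests on the plateau where the
    weight is 1.\<close>
  obtain d c where d: "d \<in> below (N (Suc k)) \<Phi>" and c: "c \<in> below (E k) x"
    and dc: "N_app k d (\<sigma> m c) = Base (Some n)"
    and near: "\<And>i g. i \<le> m \<Longrightarrow> g \<in> G i \<Longrightarrow> pts (g c) \<subseteq> {real (j g) - 1 / 8<..<real (j g) + 1 / 8}"
    using finite_information[OF \<Phi> x j, of "{\<sigma> m}" "1 / 8" m] \<sigma>_cont m by auto
  have "V m d c \<subseteq> {real n}"
  proof
    fix r assume "r \<in> V m d c"
    then obtain y' v u where y': "\<forall>i. \<forall>g\<in>G i. y' g \<in> pts (g c)" and u: "possible (N_app k d (\<sigma> m c)) u"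
      and r: "r = (\<Sum>i<m. (Q G y' i - Q G y' (Suc i)) * v i) + Q G y' m * u"
      unfolding V_def by blast
    have yj: "dist_nat (y' g) \<le> 1 / 8" if "i \<le> m" "g \<in> G i" for i g
    proof -
      have "y' g \<in> {real (j g) - 1 / 8<..<real (j g) + 1 / 8}" using near[OF that] y' that by blast
      then have "dist (y' g) (real (j g)) \<le> 1 / 8" unfolding dist_real_def abs_le_iff greaterThanLessThan_iff by linarith
      then show ?thesis by (intro infdist_le2[of "real (j g)"]) auto
    qed
    have "Q G y' i = 1" if "i \<le> m" for i 
    proof (rule Q_one[OF finG])
      show "dist_nat (y' g) \<le> 1 / 8" if "j \<le> i" "g \<in> G j" for j g
        using yj[OF order_trans[OF that(1) \<open>i \<le> m\<close>] that(2)] .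
    qed
    then have "r = u" unfolding r by simp
    then show "r \<in> {real n}" using u dc by (simp add: possible_def)
  qed
  then have V: "V m d c = {real n}" using V_nonempty[OF below_Field[OF c]] by blast
  then have nf: "{real n} \<in> fam \<Phi> x" using d c unfolding fam_def by blast
  have "\<Inter>(up (fam \<Phi> x)) = {real n}"
  proof (rule Inter_up_point[OF ideal_fam[OF \<Phi> x]])
    show "\<exists>W\<in>fam \<Phi> x. W \<subseteq> {real n - e..real n + e}" if "e > 0" for e
      using that by (intro bexI[OF _ nf]) simp
  qed
  \<comment> \<open>Since the singleton of \<open>real n\<close> belongs to the family, the ideal
    contains every interval around \<open>n\<close>, including those with \<open>n\<close> as an
    endpoint.\<close>
  then have "up (fam \<Phi> x) = up {{real n}}"
  proof (intro equalityI subsetI)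
    fix I assume "I \<in> up (fam \<Phi> x)"
    moreover from this have "real n \<in> I" using \<open>\<Inter>(up (fam \<Phi> x)) = {real n}\<close> by blast
    ultimately show "I \<in> up {{real n}}" by (simp add: up_def)
  next
    fix I assume "I \<in> up {{real n}}"
    then show "I \<in> up (fam \<Phi> x)" using nf by (auto simp: up_def)
  qed
  then show ?thesis unfolding E_app_extend[OF \<Phi> x] ext_def nat_rep_up by simp
qed

end

section \<open>The embedding\<close>

text \<open>Pulls an element of \<open>E (Suc k)\<close> back along \<open>j\<close> and rounds its
  values. With \<open>j\<close> preceded by a cap or a chop this gives \<open>\<rho>\<close> or
  \<open>\<sigma>\<close>.\<close>

definition lift :: "nat \<Rightarrow> (nat option elt \<Rightarrow> real set set elt) \<Rightarrow> real set set elt \<Rightarrow> nat option elt" where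
  "lift k j = dmap (N k) (E k) (E 0) (N 0) j nint"

lemma scott_cont_lift: "scott_cont (N k) (E k) j \<Longrightarrow> scott_cont (E (Suc k)) (N (Suc k)) (lift k j)"
  unfolding lift_def N_Suc E_Suc
  by (rule scott_cont_dmap[OF scott_domain_N scott_domain_E scott_domain_E scott_domain_N _ scott_cont_nint])

lemma N_app_lift:
  "scott_cont (N k) (E k) j \<Longrightarrow> x \<in> Field (E (Suc k)) \<Longrightarrow> a \<in> Field (N k) \<Longrightarrow>
    N_app k (lift k j x) a = nint (E_app k x (j a))"
  unfolding lift_def N_app_def E_app_def E_Suc
  by (rule app_dmap[OF scott_domain_N scott_domain_E scott_domain_E scott_domain_N _ scott_cont_nint])

lemma lift_mono:
  assumes j: "scott_cont (N k) (E k) j" "scott_cont (N k) (E k) j'"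
    and le: "\<And>a. a \<in> Field (N k) \<Longrightarrow> (j a, j' a) \<in> E k" and x: "x \<in> Field (E (Suc k))"
  shows "(lift k j x, lift k j' x) \<in> N (Suc k)"
proof -
  have F: "lift k j x \<in> Field (N (Suc k))" "lift k j' x \<in> Field (N (Suc k))"
    using scott_contD(1)[OF scott_cont_lift x] j by blast+
  have "(nint (E_app k x (j a)), nint (E_app k x (j' a))) \<in> N 0" if "a \<in> Field (N k)" for a
    using scott_contD(2)[OF scott_cont_nint scott_contD(2)[OF scott_cont_E_app[OF x] le[OF that]]] .
  then show ?thesis
    unfolding N_function_space(2)[OF F] using N_app_lift[OF j(1) x] N_app_lift[OF j(2) x] by simp
qed

text \<open>Evaluations at truncated total arguments: totality of the arguments makes the results
  single reals, and arguments with the same truncation share a test, so finitely many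
  remain.\<close>

definition tests :: "nat \<Rightarrow> (nat option elt \<Rightarrow> real set set elt) \<Rightarrow> nat \<Rightarrow>
    (real set set elt \<Rightarrow> real set set elt) set" where
  "tests k p i = (\<lambda>a x. E_app k x (p a)) ` trunc (cap i) k ` N_tot k"

lemma lift_chop_lub:
  assumes p: "scott_cont (N k) (E k) p" and x: "x \<in> Field (E (Suc k))"
  shows "is_lub (N (Suc k)) (range (\<lambda>m. lift k (\<lambda>a. p (trunc (chop m) k a)) x)) (lift k p x)"
  unfolding N_Suc
proof (rule fun_dom_lubI[OF scott_domain_N scott_domain_N])
  let ?s = "\<lambda>m. lift k (\<lambda>a. p (trunc (chop m) k a)) x"
  have j: "scott_cont (N k) (E k) (\<lambda>a. p (trunc (chop m) k a))" for m
    by (rule scott_cont_compose[OF scott_cont_trunc[OF scott_cont_chop] p])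
  show "range ?s \<subseteq> Field (fun_dom (N k) (N 0))" "lift k p x \<in> Field (fun_dom (N k) (N 0))"
    using scott_contD(1)[OF scott_cont_lift[OF j] x] scott_contD(1)[OF scott_cont_lift[OF p] x]
    unfolding N_Suc by blast+
  fix a assume a: "a \<in> Field (N k)"
  have c: "scott_cont (N k) (N 0) (\<lambda>a. nint (E_app k x (p a)))"
    by (rule scott_cont_compose[OF scott_cont_compose[OF p scott_cont_E_app[OF x]] scott_cont_nint])
  have dir: "directed (N k) (range (\<lambda>m. trunc (chop m) k a))"
    by (rule chain_directed(2)[where s = "\<lambda>m. trunc (chop m) k a", OF sd_po[OF scott_domain_N] trunc_chop_Suc[OF a]])
  have "(\<lambda>f. app (N k) (N 0) f a) ` range ?s = (\<lambda>a. nint (E_app k x (p a))) ` range (\<lambda>m. trunc (chop m) k a)"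
    unfolding image_image using N_app_lift[OF j x a] by (simp add: N_app_def)
  then show "is_lub (N 0) ((\<lambda>f. app (N k) (N 0) f a) ` range ?s) (app (N k) (N 0) (lift k p x) a)"
    using scott_contD(3)[OF c dir trunc_chop_lub[OF a]] N_app_lift[OF p x a] by (simp add: N_app_def)
qed

text \<open>The substantial condition is the totality of the limit of \<open>\<sigma>\<close>:
  nearness is assumed only at truncated arguments and has to be transferred to all total ones by
  continuity.\<close>

lemma extension_Suc:
  assumes p: "scott_cont (N k) (E k) p" and tot: "\<And>a b. N_per k a b \<Longrightarrow> E_per k (p a) (p b)"
  shows "extension (Suc k) (tests k p) (\<lambda>i. lift k (\<lambda>a. p (trunc (cap i) k a))) (\<lambda>m. lift k (\<lambda>a. p (trunc (chop m) k a)))"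
proof
  have cap: "scott_cont (N k) (E k) (\<lambda>a. p (trunc (cap i) k a))" for i
    by (rule scott_cont_compose[OF scott_cont_trunc[OF scott_cont_cap] p])
  have chop: "scott_cont (N k) (E k) (\<lambda>a. p (trunc (chop m) k a))" for m
    by (rule scott_cont_compose[OF scott_cont_trunc[OF scott_cont_chop] p])
  have capF: "trunc (cap i) k a \<in> Field (N k)" if "a \<in> Field (N k)" for i a
    using scott_contD(1)[OF scott_cont_trunc[OF scott_cont_cap] that] .
  have test: "(\<lambda>x. E_app k x (p (trunc (cap i) k a))) \<in> tests k p i" if "a \<in> N_tot k" for i a
    unfolding tests_def using that by blast
  show "finite (tests k p i)" for i
    unfolding tests_def
    by (intro finite_imageI finite_subset[OF _ finite_trunc_cap[of i k]] image_mono) (auto simp: N_tot_def)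
  show "scott_cont (E (Suc k)) (E 0) g" if g: "g \<in> tests k p i" for i g
  proof -
    obtain a where a: "a \<in> N_tot k" "g = (\<lambda>x. E_app k x (p (trunc (cap i) k a)))"
      using g unfolding tests_def by blast
    then have "p (trunc (cap i) k a) \<in> Field (E k)"
      using capF scott_contD(1)[OF p] unfolding N_tot_def by blast
    then show ?thesis unfolding a(2) by (rule scott_cont_E_app_left)
  qed
  show "E_per 0 (g x) (g x')" if g: "g \<in> tests k p i" and x: "E_per (Suc k) x x'" for i g x x'
  proof -
    obtain a where a: "a \<in> N_tot k" "g = (\<lambda>x. E_app k x (p (trunc (cap i) k a)))"
      using g unfolding tests_def by blast
    then have "N_per k a a" unfolding N_tot_iff by blast
    then show ?thesis unfolding a(2) using E_per_app[OF x tot[OF trunc_cap_total]] by blast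
  qed
  show "scott_cont (E (Suc k)) (N (Suc k)) (lift k (\<lambda>a. p (trunc (cap i) k a)))" for i
    by (rule scott_cont_lift[OF cap])
  show "scott_cont (E (Suc k)) (N (Suc k)) (lift k (\<lambda>a. p (trunc (chop m) k a)))" for m
    by (rule scott_cont_lift[OF chop])
  show "(lift k (\<lambda>a. p (trunc (chop m) k a)) x, lift k (\<lambda>a. p (trunc (cap m) k a)) x) \<in> N (Suc k)"
    if "x \<in> Field (E (Suc k))" for m x
    by (rule lift_mono[OF chop cap scott_contD(2)[OF p trunc_chop_le_cap[OF order_refl]] that])
  show "(lift k (\<lambda>a. p (trunc (chop m) k a)) x, lift k (\<lambda>a. p (trunc (chop (Suc m)) k a)) x) \<in> N (Suc k)"
    if "x \<in> Field (E (Suc k))" for m x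
    by (rule lift_mono[OF chop chop scott_contD(2)[OF p trunc_chop_Suc] that])
  show "N_per (Suc k) (lift k (\<lambda>a. p (trunc (cap i) k a)) x) (lift k (\<lambda>a. p (trunc (cap i) k a)) x')"
    if x: "E_per (Suc k) x x'" and near: "\<And>g. g \<in> tests k p i \<Longrightarrow> pts (g x) \<subseteq> {r. dist_nat r \<le> 1 / 4}" for i x x'
  proof -
    note F = E_per_Field[OF x]
    have "N_per 0 (nint (E_app k x (p (trunc (cap i) k a)))) (nint (E_app k x' (p (trunc (cap i) k b))))"
      if ab: "N_per k a b" for a b
      by (rule nint_total[OF E_per_app[OF x tot[OF trunc_cap_total[OF ab]]] near[OF test[OF N_per_tot[OF ab]]]])
    then show ?thesis
      unfolding N_per_Suc using scott_contD(1)[OF scott_cont_lift[OF cap]] F N_app_lift[OF cap F(1)] N_app_lift[OF cap F(2)]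
      by simp
  qed
  show "\<exists>b b'. is_lub (N (Suc k)) (range (\<lambda>m. lift k (\<lambda>a. p (trunc (chop m) k a)) x)) b \<and>
      is_lub (N (Suc k)) (range (\<lambda>m. lift k (\<lambda>a. p (trunc (chop m) k a)) x')) b' \<and> N_per (Suc k) b b'"
    if x: "E_per (Suc k) x x'" and near: "\<And>i g. g \<in> tests k p i \<Longrightarrow> pts (g x) \<subseteq> {r. dist_nat r \<le> 1 / 4}" for x x'
  proof -
    note F = E_per_Field[OF x]
    have "N_per 0 (nint (E_app k x (p a))) (nint (E_app k x' (p b)))" if ab: "N_per k a b" for a b
    proof (rule nint_total[OF E_per_app[OF x tot[OF ab]]])
      note aF = N_per_Field(1)[OF ab]
      obtain r where r: "pts (E_app k x (p a)) = {r}" using E_per_app[OF x tot[OF ab]] unfolding E_per_0 by blast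
      have "dist_nat r \<le> 1 / 4"
      proof (rule ccontr)
        assume far: "\<not> dist_nat r \<le> 1 / 4"
        \<comment> \<open>No real within less than \<open>e\<close> of \<open>r\<close> lies within
          \<open>1 / 4\<close> of a natural number.\<close>
        define e where "e = dist_nat r - 1 / 4"
        have c: "scott_cont (N k) (E 0) (\<lambda>a. E_app k x (p a))"
          by (rule scott_cont_compose[OF p scott_cont_E_app[OF F(1)]])
        have dir: "directed (N k) (range (\<lambda>m. trunc (chop m) k a))"
          by (rule chain_directed(2)[where s = "\<lambda>m. trunc (chop m) k a", OF sd_po[OF scott_domain_N] trunc_chop_Suc[OF aF]])
        obtain m where m: "pts (E_app k x (p (trunc (chop m) k a))) \<subseteq> {r - e<..<r + e}"
          using pts_nbhd[OF c dir trunc_chop_lub[OF aF] r, of e] far unfolding e_def by auto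
        let ?u = "E_app k x (p (trunc (cap m) k a))"
        \<comment> \<open>The chopped argument approximates \<open>a\<close>, while the capped one
          is tested. The latter is above the former, so its test value lies in the same
          neighbourhood, contradicting nearness.\<close>
        have "(E_app k x (p (trunc (chop m) k a)), ?u) \<in> E 0"
          by (rule scott_contD(2)[OF c trunc_chop_le_cap[OF order_refl aF]])
        then have "pts ?u \<subseteq> {r - e<..<r + e}" using pts_antimono m by blast
        moreover have "pts ?u \<subseteq> {r. dist_nat r \<le> 1 / 4}" using near[OF test[OF N_per_tot[OF ab]]] .
        moreover have "pts ?u \<noteq> {}" using pts_nonempty[OF scott_contD(1)[OF c capF[OF aF]]] .
        ultimately obtain s where "s \<in> {r - e<..<r + e}" "dist_nat s \<le> 1 / 4" by blast
        then show False using dist_nat_lipschitz[of r s] unfolding e_def by (auto simp: abs_le_iff abs_if split: if_splits)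
      qed
      then show "pts (E_app k x (p a)) \<subseteq> {r. dist_nat r \<le> 1 / 4}" unfolding r by simp
    qed
    then have "N_per (Suc k) (lift k p x) (lift k p x')"
      unfolding N_per_Suc using scott_contD(1)[OF scott_cont_lift[OF p]] F N_app_lift[OF p F(1)] N_app_lift[OF p F(2)]
      by simp
    then show ?thesis using lift_chop_lub[OF p F(1)] lift_chop_lub[OF p F(2)] by blast
  qed
qed

lemma nint_const_lub: "is_lub (N 0) (range (\<lambda>m :: nat. nint x)) (nint x)"
  using nint_Field po_refl[OF sd_po[OF scott_domain_N] nint_Field] by (intro is_lubI) auto

text \<open>At the base level one test, the identity, suffices, and rounding does not depend on the
  stage; all chains are constant.\<close>

lemma extension_0: "extension 0 (\<lambda>i. {\<lambda>x. x}) (\<lambda>i. nint) (\<lambda>m. nint)"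
proof
  show "scott_cont (E 0) (E 0) g" if "g \<in> {\<lambda>x. x}" for g :: "real set set elt \<Rightarrow> real set set elt"
    using that unfolding scott_cont_def by simp
  show "\<exists>b b'. is_lub (N 0) (range (\<lambda>m :: nat. nint x)) b \<and> is_lub (N 0) (range (\<lambda>m :: nat. nint x')) b' \<and> N_per 0 b b'"
    if "E_per 0 x x'" "\<And>i g. g \<in> {\<lambda>x. x} \<Longrightarrow> pts (g x) \<subseteq> {r. dist_nat r \<le> 1 / 4}" for x x'
    using nint_const_lub nint_total[OF that(1)] that(2) by blast
  show "N_per 0 (nint x) (nint x')"
    if "E_per 0 x x'" "\<And>g. g \<in> {\<lambda>x. x} \<Longrightarrow> pts (g x) \<subseteq> {r. dist_nat r \<le> 1 / 4}" for x x'
    using nint_total[OF that(1)] that(2) by blast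
qed (auto intro: scott_cont_nint po_refl[OF sd_po[OF scott_domain_N] nint_Field])

text \<open>The recursion descends by two levels: arguments in \<open>E (Suc k)\<close> are compared
  with functionals on \<open>N k\<close> by composing with \<open>emb k\<close>. Level 1 is separate
  because its arguments are rounded directly.\<close>

fun emb :: "nat \<Rightarrow> nat option elt \<Rightarrow> real set set elt" where
  "emb 0 = rep"
| "emb (Suc 0) = extension.extend 0 (\<lambda>i. {\<lambda>x. x}) (\<lambda>i. nint) (\<lambda>m. nint)"
| "emb (Suc (Suc k)) = extension.extend (Suc k) (tests k (emb k))
     (\<lambda>i. lift k (\<lambda>a. emb k (trunc (cap i) k a))) (\<lambda>m. lift k (\<lambda>a. emb k (trunc (chop m) k a)))"

lemma emb_total:
  "scott_cont (N k) (E k) (emb k) \<and> (\<forall>a b. N_per k a b \<longrightarrow> E_per k (emb k a) (emb k b))"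
proof (induction k rule: emb.induct[case_names 0 1 2])
  case 0
  have "E_per 0 (rep a) (rep b)" if "N_per 0 a b" for a b
    using that ideal_nat_rep Inter_nat_rep unfolding N_per_0 E_per_0 by (auto simp: rep_def Field_E0)
  then show ?case using scott_cont_rep by simp
next
  case 1
  show ?case
    using extension.scott_cont_extend[OF extension_0] extension.extend_total[OF extension_0] by simp
next
  case (2 k)
  then have "extension (Suc k) (tests k (emb k)) (\<lambda>i. lift k (\<lambda>a. emb k (trunc (cap i) k a)))
      (\<lambda>m. lift k (\<lambda>a. emb k (trunc (chop m) k a)))" by (intro extension_Suc) auto
  from extension.scott_cont_extend[OF this] extension.extend_total[OF this] show ?case by simp
qed

text \<open>By induction, rounding \<open>emb (Suc k) f\<close> along \<open>emb k\<close> gives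
  back a functional equivalent to \<open>f\<close>, and the tests at \<open>emb (Suc k) f\<close>
  are natural numbers; \<open>extend_exact\<close> then applies.\<close>

lemma emb_app:
  "N_per (Suc k) f f \<Longrightarrow> N_per k a a \<Longrightarrow> E_app k (emb (Suc k) f) (emb k a) = rep (N_app k f a)"
proof (induction k arbitrary: f a)
  case 0
  obtain n where n: "a = Base (Some n)" using 0(2) unfolding N_per_0 by blast
  obtain l where l: "N_app 0 f a = Base (Some l)" using N_per_app[OF 0] unfolding N_per_0 by blast
  have "E_app 0 (extension.extend 0 (\<lambda>i. {\<lambda>x. x}) (\<lambda>i. nint) (\<lambda>m. nint) f) (rep a) = Base (nat_rep l)"
  proof (rule extension.extend_exact[OF extension_0 N_per_Field(1)[OF 0(1)] _ _ nint_const_lub])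
    show "rep a \<in> Field (E 0)" using scott_contD(1)[OF scott_cont_rep N_per_Field(1)[OF 0(2)]] .
    show "N_app 0 f (nint (rep a)) = Base (Some l)" using l nint_rep n by simp
    show "\<exists>j. pts (g (rep a)) = {real j}" if "g \<in> {\<lambda>x. x}" for g
      using that n Inter_nat_rep by (auto simp: rep_def)
  qed
  then show ?case using l by (simp add: rep_def)
next
  case (Suc k F f)
  note p = emb_total[of k, THEN conjunct1] and tot = emb_total[of k, THEN conjunct2, rule_format]
  note q = emb_total[of "Suc k", THEN conjunct1]
  have x: "emb (Suc k) f \<in> Field (E (Suc k))" using scott_contD(1)[OF q N_per_Field(1)[OF Suc.prems(2)]] .
  obtain l where l: "N_app (Suc k) F f = Base (Some l)" using N_per_app[OF Suc.prems] unfolding N_per_0 by blast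
  \<comment> \<open>The two functionals agree on total arguments but need not be equal; equivalence
    suffices because \<open>F\<close> is total.\<close>
  have "N_per (Suc k) (lift k (emb k) (emb (Suc k) f)) f"
    unfolding N_per_Suc
  proof (intro conjI ballI impI)
    show "lift k (emb k) (emb (Suc k) f) \<in> Field (N (Suc k))" using scott_contD(1)[OF scott_cont_lift[OF p] x] .
    show "f \<in> Field (N (Suc k))" using N_per_Field(1)[OF Suc.prems(2)] .
    fix a b assume a: "a \<in> Field (N k)" and ab: "N_per k a b"
    obtain n where n: "N_app k f a = Base (Some n)" "N_app k f b = Base (Some n)"
      using N_per_app[OF Suc.prems(2) ab] unfolding N_per_0 by blast
    have "N_per k a a" using N_per_tot[OF ab] N_tot_iff by blast
    then have "N_app k (lift k (emb k) (emb (Suc k) f)) a = Base (Some n)"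
      using N_app_lift[OF p x a] Suc.IH[OF Suc.prems(2)] n nint_rep by simp
    then show "N_per 0 (N_app k (lift k (emb k) (emb (Suc k) f)) a) (N_app k f b)"
      using n by (simp add: N_per_0)
  qed
  from N_per_app[OF Suc.prems(1) this]
  have b: "N_app (Suc k) F (lift k (emb k) (emb (Suc k) f)) = Base (Some l)" using l unfolding N_per_0 by auto
  have "E_app (Suc k) (emb (Suc (Suc k)) F) (emb (Suc k) f) = Base (nat_rep l)"
    unfolding emb.simps(3)
  proof (rule extension.extend_exact[OF extension_Suc[OF p tot] N_per_Field(1)[OF Suc.prems(1)] x _ lift_chop_lub[OF p x] b])
    fix i g assume "g \<in> tests k (emb k) i"
    then obtain a where a: "N_per k a a" "g = (\<lambda>x. E_app k x (emb k (trunc (cap i) k a)))"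
      unfolding tests_def N_tot_iff[symmetric] by blast
    obtain n where "N_app k f (trunc (cap i) k a) = Base (Some n)"
      using N_per_app[OF Suc.prems(2) trunc_cap_total[OF a(1)]] unfolding N_per_0 by blast
    then have "g (emb (Suc k) f) = Base (nat_rep n)"
      unfolding a(2) using Suc.IH[OF Suc.prems(2) trunc_cap_total[OF a(1)]] by (simp add: rep_def)
    then show "\<exists>j. pts (g (emb (Suc k) f)) = {real j}" using Inter_nat_rep by auto
  qed
  then show ?case using l by (simp add: rep_def)
qed

theorem theorem3p1:
  shows "\<exists>\<pi> :: nat \<Rightarrow> nat option elt \<Rightarrow> real set set elt.
    (\<forall>k. scott_cont (N k) (E k) (\<pi> k)) \<and>
    (\<forall>k. \<pi> k ` N_tot k \<subseteq> E_tot k) \<and>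
    (\<forall>n. \<pi> 0 (Base (Some n)) = Base (nat_rep n)) \<and>
    (\<forall>k. \<forall>f\<in>N_tot (Suc k). \<forall>a\<in>N_tot k.
       \<pi> 0 (N_app k f a) = E_app k (\<pi> (Suc k) f) (\<pi> k a))"
proof (intro exI[of _ emb] conjI allI ballI)
  show "scott_cont (N k) (E k) (emb k)" for k using emb_total by blast
  show "emb k ` N_tot k \<subseteq> E_tot k" for k using emb_total N_tot_iff E_tot_iff by blast
  show "emb 0 (Base (Some n)) = Base (nat_rep n)" for n by (simp add: rep_def)
  show "emb 0 (N_app k f a) = E_app k (emb (Suc k) f) (emb k a)"
    if "f \<in> N_tot (Suc k)" "a \<in> N_tot k" for k f a
    using emb_app that unfolding N_tot_iff by simp
qed

end
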